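(* There exists $C\ge0$ depending on $T$, $q$, $\|M_0\|$, $\|M_1\|$, $\gamma$ and $\rho$ such that $$\sup_{t\in[0,T]}\langle M_0\xi(t),\xi(t)\rangle_H\le C e^{2\rho T}\Big(|||\partial_t M_0(U-\widehat P U)|||_{Q,\rho}^2+T\max_{1\le m\le M}\big\{|M_0\eta^+_{m-1}|_H^2\,e^{-2\rho t_{m-1}}\big\}\Big),$$ where $\xi=U^\tau-PU$, $\eta=U-PU$ and $\eta^+_{m-1}=\eta(t_{m-1}+)$.
   Context: $H$ is a real Hilbert space with inner product $\langle\cdot,\cdot\rangle_H$ and norm $|\cdot|_H$. For $\rho>0$, $H_\rho(\mathbb R;H)$ is the Hilbert space of (classes of) measurable $f:\mathbb R\to H$ with $|f|_\rho^2:=\int_{\mathbb R}|f(t)|_H^2e^{-2\rho t}\,dt<\infty$; $\partial_t$ is the closure in $H_\rho(\mathbb R;H)$ of $\phi\mapsto\phi'$ on $C_c^\infty(\mathbb R;H)$, and $H^k_\rho(\mathbb R;H)$ is the domain of $\partial_t^k$ (its elements are identified with continuous representatives for $k\ge1$). $M_0,M_1:H\to H$ are bounded linear operators, $M_0$ is selfadjoint, and $A:D(A)\subseteq H\to H$ is skew-selfadjoint, i.e. $A^*=-A$. There are $\rho_0>0$, $\gamma>0$ such that $\langle(\rho M_0+M_1)x,x\rangle_H\ge\gamma\langle x,x\rangle_H$ for all $\rho\ge\rho_0$, $x\in H$. Fix $\rho\ge\rho_0$, $T>0$, $q\in\mathbb N$, and a partition $0=t_0<\dots<t_M=T$; $I_m=(t_{m-1},t_m]$,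 $\tau_m=t_m-t_{m-1}$. $\mathcal U^\tau$ is the space of functions $u:(0,T]\to H$ such that $u|_{I_m}$ is an $H$-valued polynomial of degree at most $q$ for each $m$; $\partial_t$ acts piecewise on each $I_m$ on piecewise smooth functions, and $M_0,M_1,A$ act pointwise in $t$. Quadrature: $-1<\hat t^m_0<\dots<\hat t^m_q=1$ and $\omega^m_i$ are the nodes and weights of the right-sided weighted Gauss–Radau rule: $\int_{-1}^1 e^{-\rho\tau_m(t+1)}p(t)\,dt=\sum_{i=0}^q\omega^m_ip(\hat t^m_i)$ for all polynomials $p$ of degree at most $2q$. With $t_{m,i}=\frac{t_{m-1}+t_m}{2}+\frac{\tau_m}{2}\hat t^m_i$ set $Q_m[v]=\frac{\tau_m}{2}\sum_{i=0}^q\omega_i^mv(t_{m,i})$, $Q_m[a,b]_\rho=Q_m[\langle a,b\rangle_H]$, and $|||v|||_{Q,\rho}^2=\sum_{m=1}^M Q_m[v,v]_\rho\,e^{-2\rho t_{m-1}}$. Interpolation: for continuous $v:[0,T]\to H$, $Pv$ satisfies $(Pv)(0)=v(0)$ and on $I_m$ it is the polynomial of degree at most $q$ interpolating $v$ at $t_{m,0},\dots,t_{m,q}$; $\widehat Pv$ is on $I_m$ the polynomial of degree at most $q+1$ interpolating $v$ at $t_{m,-1}:=t_{m-1},t_{m,0},\dots,t_{m,q}$. Exact and discrete solutions: $F\in H_\rho^2(\mathbb R;H)$ is fixed, and $U\in H^2_\rho(\mathbb R;H)$ is the unique solution of $(\partial_tM_0+M_1+A)U=F$ (then $U$ is continuous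 with values in $D(A)$). $U^\tau\in\mathcal U^\tau$ is the unique function (with values in $D(A)$) satisfying, with $x_0=U(0+)$, for all $\Phi\in\mathcal U^\tau$ and $m\in\{1,\dots,M\}$, $$Q_m[(\partial_tM_0+M_1+A)U^\tau,\Phi]_\rho+\langle M_0[[U^\tau]]_{m-1}^{x_0},\Phi(t_{m-1}+)\rangle_H=Q_m[PF,\Phi]_\rho,$$ where $[[V]]_{m-1}^{x}=V(t_{m-1}+)-V(t_{m-1}-)$ for $m\ge2$ and $[[V]]_0^{x}=V(t_0+)-x$. At $t=0$ one uses $U^\tau(0):=x_0$, so $\xi(0)=0$. *)

theory Defs
  imports "HOL-Analysis.Analysis"
begin

section \<open>Unbounded operators\<close>

text \<open>An operator is a pair of a domain \<open>D\<close> and a total function \<open>A\<close> whose values outside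
  \<open>D\<close> are irrelevant.\<close>

definition densely_defined_op :: "'h::real_inner set \<Rightarrow> ('h \<Rightarrow> 'h) \<Rightarrow> bool" where
  "densely_defined_op D A \<longleftrightarrow> subspace D \<and> closure D = UNIV \<and>
     (\<forall>x\<in>D. \<forall>y\<in>D. A (x + y) = A x + A y) \<and> (\<forall>c. \<forall>x\<in>D. A (c *\<^sub>R x) = c *\<^sub>R A x)"

definition op_graph :: "'h::real_inner set \<Rightarrow> ('h \<Rightarrow> 'h) \<Rightarrow> ('h \<times> 'h) set" where
  "op_graph D A = {(x, A x) | x. x \<in> D}"

text \<open>The graph of \<open>A\<^sup>*\<close>; it is single-valued because \<open>D\<close> is dense.\<close>

definition adjoint_graph :: "'h::real_inner set \<Rightarrow> ('h \<Rightarrow> 'h) \<Rightarrow> ('h \<times> 'h) set" where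
  "adjoint_graph D A = {(y, z). \<forall>x\<in>D. inner (A x) y = inner x z}"

definition selfadjoint_op :: "'h::real_inner set \<Rightarrow> ('h \<Rightarrow> 'h) \<Rightarrow> bool" where
  "selfadjoint_op D A \<longleftrightarrow> densely_defined_op D A \<and> adjoint_graph D A = op_graph D A"

definition skew_selfadjoint_op :: "'h::real_inner set \<Rightarrow> ('h \<Rightarrow> 'h) \<Rightarrow> bool" where
  "skew_selfadjoint_op D A \<longleftrightarrow>
     densely_defined_op D A \<and> adjoint_graph D A = op_graph D (\<lambda>x. - A x)"

section \<open>Exponentially weighted spaces on the real line\<close>

text \<open>Bochner measurability; a separate notion is needed because the Hilbert space need not be
  separable. Elements of the weighted spaces are represented by functions, not by classes.\<close>

definition strongly_measurable :: "(real \<Rightarrow> 'h::real_normed_vector) \<Rightarrow> bool" where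
  "strongly_measurable f \<longleftrightarrow>
     (\<exists>s. (\<forall>n. simple_function lebesgue (s n)) \<and>
          (AE x in lebesgue. (\<lambda>n::nat. s n x) \<longlonglongrightarrow> f x))"

definition wnorm_sq :: "real \<Rightarrow> (real \<Rightarrow> 'h::real_normed_vector) \<Rightarrow> ennreal" where
  "wnorm_sq \<rho> f = (\<integral>\<^sup>+ s. ennreal ((norm (f s))\<^sup>2 * exp (- 2 * \<rho> * s)) \<partial>lebesgue)"

definition L2w :: "real \<Rightarrow> (real \<Rightarrow> 'h::real_normed_vector) set" where
  "L2w \<rho> = {f. strongly_measurable f \<and> wnorm_sq \<rho> f < \<infinity>}"

definition test_function :: "(real \<Rightarrow> 'h::real_normed_vector) \<Rightarrow> bool" where
  "test_function \<phi> \<longleftrightarrow>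
     (\<exists>d. d 0 = \<phi> \<and> (\<forall>n::nat. \<forall>s. (d n has_vector_derivative d (Suc n) s) (at s))) \<and>
     (\<exists>R. \<forall>s. R < \<bar>s\<bar> \<longrightarrow> \<phi> s = 0)"

text \<open>\<open>dt_graph \<rho> f g\<close>: the pair \<open>(f, g)\<close> lies in the closure of the graph of
  \<open>\<phi> \<mapsto> \<phi>'\<close> on test functions, i.e. \<open>f\<close> is in the domain of the time derivative
  and \<open>g\<close> is its derivative.\<close>

definition dt_graph ::
  "real \<Rightarrow> (real \<Rightarrow> 'h::real_normed_vector) \<Rightarrow> (real \<Rightarrow> 'h) \<Rightarrow> bool" where
  "dt_graph \<rho> f g \<longleftrightarrow> f \<in> L2w \<rho> \<and> g \<in> L2w \<rho> \<and>
     (\<exists>\<phi>. (\<forall>n::nat. test_function (\<phi> n)) \<and>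
          (\<lambda>n. wnorm_sq \<rho> (\<lambda>s. \<phi> n s - f s)) \<longlonglongrightarrow> 0 \<and>
          (\<lambda>n. wnorm_sq \<rho> (\<lambda>s. vector_derivative (\<phi> n) (at s) - g s)) \<longlonglongrightarrow> 0)"

fun Hkw :: "nat \<Rightarrow> real \<Rightarrow> (real \<Rightarrow> 'h::real_normed_vector) set" where
  "Hkw 0 \<rho> = L2w \<rho>"
| "Hkw (Suc k) \<rho> = {f. \<exists>g. dt_graph \<rho> f g \<and> g \<in> Hkw k \<rho>}"

text \<open>\<open>U\<close> solves \<open>(\<partial>\<^sub>t M0 + M1 + A) U = F\<close> in the weighted space, where \<open>A\<close> acts on
  the square-integrable functions that are a.e. \<open>D\<close>-valued with \<open>A U\<close> square integrable.\<close>

definition solves_evo ::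
  "real \<Rightarrow> ('h::real_inner \<Rightarrow> 'h) \<Rightarrow> ('h \<Rightarrow> 'h) \<Rightarrow> 'h set \<Rightarrow> ('h \<Rightarrow> 'h) \<Rightarrow>
   (real \<Rightarrow> 'h) \<Rightarrow> (real \<Rightarrow> 'h) \<Rightarrow> bool" where
  "solves_evo \<rho> M0 M1 D A F U \<longleftrightarrow>
     U \<in> L2w \<rho> \<and> (AE s in lebesgue. U s \<in> D) \<and> (\<lambda>s. A (U s)) \<in> L2w \<rho> \<and>
     (\<exists>g. dt_graph \<rho> (\<lambda>s. M0 (U s)) g \<and>
          (AE s in lebesgue. g s + M1 (U s) + A (U s) = F s))"

section \<open>Partition and piecewise polynomials\<close>

definition is_partition :: "real \<Rightarrow> nat \<Rightarrow> (nat \<Rightarrow> real) \<Rightarrow> bool" where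
  "is_partition T N t \<longleftrightarrow> t 0 = 0 \<and> t N = T \<and> (\<forall>m<N. t m < t (Suc m))"

definition cell :: "(nat \<Rightarrow> real) \<Rightarrow> nat \<Rightarrow> real set" where
  "cell t m = {t (m - 1)<..t m}"

definition step :: "(nat \<Rightarrow> real) \<Rightarrow> nat \<Rightarrow> real" where
  "step t m = t m - t (m - 1)"

definition cell_index :: "nat \<Rightarrow> (nat \<Rightarrow> real) \<Rightarrow> real \<Rightarrow> nat" where
  "cell_index N t s = (THE m. m \<in> {1..N} \<and> s \<in> cell t m)"

definition vpoly_on :: "nat \<Rightarrow> real set \<Rightarrow> (real \<Rightarrow> 'h::real_vector) \<Rightarrow> bool" where
  "vpoly_on n S f \<longleftrightarrow> (\<exists>c. \<forall>s\<in>S. f s = (\<Sum>k\<le>n. (s ^ k) *\<^sub>R c k))"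

text \<open>The space \<open>\<U>\<^sup>\<tau>\<close>; values outside \<open>(0, T]\<close> are unconstrained.\<close>

definition pw_poly :: "nat \<Rightarrow> nat \<Rightarrow> (nat \<Rightarrow> real) \<Rightarrow> (real \<Rightarrow> 'h::real_vector) set" where
  "pw_poly q N t = {u. \<forall>m\<in>{1..N}. vpoly_on q (cell t m) u}"

text \<open>The derivative is taken within the cell, hence one-sided at its right end point.\<close>

definition pw_dt ::
  "nat \<Rightarrow> (nat \<Rightarrow> real) \<Rightarrow> (real \<Rightarrow> 'h::real_normed_vector) \<Rightarrow> real \<Rightarrow> 'h" where
  "pw_dt N t f s = vector_derivative f (at s within cell t (cell_index N t s))"

definition right_lim :: "(real \<Rightarrow> 'h::t2_space) \<Rightarrow> real \<Rightarrow> 'h" where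
  "right_lim f s = Lim (at_right s) f"

definition left_lim :: "(real \<Rightarrow> 'h::t2_space) \<Rightarrow> real \<Rightarrow> 'h" where
  "left_lim f s = Lim (at_left s) f"

text \<open>\<open>jump t x V m\<close> is the jump of \<open>V\<close> at \<open>t (m - 1)\<close>, for \<open>m \<ge> 1\<close>.\<close>

definition jump ::
  "(nat \<Rightarrow> real) \<Rightarrow> 'h::real_normed_vector \<Rightarrow> (real \<Rightarrow> 'h) \<Rightarrow> nat \<Rightarrow> 'h" where
  "jump t x V m =
     right_lim V (t (m - 1)) - (if m = 1 then x else left_lim V (t (m - 1)))"

section \<open>Quadrature\<close>

definition gauss_radau ::
  "real \<Rightarrow> real \<Rightarrow> nat \<Rightarrow> (nat \<Rightarrow> real) \<Rightarrow> (nat \<Rightarrow> real) \<Rightarrow> bool" where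
  "gauss_radau \<rho> \<tau> q x w \<longleftrightarrow>
     - 1 < x 0 \<and> (\<forall>i<q. x i < x (Suc i)) \<and> x q = 1 \<and>
     (\<forall>p::real poly. degree p \<le> 2 * q \<longrightarrow>
        integral {-1..1} (\<lambda>s. exp (- \<rho> * \<tau> * (s + 1)) * poly p s)
          = (\<Sum>i\<le>q. w i * poly p (x i)))"

definition node :: "(nat \<Rightarrow> real) \<Rightarrow> (nat \<Rightarrow> nat \<Rightarrow> real) \<Rightarrow> nat \<Rightarrow> nat \<Rightarrow> real" where
  "node t x m i = (t (m - 1) + t m) / 2 + step t m / 2 * x m i"

definition Qm ::
  "nat \<Rightarrow> (nat \<Rightarrow> real) \<Rightarrow> (nat \<Rightarrow> nat \<Rightarrow> real) \<Rightarrow> (nat \<Rightarrow> nat \<Rightarrow> real) \<Rightarrow> nat \<Rightarrow>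
   (real \<Rightarrow> real) \<Rightarrow> real" where
  "Qm q t x w m v = step t m / 2 * (\<Sum>i\<le>q. w m i * v (node t x m i))"

definition Qm_inner ::
  "nat \<Rightarrow> (nat \<Rightarrow> real) \<Rightarrow> (nat \<Rightarrow> nat \<Rightarrow> real) \<Rightarrow> (nat \<Rightarrow> nat \<Rightarrow> real) \<Rightarrow> nat \<Rightarrow>
   (real \<Rightarrow> 'h::real_inner) \<Rightarrow> (real \<Rightarrow> 'h) \<Rightarrow> real" where
  "Qm_inner q t x w m a b = Qm q t x w m (\<lambda>s. inner (a s) (b s))"

definition Qnorm_sq ::
  "real \<Rightarrow> nat \<Rightarrow> nat \<Rightarrow> (nat \<Rightarrow> real) \<Rightarrow> (nat \<Rightarrow> nat \<Rightarrow> real) \<Rightarrow> (nat \<Rightarrow> nat \<Rightarrow> real) \<Rightarrow>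
   (real \<Rightarrow> 'h::real_inner) \<Rightarrow> real" where
  "Qnorm_sq \<rho> q N t x w v =
     (\<Sum>m=1..N. Qm_inner q t x w m v v * exp (- 2 * \<rho> * t (m - 1)))"

section \<open>Interpolation\<close>

text \<open>The Lagrange form of the polynomial of degree at most \<open>n\<close> that interpolates \<open>v\<close> at
  \<open>y 0, \<dots>, y n\<close>; the three lemmas below establish this.\<close>

definition interpolant ::
  "nat \<Rightarrow> (nat \<Rightarrow> real) \<Rightarrow> (real \<Rightarrow> 'h::real_vector) \<Rightarrow> real \<Rightarrow> 'h" where
  "interpolant n y v s = (\<Sum>i\<le>n. (\<Prod>j\<in>{..n} - {i}. (s - y j) / (y i - y j)) *\<^sub>R v (y i))"

lemma interpolant_at_node:
  assumes "inj_on y {..n}" and "k \<le> n"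
  shows "interpolant n y v (y k) = v (y k)"
proof -
  have "(\<Prod>j\<in>{..n} - {i}. (y k - y j) / (y i - y j)) = (if i = k then 1 else 0)"
    if "i \<le> n" for i
  proof (cases "i = k")
    case True
    have "(y k - y j) / (y k - y j) = 1" if "j \<in> {..n} - {k}" for j
      using that assms by (auto simp: inj_on_def)
    then show ?thesis using True by simp
  next
    case False
    then show ?thesis using assms(2) by (auto intro!: prod_zero)
  qed
  then have "interpolant n y v (y k) = (\<Sum>i\<le>n. (if i = k then v (y i) else 0))"
    unfolding interpolant_def by (intro sum.cong) auto
  then show ?thesis using assms(2) by simp
qed

lemma vpoly_on_interpolant: "vpoly_on n S (interpolant n y v)"
proof -
  define L where "L i = (\<Prod>j\<in>{..n} - {i}. smult (1 / (y i - y j)) [:- y j, 1:])" for i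
  have ev: "poly (L i) s = (\<Prod>j\<in>{..n} - {i}. (s - y j) / (y i - y j))" for i s
    unfolding L_def poly_prod by (intro prod.cong) (auto simp: diff_divide_distrib)
  have deg: "degree (L i) \<le> n" if "i \<le> n" for i
  proof -
    have "degree (L i) \<le> (\<Sum>j\<in>{..n} - {i}. degree (smult (1 / (y i - y j)) [:- y j, 1:]))"
      unfolding L_def using degree_prod_sum_le[of "{..n} - {i}" "\<lambda>j. smult (1 / (y i - y j)) [:- y j, 1:]"]
      by (simp add: o_def)
    also have "\<dots> \<le> (\<Sum>j\<in>{..n} - {i}. 1)"
      by (intro sum_mono order_trans[OF degree_smult_le]) simp
    also have "\<dots> = n" using that by simp
    finally show ?thesis .
  qed
  have "interpolant n y v s = (\<Sum>k\<le>n. (s ^ k) *\<^sub>R (\<Sum>i\<le>n. coeff (L i) k *\<^sub>R v (y i)))" for s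
  proof -
    have "poly (L i) s = (\<Sum>k\<le>n. coeff (L i) k * s ^ k)" if "i \<le> n" for i
      unfolding poly_altdef using deg[OF that]
      by (intro sum.mono_neutral_left) (auto simp: coeff_eq_0)
    then have "interpolant n y v s = (\<Sum>i\<le>n. \<Sum>k\<le>n. (coeff (L i) k * s ^ k) *\<^sub>R v (y i))"
      unfolding interpolant_def ev[symmetric] by (intro sum.cong) (auto simp: scaleR_left.sum)
    also have "\<dots> = (\<Sum>k\<le>n. \<Sum>i\<le>n. (coeff (L i) k * s ^ k) *\<^sub>R v (y i))"
      by (rule sum.swap)
    finally show ?thesis by (simp add: scaleR_right.sum mult.commute)
  qed
  then show ?thesis
    unfolding vpoly_on_def
    by (intro exI[of _ "\<lambda>k. \<Sum>i\<le>n. coeff (L i) k *\<^sub>R v (y i)"]) simp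
qed

lemma interpolant_unique:
  fixes v :: "real \<Rightarrow> 'h::real_inner"
  assumes "inj_on y {..n}" and "vpoly_on n UNIV p" and "\<And>k. k \<le> n \<Longrightarrow> p (y k) = v (y k)"
  shows "p = interpolant n y v"
proof
  fix s
  from assms(2) obtain c where c: "\<And>s. p s = (\<Sum>k\<le>n. (s ^ k) *\<^sub>R c k)"
    unfolding vpoly_on_def by auto
  from vpoly_on_interpolant[of n UNIV y v] obtain d
    where d: "\<And>s. interpolant n y v s = (\<Sum>k\<le>n. (s ^ k) *\<^sub>R d k)"
    unfolding vpoly_on_def by auto
  define z where "z = p s - interpolant n y v s"
  define r where "r = (\<Sum>k\<le>n. monom (inner (c k - d k) z) k)"
  have r: "poly r u = inner (p u - interpolant n y v u) z" for u
    unfolding r_def c d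
    by (simp add: poly_sum poly_monom inner_sum_left inner_diff_left sum_subtractf
        algebra_simps)
  have "degree r \<le> n"
    unfolding r_def by (intro degree_sum_le) (auto intro: order_trans[OF degree_monom_le])
  moreover have "poly r (y k) = 0" if "k \<le> n" for k
    using that assms interpolant_at_node[OF assms(1) that, of v] by (simp add: r)
  then have sub: "y ` {..n} \<subseteq> {u. poly r u = 0}" by auto
  have "r = 0"
  proof (rule ccontr)
    assume "r \<noteq> 0"
    then have "card (y ` {..n}) \<le> card {u. poly r u = 0}"
      by (intro card_mono sub poly_roots_finite)
    also have "\<dots> \<le> degree r" using \<open>r \<noteq> 0\<close> by (rule card_poly_roots_bound)
    finally show False using \<open>degree r \<le> n\<close> assms(1) by (simp add: card_image)
  qed
  then have "inner z z = 0" using r[of s] by (simp add: z_def)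
  then show "p s = interpolant n y v s" by (simp add: z_def)
qed

definition interp_P ::
  "nat \<Rightarrow> nat \<Rightarrow> (nat \<Rightarrow> real) \<Rightarrow> (nat \<Rightarrow> nat \<Rightarrow> real) \<Rightarrow>
   (real \<Rightarrow> 'h::real_vector) \<Rightarrow> real \<Rightarrow> 'h" where
  "interp_P q N t x v s =
     (if s = 0 then v 0 else interpolant q (node t x (cell_index N t s)) v s)"

text \<open>The additional node \<open>t (m - 1)\<close> is put in front of the quadrature nodes. The value at
  \<open>0\<close> is the one-sided limit of the first piece.\<close>

definition interp_P_hat ::
  "nat \<Rightarrow> nat \<Rightarrow> (nat \<Rightarrow> real) \<Rightarrow> (nat \<Rightarrow> nat \<Rightarrow> real) \<Rightarrow>
   (real \<Rightarrow> 'h::real_vector) \<Rightarrow> real \<Rightarrow> 'h" where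
  "interp_P_hat q N t x v s =
     (if s = 0 then v 0
      else let m = cell_index N t s
           in interpolant (Suc q) (case_nat (t (m - 1)) (node t x m)) v s)"

section \<open>The discrete problem\<close>

text \<open>Values of a solution outside \<open>(0, T]\<close> are not constrained here.\<close>

definition discrete_solution ::
  "nat \<Rightarrow> nat \<Rightarrow> (nat \<Rightarrow> real) \<Rightarrow> (nat \<Rightarrow> nat \<Rightarrow> real) \<Rightarrow> (nat \<Rightarrow> nat \<Rightarrow> real) \<Rightarrow>
   ('h::real_inner \<Rightarrow> 'h) \<Rightarrow> ('h \<Rightarrow> 'h) \<Rightarrow> 'h set \<Rightarrow> ('h \<Rightarrow> 'h) \<Rightarrow>
   (real \<Rightarrow> 'h) \<Rightarrow> 'h \<Rightarrow> (real \<Rightarrow> 'h) \<Rightarrow> bool" where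
  "discrete_solution q N t x w M0 M1 D A F x0 V \<longleftrightarrow>
     V \<in> pw_poly q N t \<and> (\<forall>s\<in>{0<..t N}. V s \<in> D) \<and>
     (\<forall>\<Phi>\<in>pw_poly q N t. \<forall>m\<in>{1..N}.
        Qm_inner q t x w m
            (\<lambda>s. pw_dt N t (\<lambda>r. M0 (V r)) s + M1 (V s) + A (V s)) \<Phi>
          + inner (M0 (jump t x0 V m)) (right_lim \<Phi> (t (m - 1)))
        = Qm_inner q t x w m (interp_P q N t x F) \<Phi>)"

end

theory Submission
  imports Defs
begin

text \<open>
  On a cell, \<open>P_hat U - P U\<close> is \<open>\<theta>(t) \<eta>(t\<^sub>m\<^sub>-\<^sub>1+)\<close>, where the scalar polynomial \<open>\<theta>\<close> is \<open>1\<close> at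
  \<open>t\<^sub>m\<^sub>-\<^sub>1\<close> and vanishes at the Gauss--Radau nodes. Integrating by parts, the error \<open>\<xi>\<close> solves the
  discrete problem with right-hand side
  \<open>Q\<^sub>m[\<partial>\<^sub>t M\<^sub>0 (U - P_hat U), \<Phi>] + 2 \<rho> \<integral> \<theta> (M\<^sub>0 \<eta>, \<Phi>) exp(-2 \<rho> (t - t\<^sub>m\<^sub>-\<^sub>1))\<close>.
  Testing with \<open>\<xi>\<close> and summing over the cells bounds \<open>\<xi>\<close> in the quadrature norm, \<open>(M\<^sub>0 \<xi>, \<xi>)\<close> at
  the grid points, and the jumps. Inside a cell one tests with the interpolant of
  \<open>\<xi>(t) / (t - t\<^sub>m\<^sub>-\<^sub>1)\<close>: the positive factor keeps the skew term zero, and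
  after adding \<open>\<theta>\<close> times the jump to make the error continuous, the time derivative controls
  the cell maximum of \<open>(M\<^sub>0 \<xi>, \<xi>)\<close> through an inverse inequality. All constants are uniform in the
  step size since the first node has distance at least a fixed multiple of the step size from
  \<open>t\<^sub>m\<^sub>-\<^sub>1\<close>. The equation holds pointwise at the nodes because \<open>U\<close> is continuously
  differentiable and \<open>A\<close> is closed.
\<close>

section \<open>Vector-valued polynomials and Gauss--Radau quadrature on a cell\<close>

text \<open>The energy test bounds the quadrature norm of \<xi> without a factor equal to the step
  size, so an inverse inequality applied to it directly would lose one power of the step. Nor can
  \<xi> be cut off at an intermediate time, since test functions are polynomials on each cell. The
  weight 1 / (t - t(m-1)) repairs this. Write \<xi> = z + (t - t(m-1)) w at the nodes, where z is
  the error entering the cell. The second test bounds the step times Q[M0 w, w]; hence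
  Q[M0 \<xi>, \<xi>] is of the order of the step, and the inverse inequality costs nothing. M0 may
  be degenerate. It is nonnegative because coercivity holds for all large parameters, and w is only
  ever measured in this semidefinite form. The degree count is tight: the products that occur reach
  degree 2q, where the rule is exact, except \<theta> times a test function, of degree 2q + 1. This
  is why an integral, and not a quadrature value, remains on the right of the error
  equation.\<close>

lemma vpoly_on_mono: "vpoly_on m S f" if "vpoly_on n S f" "n \<le> m"
proof -
  from that(1) obtain c where c: "\<forall>s\<in>S. f s = (\<Sum>k\<le>n. (s ^ k) *\<^sub>R c k)"
    unfolding vpoly_on_def by blast
  have "\<forall>s\<in>S. f s = (\<Sum>k\<le>m. (s ^ k) *\<^sub>R (if k \<le> n then c k else 0))"
  proof
    fix s assume "s \<in> S"
    have "(\<Sum>k\<le>m. (s ^ k) *\<^sub>R (if k \<le> n then c k else 0)) = (\<Sum>k\<le>n. (s ^ k) *\<^sub>R c k)"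
      using that(2) by (intro sum.mono_neutral_cong_right) auto
    then show "f s = (\<Sum>k\<le>m. (s ^ k) *\<^sub>R (if k \<le> n then c k else 0))"
      using c \<open>s \<in> S\<close> by simp
  qed
  then show ?thesis unfolding vpoly_on_def by (intro exI[of _ "\<lambda>k. if k \<le> n then c k else 0"])
qed

lemma vpoly_on_subset: "vpoly_on n S f \<Longrightarrow> S' \<subseteq> S \<Longrightarrow> vpoly_on n S' f"
  unfolding vpoly_on_def by blast

text \<open>A discrete solution is polynomial only on the half-open cells. Extending each piece to
  the line makes its right limit at the left end point an ordinary value.\<close>

lemma vpoly_on_extend:
  assumes "vpoly_on n S f"
  obtains g where "vpoly_on n UNIV g" "\<And>s. s \<in> S \<Longrightarrow> f s = g s"
  using assms unfolding vpoly_on_def by fastforce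

lemma vpoly_on_monom: "k \<le> n \<Longrightarrow> vpoly_on n S (\<lambda>s. (s ^ k) *\<^sub>R c)"
  unfolding vpoly_on_def
  by (intro exI[of _ "\<lambda>i. if i = k then c else 0"]) (simp add: if_distrib cong: if_cong)

lemma vpoly_on_const: "vpoly_on n S (\<lambda>s. c)"
  using vpoly_on_monom[of 0 n S c] by simp

lemma vpoly_on_ident: "1 \<le> n \<Longrightarrow> vpoly_on n S (\<lambda>s. s)"
  using vpoly_on_monom[of 1 n S "1::real"] by simp

lemma vpoly_on_add: "vpoly_on n S f \<Longrightarrow> vpoly_on n S g \<Longrightarrow> vpoly_on n S (\<lambda>s. f s + g s)"
  unfolding vpoly_on_def
  apply (elim exE)
  subgoal for c d by (intro exI[of _ "\<lambda>k. c k + d k"]) (simp add: scaleR_add_right sum.distrib)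
  done

lemma vpoly_on_bounded_linear:
  assumes "bounded_linear B" "vpoly_on n S f"
  shows "vpoly_on n S (\<lambda>s. B (f s))"
proof -
  interpret bounded_linear B by fact
  from assms(2) show ?thesis unfolding vpoly_on_def
    apply (elim exE)
    subgoal for c by (intro exI[of _ "\<lambda>k. B (c k)"]) (simp add: sum scale)
    done
qed

lemma vpoly_on_scaleR_const:
  fixes f :: "real \<Rightarrow> 'a::real_normed_vector"
  shows "vpoly_on n S f \<Longrightarrow> vpoly_on n S (\<lambda>s. c *\<^sub>R f s)"
  by (rule vpoly_on_bounded_linear[OF bounded_linear_scaleR_right])

lemma vpoly_on_diff:
  fixes f :: "real \<Rightarrow> 'a::real_normed_vector"
  assumes "vpoly_on n S f" "vpoly_on n S g"
  shows "vpoly_on n S (\<lambda>s. f s - g s)"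
  using vpoly_on_add[OF assms(1) vpoly_on_scaleR_const[OF assms(2), of "-1"]] by simp

lemma vpoly_on_sum:
  "(\<And>i. i \<in> I \<Longrightarrow> vpoly_on n S (f i)) \<Longrightarrow> vpoly_on n S (\<lambda>s. \<Sum>i\<in>I. f i s)"
  by (induction I rule: infinite_finite_induct) (auto intro: vpoly_on_const vpoly_on_add)

lemma vpoly_on_bilinear:
  assumes "bounded_bilinear B" "vpoly_on m S f" "vpoly_on n S g"
  shows "vpoly_on (m + n) S (\<lambda>s. B (f s) (g s))"
proof -
  interpret bounded_bilinear B by fact
  from assms(2,3) obtain c d where
    c: "\<And>s. s \<in> S \<Longrightarrow> f s = (\<Sum>k\<le>m. (s ^ k) *\<^sub>R c k)" and
    d: "\<And>s. s \<in> S \<Longrightarrow> g s = (\<Sum>k\<le>n. (s ^ k) *\<^sub>R d k)"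
    unfolding vpoly_on_def by blast
  have "vpoly_on (m + n) S (\<lambda>s. \<Sum>i\<le>m. \<Sum>j\<le>n. (s ^ (i + j)) *\<^sub>R B (c i) (d j))"
    by (intro vpoly_on_sum vpoly_on_monom) auto
  moreover have "B (f s) (g s) = (\<Sum>i\<le>m. \<Sum>j\<le>n. (s ^ (i + j)) *\<^sub>R B (c i) (d j))"
    if "s \<in> S" for s
    using that by (simp add: c d sum_left sum_right scaleR_left scaleR_right power_add
        scaleR_sum_right sum.swap[of _ "{..n}" "{..m}"] mult.commute)
  ultimately show ?thesis unfolding vpoly_on_def by simp
qed

lemmas vpoly_on_scaleR = vpoly_on_bilinear[OF bounded_bilinear_scaleR]
  and vpoly_on_mult = vpoly_on_bilinear[OF bounded_bilinear_mult]
  and vpoly_on_inner = vpoly_on_bilinear[OF bounded_bilinear_inner]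

lemma vpoly_on_prod:
  fixes f :: "'i \<Rightarrow> real \<Rightarrow> real"
  assumes "finite I" "\<And>i. i \<in> I \<Longrightarrow> vpoly_on 1 S (f i)"
  shows "vpoly_on (card I) S (\<lambda>s. \<Prod>i\<in>I. f i s)"
  using assms
proof (induction I rule: finite_induct)
  case empty
  then show ?case by (simp add: vpoly_on_const)
next
  case (insert i I)
  then have "vpoly_on (1 + card I) S (\<lambda>s. f i s * (\<Prod>i\<in>I. f i s))"
    by (intro vpoly_on_mult) auto
  then show ?case using insert by simp
qed

lemma vpoly_on_affine:
  fixes a c :: real
  shows "vpoly_on 1 S (\<lambda>s. (s - a) / c)"
proof -
  have "vpoly_on 1 S (\<lambda>s. (1 / c) *\<^sub>R (s - a))"
    by (intro vpoly_on_scaleR_const vpoly_on_diff vpoly_on_ident vpoly_on_const) simp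
  then show ?thesis by simp
qed

text \<open>For \<open>n = 0\<close> truncated subtraction makes the degree bound
  \<open>n - 1\<close> equal to 0, which alone would admit a nonzero constant. The second conclusion
  keeps the information that the derivative vanishes; the degree counts below rely on it when
  \<open>q = 0\<close>.\<close>

lemma vpoly_on_has_derivative:
  fixes f :: "real \<Rightarrow> 'a::real_normed_vector"
  assumes "vpoly_on n UNIV f"
  obtains f' where "vpoly_on (n - 1) UNIV f'" "n = 0 \<Longrightarrow> f' = (\<lambda>s. 0)"
    "\<And>s. (f has_vector_derivative f' s) (at s)"
proof -
  from assms obtain c where c: "f = (\<lambda>s. \<Sum>k\<le>n. (s ^ k) *\<^sub>R c k)"
    unfolding vpoly_on_def by auto
  define f' where "f' s = (\<Sum>k\<le>n. (s ^ (k - 1)) *\<^sub>R (real k *\<^sub>R c k))" for s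
  have "vpoly_on (n - 1) UNIV f'"
    unfolding f'_def by (intro vpoly_on_sum vpoly_on_monom) auto
  moreover have "f' = (\<lambda>s. 0)" if "n = 0"
    using that by (simp add: f'_def[abs_def])
  moreover have "(f has_vector_derivative f' s) (at s)" for s
    unfolding c f'_def
    by (auto intro!: derivative_eq_intros sum.cong simp: mult.commute)
  ultimately show thesis using that by blast
qed

lemma vpoly_on_continuous:
  fixes f :: "real \<Rightarrow> 'a::real_normed_vector"
  assumes "vpoly_on n UNIV f"
  shows "continuous_on X f"
proof -
  from assms obtain c where c: "f = (\<lambda>s. \<Sum>k\<le>n. (s ^ k) *\<^sub>R c k)"
    unfolding vpoly_on_def by auto
  show ?thesis unfolding c by (intro continuous_intros)
qed

text \<open>The factor theorem for vector coefficients, from the factorisation of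
  \<open>s ^ k - a ^ k\<close> in each term of \<open>f s - f a\<close>.\<close>

lemma vpoly_on_divide_root:
  fixes f :: "real \<Rightarrow> 'a::real_normed_vector"
  assumes "vpoly_on (Suc n) UNIV f" "f a = 0"
  obtains g where "vpoly_on n UNIV g" "\<And>s. f s = (s - a) *\<^sub>R g s"
proof -
  from assms obtain c where c: "f = (\<lambda>s. \<Sum>k\<le>Suc n. (s ^ k) *\<^sub>R c k)"
    unfolding vpoly_on_def by auto
  define g where "g s = (\<Sum>k\<le>Suc n. \<Sum>i<k. (s ^ i) *\<^sub>R (a ^ (k - Suc i) *\<^sub>R c k))" for s
  have "vpoly_on n UNIV g"
    unfolding g_def by (intro vpoly_on_sum vpoly_on_monom) auto
  moreover have "f s = (s - a) *\<^sub>R g s" for s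
  proof -
    have "f s = f s - f a" using assms by simp
    also have "\<dots> = (\<Sum>k\<le>Suc n. (s ^ k - a ^ k) *\<^sub>R c k)"
      unfolding c by (simp only: sum_subtractf scaleR_diff_left)
    also have "\<dots> = (\<Sum>k\<le>Suc n. ((s - a) * (\<Sum>i<k. a ^ (k - Suc i) * s ^ i)) *\<^sub>R c k)"
      by (intro sum.cong refl) (simp add: power_diff_sumr2)
    also have "\<dots> = (s - a) *\<^sub>R g s"
      unfolding g_def by (simp only: scaleR_sum_right scaleR_scaleR scaleR_sum_left sum_distrib_left mult_ac)
    finally show ?thesis .
  qed
  ultimately show thesis using that by blast
qed

lemma vpoly_on_real_poly:
  fixes f :: "real \<Rightarrow> real"
  assumes "vpoly_on n UNIV f"
  obtains p where "degree p \<le> n" "f = poly p"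
proof -
  from assms obtain c where c: "f = (\<lambda>s. \<Sum>k\<le>n. (s ^ k) *\<^sub>R c k)"
    unfolding vpoly_on_def by auto
  have "degree (\<Sum>k\<le>n. monom (c k) k) \<le> n"
    by (intro degree_sum_le) (auto intro: order_trans[OF degree_monom_le])
  moreover have "f = poly (\<Sum>k\<le>n. monom (c k) k)"
    by (auto simp: c poly_sum poly_monom mult.commute)
  ultimately show thesis using that by blast
qed

section \<open>The inverse inequality for polynomials\<close>

text \<open>Lagrange interpolation has \<open>n + 1\<close> terms, each basis polynomial is at most
  \<open>(2 * n + 1) ^ n\<close>, and one more factor \<open>2 * n + 1\<close> relates the interval
  to one of its subintervals.\<close>

definition inverse_const :: "nat \<Rightarrow> real" where
  "inverse_const n = (real (Suc n) * (2 * real n + 1) ^ Suc n)"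

lemma inverse_const_pos: "inverse_const n > 0"
  unfolding inverse_const_def by simp

lemma inverse_const_ge_1: "inverse_const n \<ge> 1"
proof -
  have "1 \<le> (2 * real n + 1) ^ Suc n" by (rule one_le_power) simp
  moreover have "1 \<le> real (Suc n)" by simp
  ultimately show ?thesis unfolding inverse_const_def
    using mult_mono[of 1 "real (Suc n)" 1 "(2 * real n + 1) ^ Suc n"] by simp
qed

text \<open>In each of \<open>n + 1\<close> separated subintervals there is a point at which the polynomial is at most
  its mean value; the polynomial is recovered from these points by Lagrange interpolation.\<close>

lemma polynomial_inverse_inequality:
  fixes f :: "real \<Rightarrow> real"
  assumes f: "vpoly_on n UNIV f" and ab: "a < b" and s: "s \<in> {a..b}"
  shows "(b - a) * \<bar>f s\<bar> \<le> inverse_const n * integral {a..b} (\<lambda>s. \<bar>f s\<bar>)"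
proof -
  \<comment> \<open>Of \<open>2 * n + 1\<close> subintervals of length \<open>h\<close> every second
    one is used, so points chosen in different ones are at least \<open>h\<close> apart.\<close>
  define h where "h = (b - a) / (2 * real n + 1)"
  have h: "h > 0" using ab by (simp add: h_def)
  define l where "l i = a + 2 * real i * h" for i
  define I where "I i = {l i..l i + h}" for i
  define J where "J = integral {a..b} (\<lambda>s. \<bar>f s\<bar>)"
  have cont: "continuous_on X (\<lambda>s. \<bar>f s\<bar>)" for X
    by (intro continuous_intros vpoly_on_continuous[OF f])
  have sub: "I i \<subseteq> {a..b}" if "i \<le> n" for i
  proof -
    have "2 * real i * h + h \<le> (2 * real n + 1) * h" using that h by (simp add: algebra_simps)
    also have "\<dots> = b - a" by (simp add: h_def)
    finally show ?thesis using h unfolding I_def l_def by auto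
  qed
  have "\<exists>y\<in>I i. \<forall>r\<in>I i. \<bar>f y\<bar> \<le> \<bar>f r\<bar>" for i
    using h by (intro continuous_attains_inf cont) (auto simp: I_def)
  then obtain y where y: "\<And>i. y i \<in> I i" "\<And>i r. r \<in> I i \<Longrightarrow> \<bar>f (y i)\<bar> \<le> \<bar>f r\<bar>"
    by metis
  have sep: "h \<le> \<bar>y i - y j\<bar>" if "i \<noteq> j" for i j
  proof -
    have *: "h \<le> y j - y i" if "i < j" for i j
    proof -
      have "real i + 1 \<le> real j" using that by simp
      then have "(real i + 1) * h \<le> real j * h" using h by (intro mult_right_mono) auto
      then show ?thesis using y(1)[of i] y(1)[of j] by (auto simp: I_def l_def algebra_simps)
    qed
    show ?thesis using that *[of i j] *[of j i] by (cases i j rule: linorder_cases) auto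
  qed
  have inj: "inj_on y {..n}"
    using sep h by (intro inj_onI) (metis abs_zero diff_self not_le)
  have fy: "h * \<bar>f (y i)\<bar> \<le> J" if "i \<le> n" for i
  proof -
    have "h * \<bar>f (y i)\<bar> = integral (I i) (\<lambda>_. \<bar>f (y i)\<bar>)"
      using h by (simp add: I_def)
    also have "\<dots> \<le> integral (I i) (\<lambda>s. \<bar>f s\<bar>)"
      unfolding I_def by (intro integral_le integrable_continuous_interval cont)
        (use y(2) in \<open>auto simp: I_def\<close>)
    also have "\<dots> \<le> J"
      unfolding J_def I_def using sub[OF that, unfolded I_def]
      by (intro integral_subset_le integrable_continuous_interval cont) auto
    finally show ?thesis .
  qed
  have Ln: "\<bar>\<Prod>j\<in>{..n} - {i}. (s - y j) / (y i - y j)\<bar> \<le> (2 * real n + 1) ^ n" if "i \<le> n" for i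
  proof -
    have "\<bar>\<Prod>j\<in>{..n} - {i}. (s - y j) / (y i - y j)\<bar> = (\<Prod>j\<in>{..n} - {i}. \<bar>s - y j\<bar> / \<bar>y i - y j\<bar>)"
      by (simp add: abs_prod)
    also have "\<dots> \<le> (\<Prod>j\<in>{..n} - {i}. 2 * real n + 1)"
    proof (intro prod_mono conjI)
      fix j assume j: "j \<in> {..n} - {i}"
      have "\<bar>s - y j\<bar> \<le> b - a" using s subsetD[OF sub y(1), of j] j by auto
      also have "\<dots> = (2 * real n + 1) * h" by (simp add: h_def)
      also have "\<dots> \<le> (2 * real n + 1) * \<bar>y i - y j\<bar>"
        using sep[of i j] j by (intro mult_left_mono) auto
      finally show "\<bar>s - y j\<bar> / \<bar>y i - y j\<bar> \<le> 2 * real n + 1"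
        using sep[of i j] j h by (simp add: divide_le_eq)
    qed auto
    also have "\<dots> = (2 * real n + 1) ^ n" using that by simp
    finally show ?thesis .
  qed
  have "h * \<bar>f s\<bar> = h * \<bar>interpolant n y f s\<bar>"
    using interpolant_unique[OF inj f, of f] by simp
  also have "\<dots> \<le> h * (\<Sum>i\<le>n. \<bar>\<Prod>j\<in>{..n} - {i}. (s - y j) / (y i - y j)\<bar> * \<bar>f (y i)\<bar>)"
    unfolding interpolant_def real_scaleR_def using h
    by (intro mult_left_mono order_trans[OF sum_abs]) (auto simp only: abs_mult)
  also have "\<dots> = (\<Sum>i\<le>n. \<bar>\<Prod>j\<in>{..n} - {i}. (s - y j) / (y i - y j)\<bar> * (h * \<bar>f (y i)\<bar>))"
    by (simp add: sum_distrib_left mult_ac)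
  also have "\<dots> \<le> (\<Sum>i\<le>n. (2 * real n + 1) ^ n * J)"
    using h by (intro sum_mono mult_mono Ln fy) auto
  finally have "h * \<bar>f s\<bar> \<le> real (Suc n) * ((2 * real n + 1) ^ n * J)" by simp
  then have "(2 * real n + 1) * (h * \<bar>f s\<bar>) \<le> (2 * real n + 1) * (real (Suc n) * ((2 * real n + 1) ^ n * J))"
    by (intro mult_left_mono) auto
  moreover have "(2 * real n + 1) * (h * \<bar>f s\<bar>) = (b - a) * \<bar>f s\<bar>" by (simp add: h_def)
  moreover have "(2 * real n + 1) * (real (Suc n) * ((2 * real n + 1) ^ n * J)) = inverse_const n * J"
    unfolding inverse_const_def power_Suc by (simp only: mult_ac)
  ultimately show ?thesis unfolding J_def by metis
qed

section \<open>The Gauss--Radau rule on one cell\<close>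

text \<open>A lower bound for \<open>(y 0 - a) / (b - a)\<close>. The exponential is the price of
  removing the weight \<open>E\<close>. The 4 is 2 times 2: the density is cut at distance
  \<open>(b - a) / (2 * inverse_const (2 * q))\<close> from \<open>a\<close>, and half of its mass
  remains beyond the cut.\<close>

definition node_const :: "real \<Rightarrow> real \<Rightarrow> nat \<Rightarrow> real" where
  "node_const \<rho> T q = exp (- 2 * \<rho> * T) / (4 * inverse_const (2 * q))"

lemma node_const_pos: "node_const \<rho> T q > 0"
  using inverse_const_pos[of "2 * q"] by (simp add: node_const_def)

text \<open>Each of the \<open>q + 1\<close> factors of \<theta> is at most the cell length divided
  by \<open>node_const\<close> times the cell length.\<close>

definition theta_const :: "real \<Rightarrow> real \<Rightarrow> nat \<Rightarrow> real" where
  "theta_const \<rho> T q = (1 / node_const \<rho> T q) ^ Suc q"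

lemma theta_const_pos: "theta_const \<rho> T q > 0"
  using node_const_pos[of \<rho> T q] by (simp add: theta_const_def)

text \<open>The rule transported from [-1, 1] to one cell; \<open>W\<close> absorbs half the cell
  length, so \<open>Q\<close> below is \<open>Qm\<close> of that cell. The exponential is taken
  relative to \<open>a\<close>; the factor belonging to the position of the cell returns only when
  the cells are summed. \<open>T\<close> enters just as a bound for the cell length, which keeps all
  constants independent of the step.\<close>

locale radau_cell =
  fixes \<rho> T a b :: real and q :: nat and y W :: "nat \<Rightarrow> real"
  assumes rho_pos: "\<rho> > 0" and ab: "a < b" and step_le: "b - a \<le> T"
    and y0: "a < y 0" and y_step: "i < q \<Longrightarrow> y i < y (Suc i)" and yq: "y q = b"
    and exact: "vpoly_on (2 * q) UNIV f \<Longrightarrow>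
      integral {a..b} (\<lambda>s. exp (- 2 * \<rho> * (s - a)) * f s) = (\<Sum>i\<le>q. W i * f (y i))"
begin

definition E :: "real \<Rightarrow> real" where "E s = exp (- 2 * \<rho> * (s - a))"

definition Q :: "(real \<Rightarrow> real) \<Rightarrow> real" where "Q f = (\<Sum>i\<le>q. W i * f (y i))"

definition \<theta> :: "real \<Rightarrow> real" where "\<theta> s = (\<Prod>i\<le>q. (s - y i) / (a - y i))"

lemma E_pos: "E s > 0" by (simp add: E_def)

lemma E_le_1: "a \<le> s \<Longrightarrow> E s \<le> 1"
  using rho_pos by (simp add: E_def)

lemma E_ge:
  assumes "s \<le> b"
  shows "exp (- 2 * \<rho> * T) \<le> E s"
proof -
  have "2 * \<rho> * (s - a) \<le> 2 * \<rho> * T" using assms step_le rho_pos by (intro mult_left_mono) auto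
  then show ?thesis by (simp add: E_def)
qed

lemma E_mult_le: "a \<le> s \<Longrightarrow> 0 \<le> x \<Longrightarrow> E s * x \<le> x"
  using mult_left_le_one_le[of x "E s"] E_le_1[of s] E_pos[of s] by simp

lemma E_a: "E a = 1" by (simp add: E_def)

lemma E_cont: "continuous_on X E"
  unfolding E_def by (intro continuous_intros)

lemma E_deriv: "(E has_real_derivative (- 2 * \<rho> * E s)) (at s within X)"
  unfolding E_def by (auto intro!: derivative_eq_intros)

lemma Q_exact: "vpoly_on (2 * q) UNIV f \<Longrightarrow> integral {a..b} (\<lambda>s. E s * f s) = Q f"
  unfolding E_def Q_def by (rule exact)

lemma y_less: "i < j \<Longrightarrow> j \<le> q \<Longrightarrow> y i < y j"
proof (induction j)
  case (Suc j)
  then show ?case using y_step[of j] by (cases "i = j") auto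
qed simp

lemma y_inj: "inj_on y {..q}"
  using y_less by (intro inj_onI) (metis atMost_iff linorder_neqE_nat less_irrefl)

lemma y_le: "i \<le> q \<Longrightarrow> y 0 \<le> y i"
  using y_less[of 0 i] by (cases "i = 0") auto

lemma y_gt_a: "i \<le> q \<Longrightarrow> a < y i"
  using y0 y_le[of i] by linarith

lemma y_le_b: "i \<le> q \<Longrightarrow> y i \<le> b"
  using y_less[of i q] yq by (cases "i = q") auto

lemma integrable_E: "continuous_on {a..b} f \<Longrightarrow> (\<lambda>s. E s * f s) integrable_on {a..b}"
  by (intro integrable_continuous_interval continuous_intros E_cont)

text \<open>The square of the \<open>i\<close>-th Lagrange basis polynomial has degree
  \<open>2 * q\<close>, so exactness identifies \<open>W i\<close> with the integral of a
  nonnegative function that does not vanish at \<open>y i\<close>.\<close>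

lemma W_pos: assumes i: "i \<le> q" shows "W i > 0"
proof -
  define l where "l s = (\<Prod>j\<in>{..q} - {i}. (s - y j) / (y i - y j))" for s
  have l: "vpoly_on q UNIV l"
    using vpoly_on_prod[OF _ vpoly_on_affine, of "{..q} - {i}" UNIV y "\<lambda>j. y i - y j"] i
    by (simp add: l_def[abs_def])
  have "vpoly_on (2 * q) UNIV (\<lambda>s. l s * l s)"
    using vpoly_on_mult[OF l l] by (simp add: mult_2)
  then have "integral {a..b} (\<lambda>s. E s * (l s * l s)) = Q (\<lambda>s. l s * l s)"
    by (rule Q_exact)
  also have "\<dots> = (\<Sum>k\<le>q. if k = i then W k else 0)"
    unfolding Q_def
  proof (intro sum.cong refl)
    fix k assume k: "k \<in> {..q}"
    have "l (y k) = (if k = i then 1 else 0)"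
    proof (cases "k = i")
      case True
      have "(y i - y j) / (y i - y j) = 1" if "j \<in> {..q} - {i}" for j
        using that i y_inj by (auto simp: inj_on_def)
      then show ?thesis using True by (simp add: l_def)
    next
      case False
      then show ?thesis using k by (auto simp: l_def intro!: prod_zero)
    qed
    then show "W k * (l (y k) * l (y k)) = (if k = i then W k else 0)" by simp
  qed
  finally have eq: "integral {a..b} (\<lambda>s. E s * (l s * l s)) = W i" using i by simp
  have cont: "continuous_on {a..b} (\<lambda>s. E s * (l s * l s))"
    by (intro continuous_intros E_cont vpoly_on_continuous[OF l])
  have nn: "0 \<le> E s * (l s * l s)" for s using E_pos[of s] by simp
  have "W i \<ge> 0" unfolding eq[symmetric] using nn
    by (intro integral_nonneg integrable_continuous_interval cont) auto
  moreover have "W i \<noteq> 0"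
  proof
    assume "W i = 0"
    then have "(\<lambda>s. E s * (l s * l s)) (y i) = 0"
      using integral_eq_0_iff[OF cont ab] eq nn y_gt_a[OF i] y_le_b[OF i] by auto
    moreover have "l (y i) = 1"
      unfolding l_def using i y_inj by (intro prod.neutral) (auto simp: inj_on_def)
    ultimately show False using E_pos[of "y i"] by simp
  qed
  ultimately show ?thesis by linarith
qed

lemma Q_mono: "(\<And>i. i \<le> q \<Longrightarrow> f (y i) \<le> g (y i)) \<Longrightarrow> Q f \<le> Q g"
  unfolding Q_def using W_pos by (intro sum_mono mult_left_mono) (auto intro: less_imp_le)

lemma Q_cong: "(\<And>i. i \<le> q \<Longrightarrow> f (y i) = g (y i)) \<Longrightarrow> Q f = Q g"
  unfolding Q_def by (intro sum.cong) auto

lemma Q_add: "Q (\<lambda>s. f s + g s) = Q f + Q g"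
  by (simp add: Q_def sum.distrib distrib_left)

lemma Q_diff: "Q (\<lambda>s. f s - g s) = Q f - Q g"
  by (simp add: Q_def sum_subtractf right_diff_distrib)

lemma Q_cmult: "Q (\<lambda>s. c * f s) = c * Q f"
  by (simp add: Q_def sum_distrib_left mult_ac)

lemma Q_nonneg: "(\<And>i. i \<le> q \<Longrightarrow> 0 \<le> f (y i)) \<Longrightarrow> 0 \<le> Q f"
  unfolding Q_def using W_pos by (intro sum_nonneg) (auto simp: less_imp_le)

lemma Q_const_le: assumes "0 \<le> c" shows "Q (\<lambda>s. c) \<le> (b - a) * c"
proof -
  have "Q (\<lambda>s. c) = integral {a..b} (\<lambda>s. E s * c)"
    by (rule Q_exact[symmetric]) (rule vpoly_on_const)
  also have "\<dots> \<le> integral {a..b} (\<lambda>s. c)"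
    using assms
    by (intro integral_le integrable_E continuous_intros integrable_const_ivl E_mult_le) auto
  finally show ?thesis using ab by simp
qed

lemma integral_le_Q:
  assumes f: "vpoly_on (2 * q) UNIV f" and nn: "\<And>s. s \<in> {a..b} \<Longrightarrow> 0 \<le> f s"
  shows "integral {a..b} f \<le> exp (2 * \<rho> * T) * Q f"
proof -
  have c: "continuous_on {a..b} f" by (rule vpoly_on_continuous[OF f])
  have "integral {a..b} f \<le> integral {a..b} (\<lambda>s. exp (2 * \<rho> * T) * (E s * f s))"
  proof (intro integral_le)
    show "(\<lambda>s. exp (2 * \<rho> * T) * (E s * f s)) integrable_on {a..b}"
      by (intro integrable_continuous_interval continuous_intros E_cont c)
    fix s assume s: "s \<in> {a..b}"
    have "1 = exp (2 * \<rho> * T) * exp (- 2 * \<rho> * T)" by (simp flip: exp_add)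
    also have "\<dots> \<le> exp (2 * \<rho> * T) * E s" using E_ge[of s] s by (intro mult_left_mono) auto
    finally have "1 * f s \<le> (exp (2 * \<rho> * T) * E s) * f s"
      using nn[OF s] by (intro mult_right_mono)
    then show "f s \<le> exp (2 * \<rho> * T) * (E s * f s)" by (simp add: mult_ac)
  qed (intro integrable_continuous_interval c)
  also have "\<dots> = exp (2 * \<rho> * T) * Q f"
    by (simp add: Q_exact[OF f])
  finally show ?thesis .
qed

text \<open>The inverse inequality in quadrature form. Because of the factor \<open>b - a\<close> it
  yields a uniform bound only when the right-hand side is itself of the order of the cell length;
  \<open>sup_step\<close> arranges this.\<close>

lemma sup_le_Q:
  assumes f: "vpoly_on (2 * q) UNIV f" and nn: "\<And>s. s \<in> {a..b} \<Longrightarrow> 0 \<le> f s" and s: "s \<in> {a..b}"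
  shows "(b - a) * f s \<le> inverse_const (2 * q) * exp (2 * \<rho> * T) * Q f"
proof -
  have "(b - a) * \<bar>f s\<bar> \<le> inverse_const (2 * q) * integral {a..b} (\<lambda>s. \<bar>f s\<bar>)"
    by (rule polynomial_inverse_inequality[OF f ab s])
  also have "integral {a..b} (\<lambda>s. \<bar>f s\<bar>) = integral {a..b} f"
    by (intro integral_cong) (use nn in auto)
  also have "inverse_const (2 * q) * integral {a..b} f \<le>
      inverse_const (2 * q) * (exp (2 * \<rho> * T) * Q f)"
    using inverse_const_pos[of "2 * q"] by (intro mult_left_mono integral_le_Q f nn) auto
  finally show ?thesis using nn[OF s] by (simp add: mult_ac)
qed

abbreviation \<delta> :: real where "\<delta> \<equiv> node_const \<rho> T q"

abbreviation \<kappa> :: real where "\<kappa> \<equiv> theta_const \<rho> T q"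

text \<open>Exactness turns \<open>y 0 - a\<close> into the mean of \<open>s - a\<close> with respect to the
  density \<open>E g\<close>, and the inverse inequality prevents this density from concentrating at \<open>a\<close>.\<close>

lemma first_node_ge: "\<delta> * (b - a) \<le> y 0 - a"
proof (cases "q = 0")
  case True
  have "exp (- 2 * \<rho> * T) \<le> 1" using rho_pos ab step_le by simp
  then have "\<delta> \<le> 1" unfolding node_const_def using inverse_const_ge_1[of "2 * q"]
    by (intro divide_le_eq_1_pos[THEN iffD2]) linarith+
  then show ?thesis using True yq ab mult_right_mono[of \<delta> 1 "b - a"] by simp
next
  case False
  then obtain n where n: "q = Suc n" by (cases q) auto
  \<comment> \<open>\<open>g\<close> vanishes at every node but the first: \<open>b - s\<close>
    handles the last node, and the squared product handles the inner ones without spoiling the sign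
    on the cell. With the extra factor \<open>s - a\<close> its degree is exactly
    \<open>2 * q\<close>.\<close>
  define h where "h s = (\<Prod>i\<in>{1..<q}. (s - y i) / 1)" for s
  define g where "g s = (b - s) * (h s * h s)" for s
  have h: "vpoly_on n UNIV h"
    using vpoly_on_prod[OF _ vpoly_on_affine, of "{1..<q}" UNIV y "\<lambda>i. 1"] n
    by (simp add: h_def[abs_def])
  have "vpoly_on (1 + (n + n)) UNIV g" unfolding g_def[abs_def]
    by (intro vpoly_on_mult h vpoly_on_diff vpoly_on_const vpoly_on_ident) simp
  then have g1: "vpoly_on (2 * q - 1) UNIV g" using n by (simp add: mult_2)
  then have g: "vpoly_on (2 * q) UNIV g" by (rule vpoly_on_mono) simp
  have sa: "vpoly_on 1 UNIV (\<lambda>s. s - a)"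
    by (intro vpoly_on_diff vpoly_on_const vpoly_on_ident) simp
  have "vpoly_on (1 + (2 * q - 1)) UNIV (\<lambda>s. (s - a) * g s)"
    by (intro vpoly_on_mult g1 sa)
  then have sg: "vpoly_on (2 * q) UNIV (\<lambda>s. (s - a) * g s)" using n by simp
  have gc: "continuous_on X g" for X by (rule vpoly_on_continuous[OF g])
  have gnn: "0 \<le> g s" if "s \<in> {a..b}" for s using that by (simp add: g_def)
  have g0: "g (y i) = 0" if "i \<le> q" "i \<noteq> 0" for i
    using that yq by (cases "i = q") (auto simp: g_def h_def intro!: prod_zero)
  have "Q (\<lambda>s. (s - a) * g s) = (\<Sum>i\<le>q. (y 0 - a) * (W i * g (y i)))"
    unfolding Q_def
  proof (intro sum.cong refl)
    fix i assume "i \<in> {..q}"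
    then show "W i * ((y i - a) * g (y i)) = (y 0 - a) * (W i * g (y i))"
      using g0[of i] by (cases "i = 0") auto
  qed
  then have Q: "Q (\<lambda>s. (s - a) * g s) = (y 0 - a) * Q g"
    by (simp add: Q_def sum_distrib_left)
  define K where "K = inverse_const (2 * q)"
  have K: "K \<ge> 1" by (simp add: K_def inverse_const_ge_1)
  \<comment> \<open>The inverse inequality bounds \<open>g\<close> by
    \<open>K * G / (b - a)\<close>, so an interval of length \<open>(b - a) / (2 * K)\<close> at
    \<open>a\<close> carries at most half of the integral \<open>G\<close>.\<close>
  define c where "c = a + (b - a) / (2 * K)"
  have "(b - a) / (2 * K) \<le> (b - a) / 1" using K ab by (intro divide_left_mono) auto
  then have c: "a < c" "c \<le> b" using K ab by (auto simp: c_def)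
  define G where "G = integral {a..b} g"
  have "integral {a..c} g \<le> integral {a..c} (\<lambda>s. K * G / (b - a))"
  proof (intro integral_le integrable_continuous_interval gc continuous_intros)
    fix s assume "s \<in> {a..c}"
    then have s: "s \<in> {a..b}" using c by auto
    have "(b - a) * \<bar>g s\<bar> \<le> K * integral {a..b} (\<lambda>s. \<bar>g s\<bar>)"
      unfolding K_def by (rule polynomial_inverse_inequality[OF g ab s])
    also have "integral {a..b} (\<lambda>s. \<bar>g s\<bar>) = G"
      unfolding G_def by (intro integral_cong) (use gnn in auto)
    finally show "g s \<le> K * G / (b - a)" using gnn[OF s] ab by (simp add: field_simps)
  qed
  also have "\<dots> = (c - a) * (K * G / (b - a))" using c by simp
  also have "\<dots> = G / 2" using ab K unfolding c_def by (simp add: divide_simps)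
  finally have "integral {a..c} g \<le> G / 2" .
  moreover have "integral {a..c} g + integral {c..b} g = G"
    unfolding G_def using c by (intro Henstock_Kurzweil_Integration.integral_combine
        integrable_continuous_interval gc) auto
  ultimately have cb: "G / 2 \<le> integral {c..b} g" by simp
  have Qle: "Q g \<le> G"
    unfolding Q_exact[OF g, symmetric] G_def
    by (intro integral_le integrable_E integrable_continuous_interval gc E_mult_le gnn) auto
  have "(c - a) * (G / 2) \<le> (c - a) * integral {c..b} g"
    using cb c by (intro mult_left_mono) auto
  also have "\<dots> = integral {c..b} (\<lambda>s. (c - a) * g s)" by simp
  also have "\<dots> \<le> integral {c..b} (\<lambda>s. (s - a) * g s)"
    using c gnn by (intro integral_le integrable_continuous_interval continuous_intros gc)
      (auto intro!: mult_right_mono)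
  also have "\<dots> \<le> integral {a..b} (\<lambda>s. (s - a) * g s)"
    using c gnn by (intro integral_subset_le integrable_continuous_interval continuous_intros gc) auto
  also have "\<dots> \<le> exp (2 * \<rho> * T) * Q (\<lambda>s. (s - a) * g s)"
    by (intro integral_le_Q sg) (use gnn in auto)
  also have "\<dots> = exp (2 * \<rho> * T) * ((y 0 - a) * Q g)" by (simp add: Q)
  also have "\<dots> \<le> exp (2 * \<rho> * T) * ((y 0 - a) * G)"
    using Qle y0 by (intro mult_left_mono) auto
  finally have *: "((c - a) / 2) * G \<le> (exp (2 * \<rho> * T) * (y 0 - a)) * G"
    by (simp only: mult_ac times_divide_eq_left times_divide_eq_right)
  have "0 < Q g"
  proof -
    have "0 < W 0 * g (y 0)"
    proof -
      have "y 0 < b" using y_less[of 0 q] yq False by simp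
      moreover have "h (y 0) \<noteq> 0"
      proof -
        have "(y 0 - y i) / 1 \<noteq> 0" if "i \<in> {1..<q}" for i
          using that y_less[of 0 i] by simp
        then show ?thesis unfolding h_def by (simp only: prod_zero_iff finite_atLeastLessThan) blast
      qed
      ultimately have "0 < g (y 0)" unfolding g_def by (simp add: zero_less_mult_iff not_square_less_zero linorder_neq_iff[symmetric])
      then show ?thesis using W_pos[of 0] by simp
    qed
    also have "\<dots> = Q g" unfolding Q_def
      using g0 by (subst sum.remove[of _ 0]) (auto intro!: sum.neutral)
    finally show ?thesis .
  qed
  then have "G > 0" using Qle by linarith
  then have "(c - a) / 2 \<le> exp (2 * \<rho> * T) * (y 0 - a)" using * by (simp only: mult_le_cancel_right_pos)
  then have "exp (- 2 * \<rho> * T) * ((c - a) / 2)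
      \<le> exp (- 2 * \<rho> * T) * (exp (2 * \<rho> * T) * (y 0 - a))"
    by (intro mult_left_mono) auto
  also have "\<dots> = y 0 - a" by (simp flip: exp_add mult.assoc)
  also have "exp (- 2 * \<rho> * T) * ((c - a) / 2) = \<delta> * (b - a)"
    using K by (simp add: node_const_def c_def K_def[symmetric])
  finally show ?thesis .
qed

lemma node_ge: "i \<le> q \<Longrightarrow> \<delta> * (b - a) \<le> y i - a"
  using first_node_ge y_le[of i] by linarith

lemma \<theta>_a: "\<theta> a = 1"
  unfolding \<theta>_def using y_gt_a by (intro prod.neutral) fastforce

lemma \<theta>_node: "i \<le> q \<Longrightarrow> \<theta> (y i) = 0"
  unfolding \<theta>_def by (auto intro!: prod_zero)

lemma \<theta>_poly: "vpoly_on (Suc q) UNIV \<theta>"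
  using vpoly_on_prod[OF _ vpoly_on_affine, of "{..q}" UNIV y "\<lambda>i. a - y i"]
  by (simp add: \<theta>_def[abs_def])

lemma \<theta>_bound: assumes s: "s \<in> {a..b}" shows "\<bar>\<theta> s\<bar> \<le> \<kappa>"
proof -
  have "\<bar>\<theta> s\<bar> = (\<Prod>i\<le>q. \<bar>s - y i\<bar> / \<bar>a - y i\<bar>)" by (simp add: \<theta>_def abs_prod)
  also have "\<dots> \<le> (\<Prod>i\<le>q. 1 / \<delta>)"
  proof (intro prod_mono conjI)
    fix i assume "i \<in> {..q}"
    then have i: "i \<le> q" by simp
    have "\<delta> * \<bar>s - y i\<bar> \<le> \<delta> * (b - a)"
      using s y_gt_a[OF i] y_le_b[OF i] node_const_pos[of \<rho> T q] by (intro mult_left_mono) auto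
    also have "\<dots> \<le> \<bar>a - y i\<bar>" using node_ge[OF i] by simp
    finally show "\<bar>s - y i\<bar> / \<bar>a - y i\<bar> \<le> 1 / \<delta>"
      using node_const_pos[of \<rho> T q] y_gt_a[OF i] by (simp add: field_simps)
  qed simp
  finally show ?thesis by (simp add: theta_const_def)
qed

end

section \<open>Stability of the error equation on a cell\<close>

context radau_cell
begin

lemma integral_by_parts:
  assumes f: "\<And>s. (f has_real_derivative f' s) (at s)" and c: "continuous_on {a..b} f'"
  shows "integral {a..b} (\<lambda>s. E s * f' s) = E b * f b - f a + 2 * \<rho> * integral {a..b} (\<lambda>s. E s * f s)"
proof -
  have fc: "continuous_on {a..b} f"
    using f by (intro continuous_at_imp_continuous_on) (auto intro: DERIV_isCont)
  have "((\<lambda>s. E s * f' s - 2 * \<rho> * (E s * f s)) has_integral (E b * f b - E a * f a)) {a..b}"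
  proof (rule fundamental_theorem_of_calculus)
    fix s
    have "((\<lambda>s. E s * f s) has_real_derivative E s * f' s - 2 * \<rho> * (E s * f s)) (at s)"
      using f[of s] by (auto intro!: derivative_eq_intros E_deriv)
    then show "((\<lambda>s. E s * f s) has_vector_derivative E s * f' s - 2 * \<rho> * (E s * f s)) (at s within {a..b})"
      by (metis has_real_derivative_iff_has_vector_derivative has_vector_derivative_at_within)
  qed (use ab in simp)
  then have "integral {a..b} (\<lambda>s. E s * f' s - 2 * \<rho> * (E s * f s)) = E b * f b - f a"
    by (simp add: integral_unique E_a)
  moreover have "integral {a..b} (\<lambda>s. E s * f' s - 2 * \<rho> * (E s * f s)) =
      integral {a..b} (\<lambda>s. E s * f' s) - 2 * \<rho> * integral {a..b} (\<lambda>s. E s * f s)"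
    by (subst integral_diff) (auto intro!: integrable_continuous_interval continuous_intros E_cont c fc)
  ultimately show ?thesis by simp
qed

text \<open>\<open>\<theta>\<close> is orthogonal to polynomials of degree less than \<open>q\<close>, because it vanishes at the nodes.\<close>

lemma Q_theta_deriv:
  assumes g: "vpoly_on q UNIV g" and \<theta>': "vpoly_on q UNIV \<theta>'"
    "\<And>s. (\<theta> has_real_derivative \<theta>' s) (at s)"
  shows "Q (\<lambda>s. \<theta>' s * g s) = - g a + 2 * \<rho> * integral {a..b} (\<lambda>s. E s * (\<theta> s * g s))"
proof -
  obtain g' where g': "vpoly_on (q - 1) UNIV g'" "q = 0 \<Longrightarrow> g' = (\<lambda>s. 0)"
    "\<And>s. (g has_vector_derivative g' s) (at s)"
    using vpoly_on_has_derivative[OF g] by blast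
  have d: "((\<lambda>s. \<theta> s * g s) has_real_derivative (\<theta>' s * g s + \<theta> s * g' s)) (at s)" for s
    using \<theta>'(2)[of s] g'(3)[of s]
    by (auto intro!: derivative_eq_intros simp: has_real_derivative_iff_has_vector_derivative[symmetric])
  have c: "continuous_on X \<theta>" "continuous_on X \<theta>'" "continuous_on X g" "continuous_on X g'" for X
    by (rule vpoly_on_continuous[OF \<theta>_poly] vpoly_on_continuous[OF \<theta>'(1)]
        vpoly_on_continuous[OF g] vpoly_on_continuous[OF g'(1)])+
  have "vpoly_on (2 * q) UNIV (\<lambda>s. \<theta> s * g' s)"
  proof (cases "q = 0")
    case True
    then show ?thesis using g'(2) by (simp add: vpoly_on_const)
  next
    case False
    have "vpoly_on (Suc q + (q - 1)) UNIV (\<lambda>s. \<theta> s * g' s)"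
      by (intro vpoly_on_mult \<theta>_poly g')
    then show ?thesis using False by (simp add: mult_2)
  qed
  then have "integral {a..b} (\<lambda>s. E s * (\<theta> s * g' s)) = Q (\<lambda>s. \<theta> s * g' s)" by (rule Q_exact)
  also have "\<dots> = 0" by (simp add: Q_def \<theta>_node)
  finally have z: "integral {a..b} (\<lambda>s. E s * (\<theta> s * g' s)) = 0" .
  have "vpoly_on (2 * q) UNIV (\<lambda>s. \<theta>' s * g s)"
    using vpoly_on_mult[OF \<theta>'(1) g] by (simp add: mult_2)
  then have "Q (\<lambda>s. \<theta>' s * g s) = integral {a..b} (\<lambda>s. E s * (\<theta>' s * g s)) + integral {a..b} (\<lambda>s. E s * (\<theta> s * g' s))"
    by (simp add: Q_exact z)
  also have "\<dots> = integral {a..b} (\<lambda>s. E s * (\<theta>' s * g s) + E s * (\<theta> s * g' s))"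
    by (intro integral_add[symmetric] integrable_E continuous_intros c)
  also have "\<dots> = integral {a..b} (\<lambda>s. E s * (\<theta>' s * g s + \<theta> s * g' s))"
    by (simp add: distrib_left)
  also have "\<dots> = E b * (\<theta> b * g b) - \<theta> a * g a + 2 * \<rho> * integral {a..b} (\<lambda>s. E s * (\<theta> s * g s))"
    by (intro integral_by_parts d continuous_intros c)
  also have "\<theta> b = 0" using \<theta>_node[of q] yq by simp
  finally show ?thesis by (simp add: \<theta>_a)
qed

text \<open>With \<open>k\<close> linear in a test function, \<open>\<theta> * k\<close> has degree
  up to \<open>2 * q + 1\<close> and the rule would just return 0, as \<theta> vanishes at the
  nodes. The integral is therefore estimated by a majorant \<open>m\<close> of degree at most
  \<open>2 * q\<close>, and only the majorant is converted back to \<open>Q\<close>.\<close>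

lemma theta_integral_bound:
  assumes k: "continuous_on {a..b} k" and m: "vpoly_on (2 * q) UNIV m"
    and le: "\<And>s. s \<in> {a..b} \<Longrightarrow> \<bar>k s\<bar> \<le> \<alpha> + \<beta> * m s" and \<alpha>: "0 \<le> \<alpha>"
  shows "\<bar>integral {a..b} (\<lambda>s. E s * (\<theta> s * k s))\<bar> \<le> \<kappa> * ((b - a) * \<alpha> + \<beta> * Q m)"
proof -
  have cm: "continuous_on {a..b} m" by (rule vpoly_on_continuous[OF m])
  have "norm (integral {a..b} (\<lambda>s. E s * (\<theta> s * k s)))
      \<le> integral {a..b} (\<lambda>s. \<kappa> * (E s * \<alpha> + \<beta> * (E s * m s)))"
  proof (intro integral_norm_bound_integral integrable_E integrable_continuous_interval continuous_intros
      k cm E_cont vpoly_on_continuous[OF \<theta>_poly])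
    fix s assume s: "s \<in> {a..b}"
    have "\<bar>\<theta> s\<bar> * \<bar>k s\<bar> \<le> \<kappa> * (\<alpha> + \<beta> * m s)"
      using theta_const_pos[of \<rho> T q] by (intro mult_mono \<theta>_bound s le) auto
    then have "E s * (\<bar>\<theta> s\<bar> * \<bar>k s\<bar>) \<le> E s * (\<kappa> * (\<alpha> + \<beta> * m s))"
      using E_pos[of s] by (intro mult_left_mono) auto
    then show "norm (E s * (\<theta> s * k s)) \<le> \<kappa> * (E s * \<alpha> + \<beta> * (E s * m s))"
      using E_pos[of s] by (simp add: abs_mult algebra_simps)
  qed
  also have "\<dots> = \<kappa> * (integral {a..b} (\<lambda>s. E s * \<alpha>) + \<beta> * Q m)"
    unfolding Q_exact[OF m, symmetric]
    apply (subst integral_mult_right)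
    apply (subst integral_add)
    subgoal by (intro integrable_continuous_interval continuous_intros E_cont)
    subgoal by (intro integrable_continuous_interval continuous_intros E_cont cm)
    by simp
  also have "integral {a..b} (\<lambda>s. E s * \<alpha>) = Q (\<lambda>s. \<alpha>)"
    by (rule Q_exact) (rule vpoly_on_const)
  also have "\<kappa> * (Q (\<lambda>s. \<alpha>) + \<beta> * Q m) \<le> \<kappa> * ((b - a) * \<alpha> + \<beta> * Q m)"
    using theta_const_pos[of \<rho> T q] Q_const_le[OF \<alpha>] by (intro mult_left_mono) auto
  finally show ?thesis by simp
qed

end

section \<open>Young inequalities and the two tests on a cell\<close>

lemma young:
  fixes x y \<alpha> :: real
  assumes "\<alpha> > 0"
  shows "x * y \<le> \<alpha> / 2 * x\<^sup>2 + 1 / (2 * \<alpha>) * y\<^sup>2"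
proof -
  have "0 \<le> (\<alpha> * x - y)\<^sup>2 / (2 * \<alpha>)" using assms by simp
  also have "\<dots> = \<alpha> / 2 * x\<^sup>2 + 1 / (2 * \<alpha>) * y\<^sup>2 - x * y"
    using assms by (simp add: power2_eq_square field_simps)
  finally show ?thesis by simp
qed

lemma inner_young:
  fixes x y :: "'a::real_inner"
  assumes "\<alpha> > 0"
  shows "\<bar>inner x y\<bar> \<le> \<alpha> / 2 * inner x x + 1 / (2 * \<alpha>) * inner y y"
  using Cauchy_Schwarz_ineq2[of x y] young[OF assms, of "norm x" "norm y"]
  by (simp add: power2_norm_eq_inner)

text \<open>Cauchy--Schwarz with a parameter for a form that is only semidefinite: expand it at
  \<open>\<alpha> x + y\<close> and at \<open>\<alpha> x - y\<close>, where it is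
  nonnegative.\<close>

lemma nonneg_form_young:
  fixes M :: "'a::real_inner \<Rightarrow> 'a"
  assumes "linear M" "\<And>x y. inner (M x) y = inner x (M y)" "\<And>x. 0 \<le> inner (M x) x" "\<alpha> > 0"
  shows "\<bar>inner (M x) y\<bar> \<le> \<alpha> / 2 * inner (M x) x + 1 / (2 * \<alpha>) * inner (M y) y"
proof -
  interpret linear M by fact
  have eq: "inner (M (\<alpha> *\<^sub>R x + e *\<^sub>R y)) (\<alpha> *\<^sub>R x + e *\<^sub>R y) =
      \<alpha>\<^sup>2 * inner (M x) x + 2 * \<alpha> * e * inner (M x) y + e\<^sup>2 * inner (M y) y" for e
    using assms(2)[of y x]
    by (simp add: add scale inner_add_left inner_add_right power2_eq_square algebra_simps inner_commute)
  have "0 \<le> \<alpha>\<^sup>2 * inner (M x) x + 2 * \<alpha> * e * inner (M x) y + e\<^sup>2 * inner (M y) y" for e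
    unfolding eq[symmetric] by (rule assms(3))
  from this[of 1] this[of "-1"]
  have "2 * \<alpha> * \<bar>inner (M x) y\<bar> \<le> \<alpha>\<^sup>2 * inner (M x) x + inner (M y) y"
    using assms(4) by (auto simp: abs_if)
  then have "\<bar>inner (M x) y\<bar> \<le> (\<alpha>\<^sup>2 * inner (M x) x + inner (M y) y) / (2 * \<alpha>)"
    using assms(4) by (simp add: field_simps)
  also have "\<dots> = \<alpha> / 2 * inner (M x) x + 1 / (2 * \<alpha>) * inner (M y) y"
    using assms(4) by (simp add: field_simps power2_eq_square)
  finally show ?thesis .
qed

text \<open>The sum of the coefficients in the inequality \<open>main\<close> of
  \<open>sup_step\<close>: those of the entering energy, of the quadrature norm of \<open>v\<close>,
  of the data and of the jump energy.\<close>

definition sup_const_aux :: "real \<Rightarrow> real \<Rightarrow> nat \<Rightarrow> real \<Rightarrow> real \<Rightarrow> real" where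
  "sup_const_aux \<rho> T q \<mu>0 \<mu>1 = (let d = node_const \<rho> T q; k = \<rho> * theta_const \<rho> T q in
     2 / d\<^sup>2 + 8 * (1 + \<rho> * T)\<^sup>2 * (inverse_const (2 * q) * exp (2 * \<rho> * T))
     + \<mu>1 / d + (1 / 2 + k + k * \<mu>0) / d\<^sup>2 + 1 + k + k * T)"

text \<open>The bracket bounds \<open>Q\<close> of the energy of \<open>v\<close> divided by the
  cell length; the factor in front is the constant of \<open>sup_le_Q\<close>.\<close>

definition sup_const :: "real \<Rightarrow> real \<Rightarrow> nat \<Rightarrow> real \<Rightarrow> real \<Rightarrow> real" where
  "sup_const \<rho> T q \<mu>0 \<mu>1 =
     inverse_const (2 * q) * exp (2 * \<rho> * T) * (2 + 8 * sup_const_aux \<rho> T q \<mu>0 \<mu>1)"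

text \<open>On a cell \<open>(a, b]\<close>, the error equation for the discrete error \<open>v\<close>, which enters the cell
  with the value \<open>z\<close>; \<open>r\<close> stands for \<open>\<partial>\<^sub>t M0 (U - P_hat U)\<close> and \<open>\<eta>\<close> for \<open>(U - P U)(a+)\<close>.\<close>

locale cell_error = radau_cell +
  fixes M0 M1 A :: "'h::real_inner \<Rightarrow> 'h" and \<gamma> \<mu>0 \<mu>1 :: real
    and v v' r :: "real \<Rightarrow> 'h" and z \<eta> :: 'h
  assumes M0: "bounded_linear M0" and M0_sym: "inner (M0 x1) x2 = inner x1 (M0 x2)"
    and M0_nonneg: "0 \<le> inner (M0 x1) x1"
    and M0_le: "norm (M0 x1) \<le> \<mu>0 * norm x1"
    and M1_le: "norm (M1 x1) \<le> \<mu>1 * norm x1"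
    and \<mu>0: "0 \<le> \<mu>0" and \<mu>1: "0 \<le> \<mu>1" and \<gamma>_pos: "\<gamma> > 0"
    and coercive: "\<gamma> * inner x1 x1 \<le> inner (\<rho> *\<^sub>R M0 x1 + M1 x1) x1"
    and v: "vpoly_on q UNIV v" and v': "vpoly_on (q - 1) UNIV v'"
    and v_deriv: "(v has_vector_derivative v' s) (at s)"
    and skew: "i \<le> q \<Longrightarrow> inner (A (v (y i))) (v (y i)) = 0"
    and error_eq: "vpoly_on q UNIV \<Phi> \<Longrightarrow>
      Q (\<lambda>s. inner (M0 (v' s) + M1 (v s) + A (v s)) (\<Phi> s)) + inner (M0 (v a - z)) (\<Phi> a)
      = Q (\<lambda>s. inner (r s) (\<Phi> s))
        + 2 * \<rho> * integral {a..b} (\<lambda>s. E s * (\<theta> s * inner (M0 \<eta>) (\<Phi> s)))"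
begin

lemma M0_deriv:
  assumes "\<And>s. (f has_vector_derivative f' s) (at s)"
  shows "((\<lambda>s. inner (M0 (f s)) (f s)) has_real_derivative 2 * inner (M0 (f' s)) (f s)) (at s)"
proof -
  have "((\<lambda>s. M0 (f s)) has_vector_derivative M0 (f' s)) (at s)"
    by (rule bounded_linear.has_vector_derivative[OF M0 assms])
  from bounded_bilinear.has_vector_derivative[OF bounded_bilinear_inner this assms[of s]]
  have "((\<lambda>s. inner (M0 (f s)) (f s)) has_vector_derivative
      inner (M0 (f s)) (f' s) + inner (M0 (f' s)) (f s)) (at s)" .
  moreover have "inner (M0 (f s)) (f' s) = inner (M0 (f' s)) (f s)"
    using M0_sym[of "f s" "f' s"] by (simp add: inner_commute)
  ultimately show ?thesis
    by (simp add: has_real_derivative_iff_has_vector_derivative)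
qed

lemma M0_poly: "vpoly_on n UNIV f \<Longrightarrow> vpoly_on n UNIV (\<lambda>s. M0 (f s))"
  by (rule vpoly_on_bounded_linear[OF M0])

lemma M0_inner_poly:
  "vpoly_on q UNIV f \<Longrightarrow> vpoly_on q UNIV g \<Longrightarrow> vpoly_on (2 * q) UNIV (\<lambda>s. inner (M0 (f s)) (g s))"
  unfolding mult_2 by (intro vpoly_on_inner M0_poly)

lemma inner_poly:
  "vpoly_on q UNIV f \<Longrightarrow> vpoly_on q UNIV g \<Longrightarrow> vpoly_on (2 * q) UNIV (\<lambda>s. inner (f s) (g s))"
  unfolding mult_2 by (intro vpoly_on_inner)

lemma const_inner_poly: "vpoly_on n UNIV f \<Longrightarrow> vpoly_on n UNIV (\<lambda>s. inner c (f s))"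
  by (rule vpoly_on_bounded_linear[OF bounded_linear_inner_right])

lemmas M0_young = nonneg_form_young[OF bounded_linear.linear[OF M0] M0_sym M0_nonneg]

abbreviation jmp :: 'h where "jmp \<equiv> v a - z"

definition data :: real where
  "data = Q (\<lambda>s. inner (r s) (r s)) + (b - a) * (norm (M0 \<eta>))\<^sup>2"

text \<open>Test the error equation with \<open>v\<close> and double it. Integration by parts turns
  the time derivative into end point energies plus \<open>2 * \<rho>\<close> times the energy, which
  joins \<open>M1\<close> to give coercivity, hence \<open>2 * \<gamma>\<close> times the quadrature
  norm. Polarisation splits the jump term into jump energy, energy at \<open>a\<close> and entering
  energy; the energy at \<open>a\<close> cancels. The two terms on the right absorb
  \<open>\<gamma>\<close> in total.\<close>

lemma energy_step:
  "inner (M0 (v b)) (v b) * E b + \<gamma> * Q (\<lambda>s. inner (v s) (v s)) + inner (M0 jmp) jmp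
    \<le> inner (M0 z) z + 2 * ((1 + 4 * \<rho>\<^sup>2 * \<kappa>\<^sup>2) / \<gamma>) * data"
proof -
  interpret M0: bounded_linear M0 by (rule M0)
  define B where "B = Q (\<lambda>s. inner (v s) (v s))"
  define R where "R = Q (\<lambda>s. inner (r s) (r s))"
  define H where "H = (b - a) * (norm (M0 \<eta>))\<^sup>2"
  define p where "p s = inner (M0 (v s)) (v s)" for s
  have vq: "vpoly_on q UNIV v'" by (rule vpoly_on_mono[OF v']) simp
  have "integral {a..b} (\<lambda>s. E s * (2 * inner (M0 (v' s)) (v s)))
      = E b * p b - p a + 2 * \<rho> * integral {a..b} (\<lambda>s. E s * p s)"
    unfolding p_def
    by (intro integral_by_parts M0_deriv v_deriv continuous_intros
        vpoly_on_continuous[OF M0_inner_poly[OF vq v]])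
  also have "integral {a..b} (\<lambda>s. E s * (2 * inner (M0 (v' s)) (v s)))
      = Q (\<lambda>s. 2 * inner (M0 (v' s)) (v s))"
    by (intro Q_exact vpoly_on_mono[OF vpoly_on_scaleR_const[OF M0_inner_poly[OF vq v], of 2, unfolded real_scaleR_def]]) simp
  also have "integral {a..b} (\<lambda>s. E s * p s) = Q p"
    unfolding p_def by (intro Q_exact M0_inner_poly v)
  finally have parts: "2 * Q (\<lambda>s. inner (M0 (v' s)) (v s)) = E b * p b - p a + 2 * \<rho> * Q p"
    by (simp add: Q_cmult)
  have "\<gamma> * B \<le> Q (\<lambda>s. \<rho> * p s + inner (M1 (v s)) (v s))"
    unfolding B_def Q_cmult[symmetric] p_def using coercive
    by (intro Q_mono) (simp add: inner_add_left)
  then have co: "\<gamma> * B \<le> \<rho> * Q p + Q (\<lambda>s. inner (M1 (v s)) (v s))" by (simp add: Q_add Q_cmult)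
  have "Q (\<lambda>s. inner (M0 (v' s) + M1 (v s) + A (v s)) (v s))
      = Q (\<lambda>s. inner (M0 (v' s)) (v s) + inner (M1 (v s)) (v s))"
    by (intro Q_cong) (simp add: inner_add_left skew)
  then have eq: "Q (\<lambda>s. inner (M0 (v' s)) (v s)) + Q (\<lambda>s. inner (M1 (v s)) (v s)) + inner (M0 jmp) (v a)
      = Q (\<lambda>s. inner (r s) (v s)) + 2 * \<rho> * integral {a..b} (\<lambda>s. E s * (\<theta> s * inner (M0 \<eta>) (v s)))"
    using error_eq[OF v] by (simp add: Q_add)
  have jump: "2 * inner (M0 jmp) (v a) = inner (M0 jmp) jmp + p a - inner (M0 z) z"
    using M0_sym[of z "v a"] by (simp add: p_def M0.diff inner_diff_left inner_diff_right inner_commute)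
  have "Q (\<lambda>s. inner (r s) (v s)) \<le> Q (\<lambda>s. \<gamma> / 4 * inner (v s) (v s) + 1 / \<gamma> * inner (r s) (r s))"
  proof (intro Q_mono)
    fix i
    show "inner (r (y i)) (v (y i)) \<le> \<gamma> / 4 * inner (v (y i)) (v (y i)) + 1 / \<gamma> * inner (r (y i)) (r (y i))"
      using inner_young[of "\<gamma> / 2" "v (y i)" "r (y i)"] \<gamma>_pos by (simp add: inner_commute)
  qed
  then have r: "Q (\<lambda>s. inner (r s) (v s)) \<le> \<gamma> / 4 * B + 1 / \<gamma> * R"
    unfolding Q_add Q_cmult B_def R_def .
  have \<kappa>: "\<kappa> > 0" by (rule theta_const_pos)
  \<comment> \<open>Chosen so that \<open>\<rho> * \<kappa> * \<alpha> = \<gamma> / 4\<close>, the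
    same share of the coercive term as is given to \<open>r\<close>.\<close>
  define \<alpha> where "\<alpha> = \<gamma> / (4 * \<rho> * \<kappa>)"
  have \<alpha>: "\<alpha> > 0" using \<gamma>_pos rho_pos \<kappa> by (simp add: \<alpha>_def)
  have "\<bar>integral {a..b} (\<lambda>s. E s * (\<theta> s * inner (M0 \<eta>) (v s)))\<bar>
      \<le> \<kappa> * ((b - a) * (1 / (2 * \<alpha>) * inner (M0 \<eta>) (M0 \<eta>)) + \<alpha> / 2 * B)"
    unfolding B_def
  proof (intro theta_integral_bound inner_poly v)
    show "continuous_on {a..b} (\<lambda>s. inner (M0 \<eta>) (v s))"
      by (intro continuous_intros vpoly_on_continuous[OF v])
    show "\<bar>inner (M0 \<eta>) (v s)\<bar> \<le> 1 / (2 * \<alpha>) * inner (M0 \<eta>) (M0 \<eta>) + \<alpha> / 2 * inner (v s) (v s)" for s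
      using inner_young[OF \<alpha>, of "v s" "M0 \<eta>"] by (simp add: inner_commute)
    show "0 \<le> 1 / (2 * \<alpha>) * inner (M0 \<eta>) (M0 \<eta>)" using \<alpha> by simp
  qed
  then have "2 * \<rho> * \<bar>integral {a..b} (\<lambda>s. E s * (\<theta> s * inner (M0 \<eta>) (v s)))\<bar>
      \<le> 2 * \<rho> * (\<kappa> * ((b - a) * (1 / (2 * \<alpha>) * inner (M0 \<eta>) (M0 \<eta>)) + \<alpha> / 2 * B))"
    using rho_pos by (intro mult_left_mono) auto
  also have "\<dots> = (\<rho> * \<kappa> / \<alpha>) * H + (\<rho> * \<kappa> * \<alpha>) * B"
    using \<alpha> by (simp add: H_def power2_norm_eq_inner field_simps)
  also have "\<rho> * \<kappa> / \<alpha> = 4 * \<rho>\<^sup>2 * \<kappa>\<^sup>2 / \<gamma>" using rho_pos \<kappa> \<gamma>_pos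
    by (simp add: \<alpha>_def power2_eq_square)
  also have "\<rho> * \<kappa> * \<alpha> = \<gamma> / 4" using rho_pos \<kappa> by (simp add: \<alpha>_def)
  finally have t: "2 * \<rho> * integral {a..b} (\<lambda>s. E s * (\<theta> s * inner (M0 \<eta>) (v s)))
      \<le> 4 * \<rho>\<^sup>2 * \<kappa>\<^sup>2 / \<gamma> * H + \<gamma> / 4 * B"
    using rho_pos by (smt (verit, best) mult_left_mono abs_ge_self)
  have "H \<ge> 0" "R \<ge> 0"
    unfolding H_def R_def using ab by (auto intro: Q_nonneg)
  then have "1 / \<gamma> * R + 4 * \<rho>\<^sup>2 * \<kappa>\<^sup>2 / \<gamma> * H \<le> (1 + 4 * \<rho>\<^sup>2 * \<kappa>\<^sup>2) / \<gamma> * R + (1 + 4 * \<rho>\<^sup>2 * \<kappa>\<^sup>2) / \<gamma> * H"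
    using \<gamma>_pos by (intro add_mono mult_right_mono divide_right_mono) auto
  also have "\<dots> = (1 + 4 * \<rho>\<^sup>2 * \<kappa>\<^sup>2) / \<gamma> * data"
    by (simp add: data_def R_def H_def distrib_left)
  finally have "1 / \<gamma> * R + 4 * \<rho>\<^sup>2 * \<kappa>\<^sup>2 / \<gamma> * H \<le> (1 + 4 * \<rho>\<^sup>2 * \<kappa>\<^sup>2) / \<gamma> * data" .
  then have "E b * p b + \<gamma> * B + inner (M0 jmp) jmp
    \<le> inner (M0 z) z + 2 * ((1 + 4 * \<rho>\<^sup>2 * \<kappa>\<^sup>2) / \<gamma> * data)"
    using parts co eq jump r t by linarith
  then show ?thesis by (simp only: p_def B_def mult_ac)
qed

text \<open>The right-hand side is \<open>Q\<close> of the derivative of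
  \<open>(s - a) * inner (M0 (w s)) (w s)\<close>. That derivative has degree at most
  \<open>2 * q\<close>, so \<open>Q\<close> is exact; integrating by parts leaves nothing at
  \<open>a\<close> and only nonnegative terms elsewhere.\<close>

lemma weighted_deriv_ge:
  assumes w: "vpoly_on q UNIV w" and w': "vpoly_on (q - 1) UNIV w'" "q = 0 \<Longrightarrow> w' = (\<lambda>s. 0)"
    "\<And>s. (w has_vector_derivative w' s) (at s)"
  shows "0 \<le> Q (\<lambda>s. inner (M0 (w s)) (w s)) + 2 * Q (\<lambda>s. (s - a) * inner (M0 (w' s)) (w s))"
proof -
  interpret M0: bounded_linear M0 by (rule M0)
  define g where "g s = inner (M0 (w s)) (w s)" for s
  define f' where "f' s = (s - a) * (2 * inner (M0 (w' s)) (w s)) + g s" for s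
  have wq: "vpoly_on q UNIV w'" by (rule vpoly_on_mono[OF w'(1)]) simp
  have g: "vpoly_on (2 * q) UNIV g" unfolding g_def[abs_def] by (rule M0_inner_poly[OF w w])
  have g': "vpoly_on (2 * q) UNIV (\<lambda>s. inner (M0 (w' s)) (w s))" by (rule M0_inner_poly[OF wq w])
  have "vpoly_on (2 * q) UNIV (\<lambda>s. (s - a) * (2 * inner (M0 (w' s)) (w s)))"
  proof (cases "q = 0")
    case True
    then show ?thesis using w'(2) by (simp add: vpoly_on_const M0.zero)
  next
    case False
    have "vpoly_on 1 UNIV (\<lambda>s. s - a)"
      using vpoly_on_affine[of UNIV a 1] by simp
    from vpoly_on_mult[OF this vpoly_on_scaleR_const[OF vpoly_on_inner[OF M0_poly[OF w'(1)] w], of 2]]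
    have "vpoly_on (1 + (q - 1 + q)) UNIV (\<lambda>s. (s - a) * (2 * inner (M0 (w' s)) (w s)))"
      by simp
    moreover have "1 + (q - 1 + q) = 2 * q" using False by simp
    ultimately show ?thesis by metis
  qed
  then have f'_poly: "vpoly_on (2 * q) UNIV f'" unfolding f'_def[abs_def] by (intro vpoly_on_add g)
  have "Q f' = integral {a..b} (\<lambda>s. E s * f' s)" by (rule Q_exact[OF f'_poly, symmetric])
  also have "\<dots> = E b * ((b - a) * g b) - (a - a) * g a + 2 * \<rho> * integral {a..b} (\<lambda>s. E s * ((s - a) * g s))"
  proof (intro integral_by_parts vpoly_on_continuous[OF f'_poly])
    show "((\<lambda>s. (s - a) * g s) has_real_derivative f' s) (at s)" for s
      unfolding f'_def g_def by (auto intro!: derivative_eq_intros M0_deriv[OF w'(3)])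
  qed
  also have "\<dots> \<ge> 0"
  proof -
    have nn: "0 \<le> g s" for s unfolding g_def by (rule M0_nonneg)
    have "0 \<le> integral {a..b} (\<lambda>s. E s * ((s - a) * g s))"
      using nn E_pos by (intro integral_nonneg integrable_E continuous_intros vpoly_on_continuous[OF g])
        (auto simp: less_imp_le)
    then show ?thesis using nn[of b] E_pos[of b] ab rho_pos by simp
  qed
  finally have "0 \<le> Q f'" .
  also have "Q f' = Q g + 2 * Q (\<lambda>s. (s - a) * inner (M0 (w' s)) (w s))"
    unfolding f'_def[abs_def] Q_add Q_cmult[symmetric] by (simp add: mult_ac)
  finally show ?thesis by (simp add: g_def[abs_def])
qed

text \<open>No bound for \<open>w'\<close> is available, so the derivative is moved off
  \<open>w\<close> by parts. The inverse inequality then controls \<open>w\<close> pointwise at the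
  price of \<open>1 / (b - a)\<close>, which the factor \<open>b - a\<close> on the left pays for.
  The two boundary values and the weighted integral together give at most
  \<open>2 * (1 + \<rho> * T)\<close> times the pointwise bound.\<close>

lemma deriv_pairing_bound:
  assumes w: "vpoly_on q UNIV w" and w': "vpoly_on (q - 1) UNIV w'"
    "\<And>s. (w has_vector_derivative w' s) (at s)"
  shows "(b - a) * \<bar>Q (\<lambda>s. inner (M0 (w' s)) z)\<bar> \<le> (b - a) / 8 * Q (\<lambda>s. inner (M0 (w s)) (w s))
    + 8 * (1 + \<rho> * T)\<^sup>2 * (inverse_const (2 * q) * exp (2 * \<rho> * T)) * inner (M0 z) z"
proof -
  define K where "K = inverse_const (2 * q) * exp (2 * \<rho> * T)"
  define G where "G = Q (\<lambda>s. inner (M0 (w s)) (w s))"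
  define Z where "Z = inner (M0 z) z"
  define c where "c = 1 + \<rho> * T"
  define \<tau> where "\<tau> = b - a"
  have \<tau>: "\<tau> > 0" using ab by (simp add: \<tau>_def)
  have K: "K > 0" using inverse_const_pos by (simp add: K_def)
  have c: "c > 0" using rho_pos ab step_le by (simp add: c_def add_pos_nonneg)
  \<comment> \<open>Proportional to the cell length, so that the coefficient of \<open>G\<close> in
    the result is exactly \<open>\<tau> / 8\<close>, small enough to be absorbed in
    \<open>sup_step\<close>.\<close>
  define \<alpha> where "\<alpha> = \<tau> / (8 * c * K)"
  have \<alpha>: "\<alpha> > 0" using \<tau> K c by (simp add: \<alpha>_def)
  define m where "m = \<alpha> / 2 * (K * G / \<tau>) + 1 / (2 * \<alpha>) * Z"
  define f where "f s = inner (M0 (w s)) z" for s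
  have f: "\<bar>f s\<bar> \<le> m" if "s \<in> {a..b}" for s
  proof -
    have "\<tau> * inner (M0 (w s)) (w s) \<le> K * G"
      unfolding K_def G_def \<tau>_def by (intro sup_le_Q M0_inner_poly w M0_nonneg that)
    then have "\<alpha> / 2 * inner (M0 (w s)) (w s) \<le> \<alpha> / 2 * (K * G / \<tau>)"
      using \<alpha> \<tau> by (intro mult_left_mono) (auto simp: field_simps)
    then show ?thesis using M0_young[OF \<alpha>, of "w s" z] unfolding f_def m_def Z_def by linarith
  qed
  have wc: "continuous_on X f" for X unfolding f_def
    using vpoly_on_continuous[OF M0_poly[OF w], of X] by (intro continuous_intros)
  have w'p: "vpoly_on (q - 1) UNIV (\<lambda>s. inner (M0 (w' s)) z)"
    using const_inner_poly[OF M0_poly[OF w'(1)], of z] by (simp add: inner_commute)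
  have "Q (\<lambda>s. inner (M0 (w' s)) z) = integral {a..b} (\<lambda>s. E s * inner (M0 (w' s)) z)"
    by (intro Q_exact[symmetric] vpoly_on_mono[OF w'p]) simp
  also have "\<dots> = E b * f b - f a + 2 * \<rho> * integral {a..b} (\<lambda>s. E s * f s)"
  proof (intro integral_by_parts vpoly_on_continuous[OF w'p])
    fix s
    have "((\<lambda>s. inner (M0 (w s)) z) has_vector_derivative inner (M0 (w' s)) z) (at s)"
      by (rule bounded_linear.has_vector_derivative[OF bounded_linear_inner_left
            bounded_linear.has_vector_derivative[OF M0 w'(2)]])
    then show "(f has_real_derivative inner (M0 (w' s)) z) (at s)"
      by (simp add: has_real_derivative_iff_has_vector_derivative f_def[abs_def])
  qed
  finally have eq: "Q (\<lambda>s. inner (M0 (w' s)) z) = E b * f b - f a + 2 * \<rho> * integral {a..b} (\<lambda>s. E s * f s)" .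
  have Ef: "\<bar>E s * f s\<bar> \<le> m" if "s \<in> {a..b}" for s
    using E_mult_le[of s "\<bar>f s\<bar>"] f[OF that] E_pos[of s] that by (simp add: abs_mult)
  have "norm (integral {a..b} (\<lambda>s. E s * f s)) \<le> integral {a..b} (\<lambda>s. m)"
    using Ef by (intro integral_norm_bound_integral integrable_E wc) auto
  also have "\<dots> = (b - a) * m" using ab by simp
  also have "\<dots> \<le> T * m" using step_le f[of a] ab by (intro mult_right_mono) auto
  finally have "2 * \<rho> * \<bar>integral {a..b} (\<lambda>s. E s * f s)\<bar> \<le> 2 * \<rho> * (T * m)"
    using rho_pos by (intro mult_left_mono) auto
  moreover have "\<bar>2 * \<rho> * integral {a..b} (\<lambda>s. E s * f s)\<bar> = 2 * \<rho> * \<bar>integral {a..b} (\<lambda>s. E s * f s)\<bar>"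
    using rho_pos by (simp add: abs_mult)
  moreover have "\<bar>E b * f b\<bar> \<le> m" "\<bar>f a\<bar> \<le> m" using Ef[of b] f[of a] ab by auto
  ultimately have "\<bar>Q (\<lambda>s. inner (M0 (w' s)) z)\<bar> \<le> 2 * c * m"
    unfolding eq by (simp add: c_def algebra_simps)
  then have "(b - a) * \<bar>Q (\<lambda>s. inner (M0 (w' s)) z)\<bar> \<le> (b - a) * (2 * c * m)"
    using ab by (intro mult_left_mono) auto
  also have "\<dots> = (b - a) / 8 * G + 8 * c\<^sup>2 * K * Z"
    using \<tau> c K unfolding m_def \<alpha>_def \<tau>_def[symmetric] by (simp add: power2_eq_square field_simps)
  finally show ?thesis unfolding G_def K_def c_def Z_def .
qed

text \<open>The test function is the interpolant of \<open>(b - a) v(s) / (s - a)\<close>: multiplication by a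
  positive function keeps the skew term zero, and the singular weight makes
  \<open>Q (M0 w, w)\<close> appear, where \<open>w = (v - \<theta> jmp - z) / (s - a)\<close>.\<close>

lemma sup_step:
  assumes s: "s \<in> {a..b}"
  shows "inner (M0 (v s)) (v s) \<le> sup_const \<rho> T q \<mu>0 \<mu>1 *
    (inner (M0 z) z + Q (\<lambda>s. inner (v s) (v s)) + data + inner (M0 jmp) jmp)"
proof -
  interpret M0: bounded_linear M0 by (rule M0)
  define B where "B = Q (\<lambda>s. inner (v s) (v s))"
  define R where "R = Q (\<lambda>s. inner (r s) (r s))"
  define Z where "Z = inner (M0 z) z"
  define J where "J = inner (M0 jmp) jmp"
  define \<tau> where "\<tau> = b - a"
  have \<tau>: "\<tau> > 0" using ab by (simp add: \<tau>_def)
  have \<tau>T: "\<tau> \<le> T" using step_le by (simp add: \<tau>_def)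
  define d where "d = \<delta>"
  have d: "d > 0" using node_const_pos by (simp add: d_def)
  define k where "k = \<rho> * \<kappa>"
  have k: "k > 0" using theta_const_pos rho_pos by (simp add: k_def)
  obtain \<theta>' where \<theta>': "vpoly_on (Suc q - 1) UNIV \<theta>'" "\<And>s. (\<theta> has_vector_derivative \<theta>' s) (at s)"
    using vpoly_on_has_derivative[OF \<theta>_poly] by blast
  \<comment> \<open>\<open>vh\<close> has the nodal values of \<open>v\<close> but starts at
    \<open>z\<close>. Its degree is \<open>q + 1\<close>, so dividing \<open>vh - z\<close> by
    \<open>s - a\<close> gives \<open>w\<close> of degree \<open>q\<close> and the products of
    \<open>w\<close> stay within exactness.\<close>
  define vh where "vh s = v s - \<theta> s *\<^sub>R jmp" for s
  have "vpoly_on (Suc q + 0) UNIV (\<lambda>s. \<theta> s *\<^sub>R jmp)"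
    by (intro vpoly_on_scaleR \<theta>_poly vpoly_on_const)
  then have "vpoly_on (Suc q) UNIV (\<lambda>s. vh s - z)"
    unfolding vh_def by (intro vpoly_on_diff vpoly_on_const vpoly_on_mono[OF v]) auto
  moreover have "vh a - z = 0" by (simp add: vh_def \<theta>_a)
  ultimately obtain w where w: "vpoly_on q UNIV w" "\<And>s. vh s - z = (s - a) *\<^sub>R w s"
    using vpoly_on_divide_root[of q "\<lambda>s. vh s - z" a] by auto
  obtain w' where w': "vpoly_on (q - 1) UNIV w'" "q = 0 \<Longrightarrow> w' = (\<lambda>s. 0)"
    "\<And>s. (w has_vector_derivative w' s) (at s)"
    using vpoly_on_has_derivative[OF w(1)] by blast
  have vd: "v' s - \<theta>' s *\<^sub>R jmp = w s + (s - a) *\<^sub>R w' s" for s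
  proof (rule vector_derivative_unique_at)
    show "(vh has_vector_derivative v' s - \<theta>' s *\<^sub>R jmp) (at s)"
      unfolding vh_def using v_deriv[of s] \<theta>'(2)[of s]
      by (auto intro!: derivative_eq_intros
          simp: has_real_derivative_iff_has_vector_derivative[symmetric])
    have "vh = (\<lambda>s. z + (s - a) *\<^sub>R w s)" using w(2) by (auto simp: diff_eq_eq add.commute)
    then show "(vh has_vector_derivative w s + (s - a) *\<^sub>R w' s) (at s)"
      using w'(3)[of s] by (auto intro!: derivative_eq_intros)
  qed
  \<comment> \<open>The numerator makes the weight scale invariant. Since every node is at least
    \<open>d * \<tau>\<close> away from \<open>a\<close>, the weight is at most \<open>1 / d\<close>
    wherever \<open>Q\<close> evaluates it.\<close>
  define c where "c s = \<tau> / (s - a)" for s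
  have c: "0 \<le> c (y i)" "c (y i) \<le> 1 / d" "c (y i) * (y i - a) = \<tau>" if "i \<le> q" for i
    using node_ge[OF that] y_gt_a[OF that] \<tau> d by (auto simp: c_def d_def[symmetric] \<tau>_def[symmetric] field_simps)
  define \<Phi> where "\<Phi> = interpolant q y (\<lambda>s. c s *\<^sub>R v s)"
  have \<Phi>: "vpoly_on q UNIV \<Phi>" unfolding \<Phi>_def by (rule vpoly_on_interpolant)
  have \<Phi>_node: "\<Phi> (y i) = c (y i) *\<^sub>R v (y i)" if "i \<le> q" for i
    unfolding \<Phi>_def by (rule interpolant_at_node[OF y_inj that])
  have v_node: "v (y i) = z + (y i - a) *\<^sub>R w (y i)" if "i \<le> q" for i
    using w(2)[of "y i"] \<theta>_node[OF that] by (simp add: vh_def algebra_simps)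
  define F where "F = Q (\<lambda>s. inner (\<Phi> s) (\<Phi> s))"
  have F: "F \<le> B / d\<^sup>2"
  proof -
    have "F \<le> Q (\<lambda>s. 1 / d\<^sup>2 * inner (v s) (v s))" unfolding F_def
    proof (intro Q_mono)
      fix i assume i: "i \<le> q"
      have "(c (y i))\<^sup>2 \<le> (1 / d)\<^sup>2" using c[OF i] by (intro power_mono)
      then show "inner (\<Phi> (y i)) (\<Phi> (y i)) \<le> 1 / d\<^sup>2 * inner (v (y i)) (v (y i))"
        using mult_right_mono[of "(c (y i))\<^sup>2" "(1 / d)\<^sup>2" "inner (v (y i)) (v (y i))"]
        by (simp add: \<Phi>_node[OF i] power2_eq_square)
    qed
    then show ?thesis unfolding Q_cmult B_def by (simp only: times_divide_eq_left mult_1)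
  qed
  define g where "g s = inner (M0 (w s)) (w s)" for s
  define G where "G = Q g"
  define t1 where "t1 = 2 * \<rho> * integral {a..b} (\<lambda>s. E s * (\<theta> s * inner (M0 \<eta>) (\<Phi> s)))"
  define t2 where "t2 = 2 * \<rho> * integral {a..b} (\<lambda>s. E s * (\<theta> s * inner (M0 jmp) (\<Phi> s)))"
  \<comment> \<open>The boundary value produced here cancels the jump term of the error equation.
    This matters because \<open>\<Phi> a\<close> is not controlled: \<Phi> interpolates a function
    that is singular at \<open>a\<close>.\<close>
  have th: "Q (\<lambda>s. \<theta>' s * inner (M0 jmp) (\<Phi> s)) = - inner (M0 jmp) (\<Phi> a) + t2"
    unfolding t2_def using \<theta>'
    by (intro Q_theta_deriv const_inner_poly \<Phi>) (auto simp: has_real_derivative_iff_has_vector_derivative)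
  have "Q (\<lambda>s. inner (M0 (v' s) + M1 (v s) + A (v s)) (\<Phi> s))
      = Q (\<lambda>s. inner (M0 (w s + (s - a) *\<^sub>R w' s)) (\<Phi> s) + (\<theta>' s * inner (M0 jmp) (\<Phi> s)
          + c s * inner (M1 (v s)) (v s)))"
  proof (intro Q_cong)
    fix i assume i: "i \<le> q"
    have "M0 (v' (y i)) = M0 (w (y i) + (y i - a) *\<^sub>R w' (y i)) + \<theta>' (y i) *\<^sub>R M0 jmp"
      unfolding vd[symmetric] by (simp add: M0.diff M0.scale)
    then show "inner (M0 (v' (y i)) + M1 (v (y i)) + A (v (y i))) (\<Phi> (y i))
        = inner (M0 (w (y i) + (y i - a) *\<^sub>R w' (y i))) (\<Phi> (y i)) + (\<theta>' (y i) * inner (M0 jmp) (\<Phi> (y i))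
          + c (y i) * inner (M1 (v (y i))) (v (y i)))"
      using skew[OF i] by (simp add: inner_add_left \<Phi>_node[OF i] algebra_simps)
  qed
  then have eq1: "Q (\<lambda>s. inner (M0 (w s + (s - a) *\<^sub>R w' s)) (\<Phi> s)) + Q (\<lambda>s. c s * inner (M1 (v s)) (v s))
      = Q (\<lambda>s. inner (r s) (\<Phi> s)) + t1 - t2"
    using error_eq[OF \<Phi>] th unfolding Q_add t1_def by linarith
  \<comment> \<open>At the nodes \<Phi> equals \<open>c z + \<tau> w\<close>. The part with
    \<open>w\<close> gives the terms to be kept, the part with \<open>z\<close> two cross terms to
    be absorbed.\<close>
  have "Q (\<lambda>s. inner (M0 (w s + (s - a) *\<^sub>R w' s)) (\<Phi> s))
      = Q (\<lambda>s. c s * inner (M0 (w s)) z + (\<tau> * inner (M0 (w' s)) z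
           + (\<tau> * g s + \<tau> * ((s - a) * inner (M0 (w' s)) (w s)))))"
  proof (intro Q_cong)
    fix i assume i: "i \<le> q"
    define e where "e = y i - a"
    have "inner (M0 (w (y i) + (y i - a) *\<^sub>R w' (y i))) (\<Phi> (y i))
      = c (y i) * inner (M0 (w (y i))) z + ((c (y i) * (y i - a)) * inner (M0 (w' (y i))) z
           + ((c (y i) * (y i - a)) * g (y i) + (c (y i) * (y i - a)) * ((y i - a) * inner (M0 (w' (y i))) (w (y i)))))"
      unfolding \<Phi>_node[OF i] g_def v_node[OF i] e_def[symmetric]
      by (simp add: M0.add M0.scale inner_add_left inner_add_right algebra_simps)
    then show "inner (M0 (w (y i) + (y i - a) *\<^sub>R w' (y i))) (\<Phi> (y i))
      = c (y i) * inner (M0 (w (y i))) z + (\<tau> * inner (M0 (w' (y i))) z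
           + (\<tau> * g (y i) + \<tau> * ((y i - a) * inner (M0 (w' (y i))) (w (y i)))))"
      unfolding c(3)[OF i] .
  qed
  then have eq2: "Q (\<lambda>s. inner (M0 (w s + (s - a) *\<^sub>R w' s)) (\<Phi> s))
      = Q (\<lambda>s. c s * inner (M0 (w s)) z) + \<tau> * Q (\<lambda>s. inner (M0 (w' s)) z)
        + \<tau> * G + \<tau> * Q (\<lambda>s. (s - a) * inner (M0 (w' s)) (w s))"
    unfolding Q_add Q_cmult G_def by simp
  have b1: "\<tau> * Q (\<lambda>s. (s - a) * inner (M0 (w' s)) (w s)) \<ge> \<tau> * (- G / 2)"
    using weighted_deriv_ge[OF w(1) w'] \<tau> unfolding G_def g_def
    by (intro mult_left_mono) auto
  have b2: "- (Q (\<lambda>s. c s * inner (M0 (w s)) z)) \<le> \<tau> / 8 * G + 2 / d\<^sup>2 * Z"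
  proof -
    have "- Q (\<lambda>s. c s * inner (M0 (w s)) z) = Q (\<lambda>s. (-1) * (c s * inner (M0 (w s)) z))"
      unfolding Q_cmult by simp
    also have "\<dots> \<le> Q (\<lambda>s. \<tau> / 8 * g s + 2 / (d\<^sup>2 * \<tau>) * Z)"
    proof (intro Q_mono)
      fix i assume i: "i \<le> q"
      have "(-1) * (c (y i) * inner (M0 (w (y i))) z) \<le> c (y i) * \<bar>inner (M0 (w (y i))) z\<bar>"
        using c(1)[OF i] by (simp add: abs_if mult_nonneg_nonpos)
      also have "\<dots> \<le> 1 / d * ((d * \<tau> / 4) / 2 * g (y i) + 1 / (2 * (d * \<tau> / 4)) * Z)"
        unfolding g_def Z_def using c[OF i] \<tau> d by (intro mult_mono M0_young) auto
      also have "\<dots> = \<tau> / 8 * g (y i) + 2 / (d\<^sup>2 * \<tau>) * Z"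
        using d \<tau> by (simp add: field_simps power2_eq_square)
      finally show "(-1) * (c (y i) * inner (M0 (w (y i))) z) \<le> \<tau> / 8 * g (y i) + 2 / (d\<^sup>2 * \<tau>) * Z" .
    qed
    also have "\<dots> = \<tau> / 8 * G + Q (\<lambda>s. 2 / (d\<^sup>2 * \<tau>) * Z)" by (simp only: Q_add Q_cmult G_def)
    also have "Q (\<lambda>s. 2 / (d\<^sup>2 * \<tau>) * Z) \<le> (b - a) * (2 / (d\<^sup>2 * \<tau>) * Z)"
      using M0_nonneg[of z] \<tau> by (intro Q_const_le) (auto simp: Z_def)
    also have "(b - a) * (2 / (d\<^sup>2 * \<tau>) * Z) = 2 / d\<^sup>2 * Z" using \<tau> by (simp add: \<tau>_def)
    finally show ?thesis by simp
  qed
  define K where "K = inverse_const (2 * q) * exp (2 * \<rho> * T)"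
  have K: "K > 0" using inverse_const_pos by (simp add: K_def)
  have b3: "\<tau> * \<bar>Q (\<lambda>s. inner (M0 (w' s)) z)\<bar> \<le> \<tau> / 8 * G + 8 * (1 + \<rho> * T)\<^sup>2 * K * Z"
    using deriv_pairing_bound[OF w(1) w'(1,3)] unfolding \<tau>_def G_def g_def K_def Z_def .
  have b4: "- Q (\<lambda>s. c s * inner (M1 (v s)) (v s)) \<le> \<mu>1 / d * B"
  proof -
    have "- Q (\<lambda>s. c s * inner (M1 (v s)) (v s)) = Q (\<lambda>s. (-1) * (c s * inner (M1 (v s)) (v s)))"
      unfolding Q_cmult by simp
    also have "\<dots> \<le> Q (\<lambda>s. \<mu>1 / d * inner (v s) (v s))"
    proof (intro Q_mono)
      fix i assume i: "i \<le> q"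
      have "\<bar>inner (M1 (v (y i))) (v (y i))\<bar> \<le> norm (M1 (v (y i))) * norm (v (y i))"
        by (rule Cauchy_Schwarz_ineq2)
      also have "\<dots> \<le> (\<mu>1 * norm (v (y i))) * norm (v (y i))"
        by (intro mult_right_mono M1_le) auto
      finally have M1: "\<bar>inner (M1 (v (y i))) (v (y i))\<bar> \<le> \<mu>1 * inner (v (y i)) (v (y i))"
        by (simp add: power2_norm_eq_inner[symmetric] power2_eq_square mult_ac)
      have "(-1) * (c (y i) * inner (M1 (v (y i))) (v (y i))) \<le> c (y i) * \<bar>inner (M1 (v (y i))) (v (y i))\<bar>"
        using c(1)[OF i] by (simp add: abs_if mult_nonneg_nonpos)
      also have "\<dots> \<le> 1 / d * (\<mu>1 * inner (v (y i)) (v (y i)))"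
        using c[OF i] d M1 by (intro mult_mono) auto
      finally show "(-1) * (c (y i) * inner (M1 (v (y i))) (v (y i))) \<le> \<mu>1 / d * inner (v (y i)) (v (y i))"
        by simp
    qed
    also have "\<dots> = \<mu>1 / d * B" by (simp only: Q_cmult B_def)
    finally show ?thesis .
  qed
  have "Q (\<lambda>s. inner (r s) (\<Phi> s)) \<le> Q (\<lambda>s. 1 / 2 * inner (r s) (r s) + 1 / 2 * inner (\<Phi> s) (\<Phi> s))"
  proof (intro Q_mono)
    fix i
    show "inner (r (y i)) (\<Phi> (y i)) \<le> 1 / 2 * inner (r (y i)) (r (y i)) + 1 / 2 * inner (\<Phi> (y i)) (\<Phi> (y i))"
      using inner_young[of 1 "r (y i)" "\<Phi> (y i)"] by simp
  qed
  then have b5: "Q (\<lambda>s. inner (r s) (\<Phi> s)) \<le> 1 / 2 * R + 1 / 2 * F"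
    by (simp only: Q_add Q_cmult R_def F_def)
  have "\<bar>integral {a..b} (\<lambda>s. E s * (\<theta> s * inner (M0 \<eta>) (\<Phi> s)))\<bar>
      \<le> \<kappa> * ((b - a) * (1 / 2 * inner (M0 \<eta>) (M0 \<eta>)) + 1 / 2 * F)"
    unfolding F_def using inner_young[of 1 "M0 \<eta>"]
    by (intro theta_integral_bound inner_poly \<Phi> continuous_intros vpoly_on_continuous[OF \<Phi>]) auto
  then have "2 * \<rho> * \<bar>integral {a..b} (\<lambda>s. E s * (\<theta> s * inner (M0 \<eta>) (\<Phi> s)))\<bar>
      \<le> 2 * \<rho> * (\<kappa> * ((b - a) * (1 / 2 * inner (M0 \<eta>) (M0 \<eta>)) + 1 / 2 * F))"
    using rho_pos by (intro mult_left_mono) auto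
  moreover have "\<bar>t1\<bar> = 2 * \<rho> * \<bar>integral {a..b} (\<lambda>s. E s * (\<theta> s * inner (M0 \<eta>) (\<Phi> s)))\<bar>"
    using rho_pos by (simp add: t1_def abs_mult)
  ultimately have b6: "\<bar>t1\<bar> \<le> k * (\<tau> * (norm (M0 \<eta>))\<^sup>2) + k * F"
    by (simp add: k_def \<tau>_def power2_norm_eq_inner field_simps)
  have M0\<Phi>: "\<bar>inner (M0 jmp) (\<Phi> s)\<bar> \<le> 1 / 2 * J + \<mu>0 / 2 * inner (\<Phi> s) (\<Phi> s)" for s
  proof -
    have "inner (M0 (\<Phi> s)) (\<Phi> s) \<le> norm (M0 (\<Phi> s)) * norm (\<Phi> s)" by (rule norm_cauchy_schwarz)
    also have "\<dots> \<le> (\<mu>0 * norm (\<Phi> s)) * norm (\<Phi> s)" by (intro mult_right_mono M0_le) auto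
    finally have "inner (M0 (\<Phi> s)) (\<Phi> s) \<le> \<mu>0 * inner (\<Phi> s) (\<Phi> s)"
      by (simp add: power2_norm_eq_inner[symmetric] power2_eq_square mult_ac)
    then show ?thesis using M0_young[of 1 jmp "\<Phi> s"] by (simp add: J_def)
  qed
  have "\<bar>integral {a..b} (\<lambda>s. E s * (\<theta> s * inner (M0 jmp) (\<Phi> s)))\<bar>
      \<le> \<kappa> * ((b - a) * (1 / 2 * J) + \<mu>0 / 2 * F)"
    unfolding F_def using M0\<Phi> M0_nonneg[of jmp]
    by (intro theta_integral_bound inner_poly \<Phi> continuous_intros vpoly_on_continuous[OF \<Phi>])
      (auto simp: J_def)
  then have "2 * \<rho> * \<bar>integral {a..b} (\<lambda>s. E s * (\<theta> s * inner (M0 jmp) (\<Phi> s)))\<bar>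
      \<le> 2 * \<rho> * (\<kappa> * ((b - a) * (1 / 2 * J) + \<mu>0 / 2 * F))"
    using rho_pos by (intro mult_left_mono) auto
  moreover have "\<bar>t2\<bar> = 2 * \<rho> * \<bar>integral {a..b} (\<lambda>s. E s * (\<theta> s * inner (M0 jmp) (\<Phi> s)))\<bar>"
    using rho_pos by (simp add: t2_def abs_mult)
  ultimately have b7: "\<bar>t2\<bar> \<le> k * (\<tau> * J) + k * \<mu>0 * F"
    by (simp add: k_def \<tau>_def field_simps)
  define H where "H = \<tau> * (norm (M0 \<eta>))\<^sup>2"
  have data: "data = R + H" by (simp add: data_def R_def H_def \<tau>_def)
  have nn: "0 \<le> B" "0 \<le> R" "0 \<le> H" "0 \<le> Z" "0 \<le> J" "0 \<le> G"
    unfolding B_def R_def H_def Z_def J_def G_def g_def using \<tau> M0_nonneg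
    by (auto intro: Q_nonneg)
  have "(1 / 2 + k + k * \<mu>0) * F \<le> (1 / 2 + k + k * \<mu>0) * (B / d\<^sup>2)"
    using F k \<mu>0 by (intro mult_left_mono) auto
  moreover have "k * (\<tau> * J) \<le> k * T * J"
    using k nn(5) \<tau>T by (simp add: mult_right_mono)
  moreover have "k * H + 1 / 2 * R \<le> (1 + k) * data"
    using nn k by (simp add: data distrib_left distrib_right)
  moreover have "b - a = \<tau>" by (simp add: \<tau>_def)
  \<comment> \<open>Bookkeeping for \<open>\<tau> * G\<close>: a half goes to the derivative term
    \<open>b1\<close>, an eighth to each of the cross terms \<open>b2\<close> and \<open>b3\<close>,
    and a quarter survives.\<close>
  moreover have "\<tau> / 4 * G = \<tau> * G + \<tau> * (- G / 2) - \<tau> / 8 * G - \<tau> / 8 * G" by (simp add: field_simps)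
  moreover have "- (\<tau> * Q (\<lambda>s. inner (M0 (w' s)) z)) \<le> \<tau> * \<bar>Q (\<lambda>s. inner (M0 (w' s)) z)\<bar>"
    using \<tau> by (metis abs_ge_minus_self minus_mult_right mult_left_mono order_less_imp_le)
  moreover have "(1 / 2 + k + k * \<mu>0) * F = 1 / 2 * F + k * F + k * \<mu>0 * F"
    by (simp add: distrib_right)
  ultimately have "\<tau> / 4 * G \<le> 2 / d\<^sup>2 * Z + 8 * (1 + \<rho> * T)\<^sup>2 * K * Z
      + \<mu>1 / d * B + (1 / 2 + k + k * \<mu>0) * (B / d\<^sup>2) + (1 + k) * data + k * T * J"
    using eq1 eq2 b1 b2 b3 b4 b5 b6 b7 unfolding H_def[symmetric] by linarith
  then have main: "\<tau> / 4 * G \<le> (2 / d\<^sup>2 + 8 * (1 + \<rho> * T)\<^sup>2 * K) * Z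
      + (\<mu>1 / d + (1 / 2 + k + k * \<mu>0) / d\<^sup>2) * B + (1 + k) * data + k * T * J"
    by (simp add: distrib_right)
  define C where "C = sup_const_aux \<rho> T q \<mu>0 \<mu>1"
  have C: "C = 2 / d\<^sup>2 + 8 * (1 + \<rho> * T)\<^sup>2 * K + \<mu>1 / d + (1 / 2 + k + k * \<mu>0) / d\<^sup>2 + 1 + k + k * T"
    by (simp add: C_def sup_const_aux_def Let_def d_def k_def K_def)
  define S where "S = Z + B + data + J"
  have T: "T > 0" using \<tau> \<tau>T by simp
  have nn': "0 \<le> 2 / d\<^sup>2 + 8 * (1 + \<rho> * T)\<^sup>2 * K" "0 \<le> \<mu>1 / d + (1 / 2 + k + k * \<mu>0) / d\<^sup>2"
    "0 \<le> 1 + k" "0 \<le> k * T" "0 \<le> data"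
    using d k K T \<mu>0 \<mu>1 nn by (auto simp: data)
  have "\<tau> / 4 * G \<le> (2 / d\<^sup>2 + 8 * (1 + \<rho> * T)\<^sup>2 * K) * S
      + (\<mu>1 / d + (1 / 2 + k + k * \<mu>0) / d\<^sup>2) * S + (1 + k) * S + k * T * S"
    using nn nn' by (intro order_trans[OF main] add_mono mult_left_mono) (auto simp: S_def)
  also have "\<dots> = C * S" unfolding C by (simp add: algebra_simps)
  finally have GS: "\<tau> * G \<le> 4 * (C * S)" by simp
  \<comment> \<open>Returning from \<open>w\<close> to \<open>v\<close> gains
    \<open>\<tau>\<^sup>2\<close> in front of \<open>G\<close>. As \<open>\<tau> * G\<close> is
    bounded, the quadrature energy of \<open>v\<close> is of the order of \<tau>, as
    \<open>sup_le_Q\<close> requires.\<close>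
  have "Q (\<lambda>s. inner (M0 (v s)) (v s)) \<le> Q (\<lambda>s. 2 * Z + 2 * \<tau>\<^sup>2 * g s)"
  proof (intro Q_mono)
    fix i assume i: "i \<le> q"
    define e where "e = y i - a"
    have e: "0 \<le> e" "e \<le> \<tau>" using y_gt_a[OF i] y_le_b[OF i] by (auto simp: e_def \<tau>_def)
    have sym: "inner (M0 (w (y i))) z = inner (M0 z) (w (y i))"
      using M0_sym[of z "w (y i)"] by (simp add: inner_commute)
    have "inner (M0 (v (y i))) (v (y i)) = Z + 2 * inner (M0 (e *\<^sub>R w (y i))) z + e\<^sup>2 * g (y i)"
      unfolding v_node[OF i] e_def[symmetric] g_def Z_def using sym
      by (simp add: M0.add M0.scale inner_add_left inner_add_right power2_eq_square distrib_left)
    also have "\<dots> \<le> Z + (e\<^sup>2 * g (y i) + Z) + e\<^sup>2 * g (y i)"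
      using M0_young[of 1 "e *\<^sub>R w (y i)" z]
      by (simp add: M0.scale g_def Z_def power2_eq_square)
    also have "\<dots> = 2 * Z + 2 * (e\<^sup>2 * g (y i))" by simp
    also have "\<dots> \<le> 2 * Z + 2 * (\<tau>\<^sup>2 * g (y i))"
      using e M0_nonneg by (intro add_mono mult_left_mono mult_right_mono power_mono) (auto simp: g_def)
    finally show "inner (M0 (v (y i))) (v (y i)) \<le> 2 * Z + 2 * \<tau>\<^sup>2 * g (y i)" by simp
  qed
  also have "\<dots> = Q (\<lambda>s. 2 * Z) + 2 * \<tau>\<^sup>2 * G" by (simp only: Q_add Q_cmult G_def)
  also have "\<dots> \<le> (b - a) * (2 * Z) + 2 * \<tau>\<^sup>2 * G" using nn by (intro add_right_mono Q_const_le) auto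
  also have "\<dots> = \<tau> * (2 * Z + 2 * (\<tau> * G))" by (simp add: \<tau>_def power2_eq_square algebra_simps)
  also have "\<dots> \<le> \<tau> * (2 * S + 8 * (C * S))"
  proof (rule mult_left_mono)
    have "Z \<le> S" using nn nn' by (simp add: S_def)
    then show "2 * Z + 2 * (\<tau> * G) \<le> 2 * S + 8 * (C * S)" using GS by linarith
  qed (use \<tau> in simp)
  finally have "K * Q (\<lambda>s. inner (M0 (v s)) (v s)) \<le> K * (\<tau> * (2 * S + 8 * (C * S)))"
    using K by (intro mult_left_mono) auto
  moreover have "\<tau> * inner (M0 (v s)) (v s) \<le> K * Q (\<lambda>s. inner (M0 (v s)) (v s))"
    unfolding K_def \<tau>_def by (intro sup_le_Q M0_inner_poly v M0_nonneg s)
  ultimately have "\<tau> * inner (M0 (v s)) (v s) \<le> \<tau> * (K * (2 + 8 * C) * S)"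
    by (simp add: algebra_simps)
  then have "inner (M0 (v s)) (v s) \<le> K * (2 + 8 * C) * S" using \<tau> by simp
  then show ?thesis unfolding sup_const_def K_def C_def S_def Z_def B_def J_def .
qed

end

section \<open>Regularity of the exact solution\<close>

lemma strongly_measurable_diff:
  assumes "strongly_measurable f" "strongly_measurable g"
  shows "strongly_measurable (\<lambda>s. f s - g s)"
proof -
  obtain u v where u: "\<And>n. simple_function lebesgue (u n)" "AE x in lebesgue. (\<lambda>n::nat. u n x) \<longlonglongrightarrow> f x"
    and v: "\<And>n. simple_function lebesgue (v n)" "AE x in lebesgue. (\<lambda>n::nat. v n x) \<longlonglongrightarrow> g x"
    using assms unfolding strongly_measurable_def by blast
  have "AE x in lebesgue. (\<lambda>n::nat. u n x - v n x) \<longlonglongrightarrow> f x - g x"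
    using u(2) v(2) by eventually_elim (rule tendsto_diff)
  then show ?thesis unfolding strongly_measurable_def
    by (intro exI[of _ "\<lambda>n x. u n x - v n x"]) (auto intro: simple_function_compose2 u v)
qed

text \<open>The simple functions converge only almost everywhere. On the exceptional null set the
  values are arbitrary, and completeness of Lebesgue measure makes its subsets measurable.\<close>

lemma strongly_measurable_norm:
  assumes "strongly_measurable f"
  shows "(\<lambda>s. norm (f s)) \<in> borel_measurable lebesgue"
proof -
  obtain u where u: "\<And>n. simple_function lebesgue (u n)" "AE x in lebesgue. (\<lambda>n::nat. u n x) \<longlonglongrightarrow> f x"
    using assms unfolding strongly_measurable_def by blast
  from u(2) obtain N where N: "N \<in> null_sets lebesgue" "\<And>x. x \<notin> N \<Longrightarrow> (\<lambda>n::nat. u n x) \<longlonglongrightarrow> f x"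
    by (auto elim!: AE_E3)
  define g where "g x = (if x \<in> N then 0 else norm (f x))" for x
  have N_set: "N \<in> sets lebesgue" using N(1) by blast
  have "g \<in> borel_measurable lebesgue"
  proof (rule borel_measurable_LIMSEQ_metric)
    show "(\<lambda>x. if x \<in> N then 0 else norm (u n x)) \<in> borel_measurable lebesgue" for n
      using N_set by (intro measurable_If_set borel_measurable_simple_function
          simple_function_compose1[OF u(1)]) auto
    show "(\<lambda>n. if x \<in> N then 0 else norm (u n x)) \<longlonglongrightarrow> g x" for x
      using N(2)[of x] by (cases "x \<in> N") (auto simp: g_def intro: tendsto_norm)
  qed
  then have g: "{x. g x \<le> a} \<in> sets lebesgue" for a
    by (simp add: borel_measurable_iff_le)
  have "{x. norm (f x) \<le> a} \<in> sets lebesgue" for a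
  proof -
    have "{x. norm (f x) \<le> a} = ({x. g x \<le> a} - N) \<union> ({x. norm (f x) \<le> a} \<inter> N)"
      by (auto simp: g_def)
    moreover have "{x. norm (f x) \<le> a} \<inter> N \<in> sets lebesgue"
      using null_sets_completion_subset[OF Int_lower2 N(1)] by blast
    ultimately show ?thesis using sets.Un[OF sets.Diff[OF g N_set]] by metis
  qed
  then show ?thesis by (simp add: borel_measurable_iff_le)
qed

text \<open>The argument is discretised instead of the values: clamp it to [-n, n] and round it down
  to a multiple of 1 / (n + 1). This leaves finitely many arguments, so composing with
  \<open>f\<close> gives a simple function in any normed space.\<close>

lemma strongly_measurable_continuous:
  fixes f :: "real \<Rightarrow> 'a::real_normed_vector"
  assumes "continuous_on UNIV f"
  shows "strongly_measurable f"
proof -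
  define h where "h n x = real_of_int \<lfloor>real (Suc n) * max (- real n) (min (real n) x)\<rfloor> / real (Suc n)" for n :: nat and x :: real
  have "simple_function lebesgue (\<lambda>x. f (h n x))" for n
  proof (rule simple_function_compose1[where f = "h n" and g = f], rule simple_function_borel_measurable)
    show "h n \<in> borel_measurable lebesgue"
      unfolding h_def by (intro measurable_completion) measurable
    have "h n ` space lebesgue \<subseteq> (\<lambda>k. real_of_int k / real (Suc n)) ` {- int (Suc n * n)..int (Suc n * n)}"
    proof safe
      fix x
      define m where "m = max (- real n) (min (real n) x)"
      have m: "- real n \<le> m" "m \<le> real n" by (auto simp: m_def)
      have le: "real (Suc n) * m \<le> real (Suc n) * real n" "real (Suc n) * (- real n) \<le> real (Suc n) * m"
        using m by (intro mult_left_mono; simp)+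
      have "\<lfloor>real (Suc n) * m\<rfloor> \<le> int (Suc n * n)" "- int (Suc n * n) \<le> \<lfloor>real (Suc n) * m\<rfloor>"
      proof -
        have eq: "real (Suc n) * real n = real_of_int (int (Suc n * n))"
          by (metis of_int_of_nat_eq of_nat_mult)
        from le show "\<lfloor>real (Suc n) * m\<rfloor> \<le> int (Suc n * n)" "- int (Suc n * n) \<le> \<lfloor>real (Suc n) * m\<rfloor>"
          unfolding mult_minus_right eq by linarith+
      qed
      then show "h n x \<in> (\<lambda>k. real_of_int k / real (Suc n)) ` {- int (Suc n * n)..int (Suc n * n)}"
        unfolding h_def m_def[symmetric] by (intro imageI) auto
    qed
    then show "finite (h n ` space lebesgue)" by (rule finite_subset) simp
  qed
  moreover have "(\<lambda>n. h n x) \<longlonglongrightarrow> x" for x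
  proof (rule tendsto_sandwich)
    obtain N :: nat where N: "\<bar>x\<bar> \<le> real N" using real_arch_simple by blast
    have h: "h n x = real_of_int \<lfloor>real (Suc n) * x\<rfloor> / real (Suc n)" if "N \<le> n" for n
    proof -
      have "max (- real n) (min (real n) x) = x" using N that by linarith
      then show ?thesis by (simp add: h_def)
    qed
    show "\<forall>\<^sub>F n in sequentially. h n x \<le> x"
      using eventually_ge_at_top[of N]
    proof eventually_elim
      case (elim n)
      have "real_of_int \<lfloor>real (Suc n) * x\<rfloor> \<le> real (Suc n) * x" by simp
      then have "h n x \<le> (real (Suc n) * x) / real (Suc n)"
        unfolding h[OF elim] by (intro divide_right_mono) auto
      then show ?case by (metis nonzero_mult_div_cancel_left of_nat_eq_0_iff Zero_not_Suc)
    qed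
    show "\<forall>\<^sub>F n in sequentially. x - 1 / real (Suc n) \<le> h n x"
      using eventually_ge_at_top[of N]
    proof eventually_elim
      case (elim n)
      have "real (Suc n) * x - 1 \<le> real_of_int \<lfloor>real (Suc n) * x\<rfloor>" by linarith
      then have "(real (Suc n) * x - 1) / real (Suc n) \<le> h n x"
        unfolding h[OF elim] by (intro divide_right_mono) auto
      then show ?case by (simp add: diff_divide_distrib)
    qed
    show "(\<lambda>n. x - 1 / real (Suc n)) \<longlonglongrightarrow> x"
      using tendsto_diff[OF tendsto_const[of x] LIMSEQ_inverse_real_of_nat] by (simp add: inverse_eq_divide)
  qed simp
  then have "(\<lambda>n. f (h n x)) \<longlonglongrightarrow> f x" for x
    using assms by (intro isCont_tendsto_compose[of x f]) (auto simp: continuous_on_eq_continuous_at)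
  ultimately show ?thesis unfolding strongly_measurable_def
    by (intro exI[of _ "\<lambda>n x. f (h n x)"]) auto
qed

lemma wnorm_sq_triangle:
  assumes "strongly_measurable f" "strongly_measurable g" "strongly_measurable h"
  shows "wnorm_sq \<rho> (\<lambda>s. f s - h s) \<le> 2 * wnorm_sq \<rho> (\<lambda>s. f s - g s) + 2 * wnorm_sq \<rho> (\<lambda>s. h s - g s)"
proof -
  define W where "W k s = ennreal ((norm (k s))\<^sup>2 * exp (- 2 * \<rho> * s))" for k :: "real \<Rightarrow> 'a" and s
  have m: "W k \<in> borel_measurable lebesgue" if "strongly_measurable k" for k
  proof -
    have "(\<lambda>s::real. exp (- 2 * \<rho> * s)) \<in> borel_measurable lebesgue"
      by (intro measurable_completion) measurable
    then show ?thesis unfolding W_def[abs_def]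
      by (intro measurable_compose[OF _ measurable_ennreal] borel_measurable_times
          borel_measurable_power strongly_measurable_norm[OF that])
  qed
  have "W (\<lambda>s. f s - h s) s \<le> 2 * W (\<lambda>s. f s - g s) s + 2 * W (\<lambda>s. h s - g s) s" for s
  proof -
    have "norm (f s - h s) \<le> norm (f s - g s) + norm (h s - g s)"
      by (metis norm_minus_commute norm_diff_triangle_le order_refl)
    then have "(norm (f s - h s))\<^sup>2 \<le> (norm (f s - g s) + norm (h s - g s))\<^sup>2"
      by (intro power_mono) auto
    also have "\<dots> \<le> 2 * (norm (f s - g s))\<^sup>2 + 2 * (norm (h s - g s))\<^sup>2"
      using sum_squares_bound[of "norm (f s - g s)" "norm (h s - g s)"] by (simp add: power2_sum)
    finally have "(norm (f s - h s))\<^sup>2 * exp (- 2 * \<rho> * s) \<le>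
        (2 * (norm (f s - g s))\<^sup>2 + 2 * (norm (h s - g s))\<^sup>2) * exp (- 2 * \<rho> * s)"
      by (intro mult_right_mono) auto
    also have "\<dots> = 2 * ((norm (f s - g s))\<^sup>2 * exp (- 2 * \<rho> * s)) + 2 * ((norm (h s - g s))\<^sup>2 * exp (- 2 * \<rho> * s))"
      by (simp add: algebra_simps)
    finally have "W (\<lambda>s. f s - h s) s \<le> ennreal (2 * ((norm (f s - g s))\<^sup>2 * exp (- 2 * \<rho> * s)) +
        2 * ((norm (h s - g s))\<^sup>2 * exp (- 2 * \<rho> * s)))"
      unfolding W_def by (rule ennreal_leI)
    also have "\<dots> = 2 * W (\<lambda>s. f s - g s) s + 2 * W (\<lambda>s. h s - g s) s"
      unfolding W_def by (subst ennreal_plus) (auto simp: ennreal_mult'[of 2])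
    finally show ?thesis .
  qed
  then have "(\<integral>\<^sup>+s. W (\<lambda>s. f s - h s) s \<partial>lebesgue) \<le>
      (\<integral>\<^sup>+s. (2 * W (\<lambda>s. f s - g s) s + 2 * W (\<lambda>s. h s - g s) s) \<partial>lebesgue)"
    by (intro nn_integral_mono)
  also have "\<dots> = 2 * (\<integral>\<^sup>+s. W (\<lambda>s. f s - g s) s \<partial>lebesgue) + 2 * (\<integral>\<^sup>+s. W (\<lambda>s. h s - g s) s \<partial>lebesgue)"
  proof -
    have d: "W (\<lambda>s. f s - g s) \<in> borel_measurable lebesgue" "W (\<lambda>s. h s - g s) \<in> borel_measurable lebesgue"
      by (intro m strongly_measurable_diff assms)+
    then have "(\<lambda>s. 2 * W (\<lambda>s. f s - g s) s) \<in> borel_measurable lebesgue"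
      "(\<lambda>s. 2 * W (\<lambda>s. h s - g s) s) \<in> borel_measurable lebesgue"
      by measurable
    then show ?thesis by (subst nn_integral_add) (simp_all add: nn_integral_cmult d)
  qed
  finally show ?thesis unfolding W_def wnorm_sq_def .
qed

text \<open>On [-R, R] the exponential weight is at least
  \<open>exp (- 2 * \<bar>\<rho>\<bar> * R)\<close>. This lets integrals of continuous functions
  over bounded intervals inherit convergence in the weighted norm.\<close>

lemma integral_le_wnorm_sq:
  fixes F :: "real \<Rightarrow> 'a::real_normed_vector"
  assumes h: "continuous_on {c..d} h" "\<And>s. s \<in> {c..d} \<Longrightarrow> 0 \<le> h s"
    and F: "strongly_measurable F" and le: "AE s in lebesgue. s \<in> {c..d} \<longrightarrow> h s \<le> C * (norm (F s))\<^sup>2"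
    and C: "0 \<le> C" and R: "{c..d} \<subseteq> {-R..R}"
  shows "ennreal (integral {c..d} h) \<le> ennreal (C * exp (2 * \<bar>\<rho>\<bar> * R)) * wnorm_sq \<rho> F"
proof -
  have "(\<lambda>s::real. exp (- 2 * \<rho> * s)) \<in> borel_measurable lebesgue"
    by (intro measurable_completion) measurable
  then have m: "(\<lambda>s. ennreal ((norm (F s))\<^sup>2 * exp (- 2 * \<rho> * s))) \<in> borel_measurable lebesgue"
    by (intro measurable_compose[OF _ measurable_ennreal] borel_measurable_times
        borel_measurable_power strongly_measurable_norm[OF F])
  have "ennreal (integral {c..d} h) = (\<integral>\<^sup>+s. ennreal (h s) * indicator {c..d} s \<partial>lborel)"
    by (intro nn_integral_has_integral_lebesgue'[symmetric] integrable_integral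
        integrable_continuous_interval h)
  also have "\<dots> = (\<integral>\<^sup>+s. ennreal (h s) * indicator {c..d} s \<partial>lebesgue)"
    by (simp add: nn_integral_completion)
  also have "\<dots> \<le> (\<integral>\<^sup>+s. ennreal (C * exp (2 * \<bar>\<rho>\<bar> * R)) * ennreal ((norm (F s))\<^sup>2 * exp (- 2 * \<rho> * s)) \<partial>lebesgue)"
  proof (rule nn_integral_mono_AE)
    from le show "AE s in lebesgue. ennreal (h s) * indicator {c..d} s \<le>
        ennreal (C * exp (2 * \<bar>\<rho>\<bar> * R)) * ennreal ((norm (F s))\<^sup>2 * exp (- 2 * \<rho> * s))"
    proof eventually_elim
      case (elim s)
      show ?case
      proof (cases "s \<in> {c..d}")
        case True
        then have "\<bar>s\<bar> \<le> R" using R by auto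
        have "\<rho> * s \<le> \<bar>\<rho>\<bar> * \<bar>s\<bar>" by (metis abs_ge_self abs_mult)
        also have "\<dots> \<le> \<bar>\<rho>\<bar> * R" using \<open>\<bar>s\<bar> \<le> R\<close> by (intro mult_left_mono) auto
        finally have "\<rho> * s \<le> \<bar>\<rho>\<bar> * R" .
        then have "1 \<le> exp (2 * \<bar>\<rho>\<bar> * R) * exp (- 2 * \<rho> * s)"
          by (simp flip: exp_add)
        then have "(C * (norm (F s))\<^sup>2) * 1 \<le> (C * (norm (F s))\<^sup>2) * (exp (2 * \<bar>\<rho>\<bar> * R) * exp (- 2 * \<rho> * s))"
          using C by (intro mult_left_mono) auto
        then have "h s \<le> (C * exp (2 * \<bar>\<rho>\<bar> * R)) * ((norm (F s))\<^sup>2 * exp (- 2 * \<rho> * s))"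
          using elim True by (simp add: mult_ac)
        then have "ennreal (h s) \<le> ennreal ((C * exp (2 * \<bar>\<rho>\<bar> * R)) * ((norm (F s))\<^sup>2 * exp (- 2 * \<rho> * s)))"
          by (rule ennreal_leI)
        then show ?thesis using True C by (simp add: ennreal_mult')
      qed simp
    qed
  qed
  also have "\<dots> = ennreal (C * exp (2 * \<bar>\<rho>\<bar> * R)) * wnorm_sq \<rho> F"
    unfolding wnorm_sq_def by (rule nn_integral_cmult[OF m])
  finally show ?thesis .
qed

lemma tendsto_zero_ennreal_bound:
  assumes "\<And>n. 0 \<le> a n" "\<And>n. ennreal (a n) \<le> ennreal K * w n" "w \<longlonglongrightarrow> 0"
  shows "a \<longlonglongrightarrow> 0"
proof -
  have "(\<lambda>n. ennreal K * w n) \<longlonglongrightarrow> ennreal K * 0"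
    by (intro ennreal_tendsto_cmult assms) simp
  then have "(\<lambda>n. ennreal K * w n) \<longlonglongrightarrow> 0" by simp
  then have "(\<lambda>n. ennreal (a n)) \<longlonglongrightarrow> 0"
    by (rule tendsto_sandwich[OF _ _ tendsto_const, rotated 2]) (auto simp: assms(2))
  then show ?thesis using ennreal_tendsto_0_iff assms(1) by blast
qed

section \<open>Continuous representatives and classical derivatives\<close>

lemma norm_sq_deriv:
  fixes f :: "real \<Rightarrow> 'a::real_inner"
  assumes "(f has_vector_derivative f') (at s)"
  shows "((\<lambda>s. (norm (f s))\<^sup>2) has_real_derivative 2 * inner f' (f s)) (at s)"
proof -
  have "((\<lambda>s. inner (f s) (f s)) has_vector_derivative inner (f s) f' + inner f' (f s)) (at s)"
    by (rule bounded_bilinear.has_vector_derivative[OF bounded_bilinear_inner assms assms])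
  then show ?thesis
    by (simp add: has_real_derivative_iff_has_vector_derivative power2_norm_eq_inner inner_commute)
qed

text \<open>The one-dimensional Sobolev embedding. The minimum of the squared norm over
  \<open>[s, s + 1]\<close> is at most its integral, and the change from the minimum point to
  \<open>s\<close> is the integral of twice the inner product of the function and its
  derivative.\<close>

lemma pointwise_le_wnorm_sq:
  fixes \<psi> :: "real \<Rightarrow> 'a::real_inner"
  assumes d: "\<And>s. (\<psi> has_vector_derivative \<psi>' s) (at s)" and c': "continuous_on UNIV \<psi>'"
    and s: "\<bar>s\<bar> \<le> R"
  shows "ennreal ((norm (\<psi> s))\<^sup>2) \<le>
    ennreal (2 * exp (2 * \<bar>\<rho>\<bar> * (R + 1))) * (wnorm_sq \<rho> \<psi> + wnorm_sq \<rho> \<psi>')"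
proof -
  define K where "K = exp (2 * \<bar>\<rho>\<bar> * (R + 1))"
  define p where "p t = (norm (\<psi> t))\<^sup>2" for t
  define p' where "p' t = (norm (\<psi>' t))\<^sup>2" for t
  have c: "continuous_on X \<psi>" for X
    using d by (meson continuous_at_imp_continuous_on has_vector_derivative_continuous)
  have c'X: "continuous_on X \<psi>'" for X using c' by (rule continuous_on_subset) simp
  have pc: "continuous_on X p" "continuous_on X p'" for X
    unfolding p_def p'_def by (intro continuous_intros c c'X)+
  have nn: "0 \<le> p t" "0 \<le> p' t" for t by (simp_all add: p_def p'_def)
  obtain r where r: "r \<in> {s..s + 1}" "\<And>t. t \<in> {s..s + 1} \<Longrightarrow> p r \<le> p t"
    using continuous_attains_inf[of "{s..s + 1}" p] pc by auto
  have "p r = integral {s..s + 1} (\<lambda>_. p r)" by simp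
  also have "\<dots> \<le> integral {s..s + 1} p"
    using r by (intro integral_le integrable_continuous_interval pc continuous_intros) auto
  finally have pr: "p r \<le> integral {s..s + 1} p" .
  have "((\<lambda>t. 2 * inner (\<psi>' t) (\<psi> t)) has_integral (p r - p s)) {s..r}"
    using r norm_sq_deriv[OF d]
    by (intro fundamental_theorem_of_calculus)
      (auto simp: p_def has_real_derivative_iff_has_vector_derivative intro: has_vector_derivative_at_within)
  from integral_unique[OF this]
  have "p s = p r - integral {s..r} (\<lambda>t. 2 * inner (\<psi>' t) (\<psi> t))" by linarith
  also have "\<dots> \<le> p r + norm (integral {s..r} (\<lambda>t. 2 * inner (\<psi>' t) (\<psi> t)))" by simp
  also have "norm (integral {s..r} (\<lambda>t. 2 * inner (\<psi>' t) (\<psi> t))) \<le> integral {s..r} (\<lambda>t. p t + p' t)"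
  proof (intro integral_norm_bound_integral integrable_continuous_interval continuous_intros pc c c'X)
    show "norm (2 * inner (\<psi>' t) (\<psi> t)) \<le> p t + p' t" for t
      using inner_young[of 1 "\<psi>' t" "\<psi> t"]
      by (simp add: p_def p'_def power2_norm_eq_inner abs_mult)
  qed
  also have "\<dots> \<le> integral {s..s + 1} (\<lambda>t. p t + p' t)"
    using r nn by (intro integral_subset_le integrable_continuous_interval continuous_intros pc) auto
  also have "\<dots> = integral {s..s + 1} p + integral {s..s + 1} p'"
    by (intro integral_add integrable_continuous_interval pc)
  finally have "p s \<le> 2 * integral {s..s + 1} p + 2 * integral {s..s + 1} p'"
    using pr integral_nonneg[OF integrable_continuous_interval[OF pc(2)] nn(2), of s "s + 1"] by simp
  then have "ennreal (p s) \<le> ennreal (2 * integral {s..s + 1} p + 2 * integral {s..s + 1} p')"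
    by (rule ennreal_leI)
  also have "\<dots> = 2 * ennreal (integral {s..s + 1} p) + 2 * ennreal (integral {s..s + 1} p')"
    using nn pc by (subst ennreal_plus) (auto simp: ennreal_mult' intro!: integral_nonneg integrable_continuous_interval)
  also have "\<dots> \<le> 2 * (ennreal (1 * K) * wnorm_sq \<rho> \<psi>) + 2 * (ennreal (1 * K) * wnorm_sq \<rho> \<psi>')"
    unfolding K_def
    by (intro add_mono mult_left_mono integral_le_wnorm_sq strongly_measurable_continuous pc nn c c'X AE_I2)
      (use s in \<open>auto simp: p_def p'_def\<close>)
  also have "\<dots> = ennreal (2 * K) * (wnorm_sq \<rho> \<psi> + wnorm_sq \<rho> \<psi>')"
  proof -
    have "ennreal (2 * K) = 2 * ennreal K" by (simp add: ennreal_mult')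
    then show ?thesis by (simp add: distrib_left mult_ac)
  qed
  finally show ?thesis unfolding p_def K_def .
qed

lemma test_functionE:
  assumes "test_function \<phi>"
  obtains \<phi>' where "\<And>s. (\<phi> has_vector_derivative \<phi>' s) (at s)" "continuous_on UNIV \<phi>'"
    "continuous_on UNIV \<phi>" "(\<lambda>s. vector_derivative \<phi> (at s)) = \<phi>'"
proof -
  from assms obtain d where d: "d 0 = \<phi>" "\<And>n s. (d n has_vector_derivative d (Suc n) s) (at s)"
    unfolding test_function_def by blast
  have c: "continuous_on UNIV (d n)" for n
    using d(2) by (meson continuous_at_imp_continuous_on has_vector_derivative_continuous)
  show thesis
  proof (rule that[of "d 1"])
    show "(\<phi> has_vector_derivative d 1 s) (at s)" for s using d(2)[of 0 s] d(1) by simp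
    then show "(\<lambda>s. vector_derivative \<phi> (at s)) = d 1"
      by (auto intro: vector_derivative_at)
  qed (use c[of 0] c[of 1] d(1) in auto)
qed

text \<open>By \<open>pointwise_le_wnorm_sq\<close>, approximants in the graph norm are uniformly
  Cauchy on bounded intervals, and completeness of the space gives a continuous limit
  \<open>h\<close>. No equality of \<open>h\<close> with \<open>f\<close> is claimed, since
  \<open>f\<close> is only determined up to a null set.\<close>

lemma dt_graph_approx:
  fixes f g :: "real \<Rightarrow> 'h::{real_inner, complete_space}"
  assumes "dt_graph \<rho> f g"
  obtains \<phi> \<phi>' h where
    "\<forall>n s. (\<phi> n has_vector_derivative \<phi>' n s) (at s)"
    "\<forall>n. continuous_on UNIV (\<phi> n)" "\<forall>n. continuous_on UNIV (\<phi>' n)"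
    "(\<lambda>n. wnorm_sq \<rho> (\<lambda>s. \<phi> n s - f s)) \<longlonglongrightarrow> 0"
    "(\<lambda>n. wnorm_sq \<rho> (\<lambda>s. \<phi>' n s - g s)) \<longlonglongrightarrow> 0"
    "\<forall>R. uniform_limit {-R..R} \<phi> h sequentially" "continuous_on UNIV h"
    "strongly_measurable f" "strongly_measurable g"
proof -
  from assms obtain \<phi> where meas: "strongly_measurable f" "strongly_measurable g"
    and \<phi>: "\<And>n. test_function (\<phi> n)"
    and lim: "(\<lambda>n. wnorm_sq \<rho> (\<lambda>s. \<phi> n s - f s)) \<longlonglongrightarrow> 0"
      "(\<lambda>n. wnorm_sq \<rho> (\<lambda>s. vector_derivative (\<phi> n) (at s) - g s)) \<longlonglongrightarrow> 0"
    unfolding dt_graph_def L2w_def by blast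
  define \<phi>' where "\<phi>' n s = vector_derivative (\<phi> n) (at s)" for n s
  have d: "(\<phi> n has_vector_derivative \<phi>' n s) (at s)" and c: "continuous_on UNIV (\<phi> n)"
    and c': "continuous_on UNIV (\<phi>' n)" for n s
    using test_functionE[OF \<phi>[of n]] unfolding \<phi>'_def by metis+
  have lim': "(\<lambda>n. wnorm_sq \<rho> (\<lambda>s. \<phi>' n s - g s)) \<longlonglongrightarrow> 0"
    using lim(2) by (simp add: \<phi>'_def)
  have cauchy: "uniformly_Cauchy_on {-R..R} \<phi>" for R
  proof (rule uniformly_Cauchy_onI)
    fix e :: real assume e: "e > 0"
    define K where "K = 2 * exp (2 * \<bar>\<rho>\<bar> * (R + 1))"
    have K: "K > 0" by (simp add: K_def)
    \<comment> \<open>Two triangle inequalities with squared norms give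
      \<open>8 * \<epsilon>\<close>, so the squared distance ends up at most half of
      \<open>e\<^sup>2\<close>.\<close>
    define \<epsilon> where "\<epsilon> = e\<^sup>2 / (16 * K)"
    have \<epsilon>: "\<epsilon> > 0" using e K by (simp add: \<epsilon>_def)
    have "\<forall>\<^sub>F n in sequentially. wnorm_sq \<rho> (\<lambda>s. \<phi> n s - f s) < ennreal \<epsilon> \<and> wnorm_sq \<rho> (\<lambda>s. \<phi>' n s - g s) < ennreal \<epsilon>"
      using \<epsilon> by (intro eventually_conj order_tendstoD[OF lim(1)] order_tendstoD[OF lim']) auto
    then obtain N where N: "\<And>n. N \<le> n \<Longrightarrow> wnorm_sq \<rho> (\<lambda>s. \<phi> n s - f s) \<le> ennreal \<epsilon>"
        "\<And>n. N \<le> n \<Longrightarrow> wnorm_sq \<rho> (\<lambda>s. \<phi>' n s - g s) \<le> ennreal \<epsilon>"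
      unfolding eventually_sequentially by (meson less_imp_le)
    have "dist (\<phi> m s) (\<phi> n s) < e" if s: "s \<in> {-R..R}" and mn: "N \<le> m" "N \<le> n" for m n s
    proof -
      have "ennreal ((norm (\<phi> m s - \<phi> n s))\<^sup>2) \<le>
          ennreal K * (wnorm_sq \<rho> (\<lambda>s. \<phi> m s - \<phi> n s) + wnorm_sq \<rho> (\<lambda>s. \<phi>' m s - \<phi>' n s))"
        unfolding K_def using s
        by (intro pointwise_le_wnorm_sq continuous_intros c' has_vector_derivative_diff d) auto
      also have "wnorm_sq \<rho> (\<lambda>s. \<phi> m s - \<phi> n s) \<le>
          2 * wnorm_sq \<rho> (\<lambda>s. \<phi> m s - f s) + 2 * wnorm_sq \<rho> (\<lambda>s. \<phi> n s - f s)"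
        by (rule wnorm_sq_triangle[OF strongly_measurable_continuous[OF c] meas(1) strongly_measurable_continuous[OF c]])
      also have "\<dots> \<le> 2 * ennreal \<epsilon> + 2 * ennreal \<epsilon>"
        by (intro add_mono mult_left_mono N(1) mn) auto
      also have "wnorm_sq \<rho> (\<lambda>s. \<phi>' m s - \<phi>' n s) \<le>
          2 * wnorm_sq \<rho> (\<lambda>s. \<phi>' m s - g s) + 2 * wnorm_sq \<rho> (\<lambda>s. \<phi>' n s - g s)"
        by (rule wnorm_sq_triangle[OF strongly_measurable_continuous[OF c'] meas(2) strongly_measurable_continuous[OF c']])
      also have "\<dots> \<le> 2 * ennreal \<epsilon> + 2 * ennreal \<epsilon>"
        by (intro add_mono mult_left_mono N(2) mn) auto
      also have "ennreal K * (2 * ennreal \<epsilon> + 2 * ennreal \<epsilon> + (2 * ennreal \<epsilon> + 2 * ennreal \<epsilon>)) = ennreal (K * (8 * \<epsilon>))"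
      proof -
        have "2 * ennreal \<epsilon> + 2 * ennreal \<epsilon> = ennreal (2 * \<epsilon> + 2 * \<epsilon>)"
          using \<epsilon> by (subst ennreal_plus) (auto simp: ennreal_mult')
        then have "2 * ennreal \<epsilon> + 2 * ennreal \<epsilon> + (2 * ennreal \<epsilon> + 2 * ennreal \<epsilon>) = ennreal (8 * \<epsilon>)"
          using \<epsilon> by (simp flip: ennreal_plus)
        then show ?thesis using K by (simp add: ennreal_mult')
      qed
      finally have "ennreal ((norm (\<phi> m s - \<phi> n s))\<^sup>2) \<le> ennreal (K * (8 * \<epsilon>))"
        by (simp add: add_mono mult_left_mono)
      then have "(norm (\<phi> m s - \<phi> n s))\<^sup>2 \<le> K * (8 * \<epsilon>)"
        using K \<epsilon> by (simp add: ennreal_le_iff)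
      also have "\<dots> < e\<^sup>2" using K e by (simp add: \<epsilon>_def)
      finally show ?thesis using e by (simp add: dist_norm power_less_imp_less_base)
    qed
    then show "\<exists>M. \<forall>x\<in>{-R..R}. \<forall>m\<ge>M. \<forall>n\<ge>M. dist (\<phi> m x) (\<phi> n x) < e" by blast
  qed
  define h where "h s = lim (\<lambda>n. \<phi> n s)" for s
  have ul: "uniform_limit {-R..R} \<phi> h sequentially" for R
    using Cauchy_uniformly_convergent[OF cauchy[of R]]
    unfolding uniformly_convergent_uniform_limit_iff h_def .
  have "continuous_on UNIV h"
  proof (rule continuous_at_imp_continuous_on, rule ballI)
    fix s :: real
    have "continuous_on {-(\<bar>s\<bar> + 1)..\<bar>s\<bar> + 1} h"
      by (rule uniform_limit_theorem[OF _ ul])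
        (auto intro!: always_eventually intro: continuous_on_subset[OF c])
    moreover have "s \<in> interior {-(\<bar>s\<bar> + 1)..\<bar>s\<bar> + 1}" by (simp add: interior_atLeastAtMost_real) linarith
    ultimately show "isCont h s" by (rule continuous_on_interior)
  qed
  with d c c' lim(1) lim' ul meas show thesis by (intro that[of \<phi> \<phi>' h]) auto
qed

lemma zero_of_integral_eq_0:
  fixes h :: "real \<Rightarrow> real"
  assumes "continuous_on UNIV h" "\<And>s. 0 \<le> h s" "integral {c..d} h = 0" "c < d" "s \<in> {c..d}"
  shows "h s = 0"
  using integral_eq_0_iff[of c d h] assms continuous_on_subset[OF assms(1), of "{c..d}"] by auto

lemma integral_norm_sq_tendsto_wnorm:
  fixes F :: "nat \<Rightarrow> real \<Rightarrow> 'a::real_normed_vector"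
  assumes c: "\<And>n. continuous_on UNIV (F n)" and w: "(\<lambda>n. wnorm_sq \<rho> (F n)) \<longlonglongrightarrow> 0"
  shows "(\<lambda>n. integral {a..b} (\<lambda>t. (norm (F n t))\<^sup>2)) \<longlonglongrightarrow> 0"
proof (rule tendsto_zero_ennreal_bound[OF _ _ w])
  define R where "R = \<bar>a\<bar> + \<bar>b\<bar>"
  have cX: "continuous_on X (F n)" for X n using c continuous_on_subset by blast
  show "0 \<le> integral {a..b} (\<lambda>t. (norm (F n t))\<^sup>2)" for n
    by (intro integral_nonneg integrable_continuous_interval continuous_intros cX) auto
  show "ennreal (integral {a..b} (\<lambda>t. (norm (F n t))\<^sup>2)) \<le>
      ennreal (1 * exp (2 * \<bar>\<rho>\<bar> * R)) * wnorm_sq \<rho> (F n)" for n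
    by (intro integral_le_wnorm_sq strongly_measurable_continuous continuous_intros cX)
      (auto simp: R_def)
qed

lemma integral_norm_sq_tendsto_uniform:
  fixes \<phi> :: "nat \<Rightarrow> real \<Rightarrow> 'a::real_normed_vector"
  assumes c: "\<And>n. continuous_on UNIV (\<phi> n)" "continuous_on UNIV h" and ab: "a < b"
    and ul: "\<And>R. uniform_limit {-R..R} \<phi> h sequentially"
  shows "(\<lambda>n. integral {a..b} (\<lambda>t. (norm (h t - \<phi> n t))\<^sup>2)) \<longlonglongrightarrow> 0"
proof (rule LIMSEQ_I)
  define R where "R = \<bar>a\<bar> + \<bar>b\<bar>"
  have cX: "continuous_on X (\<phi> n)" "continuous_on X h" for X n
    using c continuous_on_subset by blast+
  fix e :: real assume e: "e > 0"
  \<comment> \<open>The cap at 1 allows the square of a difference below \<open>d\<close> to be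
    bounded by \<open>d\<close> itself.\<close>
  define d where "d = min 1 (e / (2 * (b - a)))"
  have d: "d > 0" "d * (b - a) < e"
  proof -
    show "d > 0" using e ab by (simp add: d_def)
    have "d * (b - a) \<le> e / (2 * (b - a)) * (b - a)" using ab by (intro mult_right_mono) (auto simp: d_def)
    also have "\<dots> = e / 2" using ab by (simp add: divide_simps)
    finally show "d * (b - a) < e" using e by simp
  qed
  have "\<forall>\<^sub>F n in sequentially. \<forall>t\<in>{-R..R}. dist (\<phi> n t) (h t) < d"
    using ul[of R] d(1) unfolding uniform_limit_iff by blast
  then obtain N where N: "\<And>n t. N \<le> n \<Longrightarrow> t \<in> {-R..R} \<Longrightarrow> dist (\<phi> n t) (h t) < d"
    unfolding eventually_sequentially by blast
  have "norm (integral {a..b} (\<lambda>t. (norm (h t - \<phi> n t))\<^sup>2)) < e" if "N \<le> n" for n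
  proof -
    have "norm (integral {a..b} (\<lambda>t. (norm (h t - \<phi> n t))\<^sup>2)) \<le> integral {a..b} (\<lambda>t. d)"
    proof (intro integral_norm_bound_integral integrable_continuous_interval continuous_intros cX)
      fix t assume "t \<in> {a..b}"
      then have "t \<in> {-R..R}" unfolding R_def atLeastAtMost_iff by linarith
      then have "norm (h t - \<phi> n t) < d"
        using N[OF that, of t] by (simp add: dist_norm norm_minus_commute)
      then have "(norm (h t - \<phi> n t))\<^sup>2 \<le> 1 * d"
        unfolding power2_eq_square by (intro mult_mono) (auto simp: d_def)
      then show "norm ((norm (h t - \<phi> n t))\<^sup>2) \<le> d" by simp
    qed
    also have "\<dots> < e" using d(2) ab by (simp add: mult.commute)
    finally show ?thesis .
  qed
  then show "\<exists>no. \<forall>n\<ge>no. norm (integral {a..b} (\<lambda>t. (norm (h t - \<phi> n t))\<^sup>2) - 0) < e" by auto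
qed

lemma norm_diff_sq_le:
  fixes x y z :: "'a::real_normed_vector"
  shows "(norm (x - z))\<^sup>2 \<le> 2 * (norm (y - z))\<^sup>2 + 2 * (norm (x - y))\<^sup>2"
proof -
  have "norm (x - z) \<le> norm (y - z) + norm (x - y)"
    using norm_triangle_ineq[of "y - z" "x - y"] by simp
  then have "(norm (x - z))\<^sup>2 \<le> (norm (y - z) + norm (x - y))\<^sup>2"
    by (intro power_mono) auto
  also have "\<dots> \<le> 2 * (norm (y - z))\<^sup>2 + 2 * (norm (x - y))\<^sup>2"
    using sum_squares_bound[of "norm (y - z)" "norm (x - y)"] by (simp add: power2_sum)
  finally show ?thesis .
qed

lemma integral_norm_diff_sq_le:
  fixes f g h :: "real \<Rightarrow> 'a::real_normed_vector"
  assumes "continuous_on {a..b} f" "continuous_on {a..b} g" "continuous_on {a..b} h"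
  shows "integral {a..b} (\<lambda>t. (norm (h t - f t))\<^sup>2) \<le>
      2 * integral {a..b} (\<lambda>t. (norm (g t - f t))\<^sup>2) + 2 * integral {a..b} (\<lambda>t. (norm (h t - g t))\<^sup>2)"
proof -
  have "integral {a..b} (\<lambda>t. (norm (h t - f t))\<^sup>2) \<le>
      integral {a..b} (\<lambda>t. 2 * (norm (g t - f t))\<^sup>2 + 2 * (norm (h t - g t))\<^sup>2)"
    by (intro integral_le integrable_continuous_interval continuous_intros assms norm_diff_sq_le)
  also have "\<dots> = 2 * integral {a..b} (\<lambda>t. (norm (g t - f t))\<^sup>2) + 2 * integral {a..b} (\<lambda>t. (norm (h t - g t))\<^sup>2)"
    by (subst integral_add) (auto intro!: integrable_continuous_interval continuous_intros assms)
  finally show ?thesis .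
qed

text \<open>The weighted limit and the locally uniform limit agree in mean square on every interval
  \<open>[s, s + 1]\<close>; two continuous functions at mean-square distance zero coincide
  everywhere. So the \<open>h\<close> of \<open>dt_graph_approx\<close> is \<open>f\<close> once
  \<open>f\<close> is the continuous representative.\<close>

lemma dt_graph_limit_eq:
  fixes f h :: "real \<Rightarrow> 'h::real_inner"
  assumes c: "\<And>n. continuous_on UNIV (\<phi> n)" "continuous_on UNIV h" "continuous_on UNIV f"
    and w: "(\<lambda>n. wnorm_sq \<rho> (\<lambda>s. \<phi> n s - f s)) \<longlonglongrightarrow> 0"
    and ul: "\<And>R. uniform_limit {-R..R} \<phi> h sequentially"
  shows "h = f"
proof
  fix s :: real
  have cX: "continuous_on X (\<phi> n)" "continuous_on X h" "continuous_on X f" for X n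
    using c continuous_on_subset by blast+
  define I where "I = {s..s + 1}"
  have "(\<lambda>n. integral I (\<lambda>t. (norm (\<phi> n t - f t))\<^sup>2)) \<longlonglongrightarrow> 0"
    unfolding I_def by (intro integral_norm_sq_tendsto_wnorm[OF _ w] continuous_intros c)
  moreover have "(\<lambda>n. integral I (\<lambda>t. (norm (h t - \<phi> n t))\<^sup>2)) \<longlonglongrightarrow> 0"
    unfolding I_def by (intro integral_norm_sq_tendsto_uniform c ul) simp
  ultimately have "(\<lambda>n. 2 * integral I (\<lambda>t. (norm (\<phi> n t - f t))\<^sup>2) + 2 * integral I (\<lambda>t. (norm (h t - \<phi> n t))\<^sup>2))
      \<longlonglongrightarrow> 2 * 0 + 2 * 0" by (intro tendsto_intros)
  moreover have "integral I (\<lambda>t. (norm (h t - f t))\<^sup>2) \<le>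
      2 * integral I (\<lambda>t. (norm (\<phi> n t - f t))\<^sup>2) + 2 * integral I (\<lambda>t. (norm (h t - \<phi> n t))\<^sup>2)" for n
    unfolding I_def by (intro integral_norm_diff_sq_le cX)
  ultimately have "integral I (\<lambda>t. (norm (h t - f t))\<^sup>2) \<le> 2 * 0 + 2 * 0"
    by (intro LIMSEQ_le_const[of _ "2 * 0 + 2 * 0"]) auto
  moreover have "0 \<le> integral I (\<lambda>t. (norm (h t - f t))\<^sup>2)"
    unfolding I_def by (intro integral_nonneg integrable_continuous_interval continuous_intros cX) auto
  ultimately have "integral I (\<lambda>t. (norm (h t - f t))\<^sup>2) = 0" by simp
  then have "(norm (h s - f s))\<^sup>2 = 0"
    unfolding I_def by (rule zero_of_integral_eq_0[rotated 2]) (auto intro!: continuous_intros cX)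
  then show "h s = f s" by simp
qed

text \<open>Bochner integrals are avoided (\<open>'h\<close> is neither separable nor of class \<open>banach\<close>):
  derivatives are identified through the functionals \<open>inner x\<close>.\<close>

lemma weak_primitive:
  fixes f :: "real \<Rightarrow> 'h::real_inner" and p :: "real \<Rightarrow> real"
  assumes d: "\<And>n s. (\<phi> n has_vector_derivative \<phi>' n s) (at s)"
    and c: "\<And>n. continuous_on UNIV (\<phi>' n)" "continuous_on UNIV p"
    and f: "\<And>s. (\<lambda>n. \<phi> n s) \<longlonglongrightarrow> f s"
    and lim: "\<And>r s. r < s \<Longrightarrow> (\<lambda>n. integral {r..s} (\<lambda>t. (inner x (\<phi>' n t) - p t)\<^sup>2)) \<longlonglongrightarrow> 0"
  shows "((\<lambda>s. inner x (f s)) has_real_derivative p s) (at s)"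
proof -
  have cX: "continuous_on X (\<phi>' n)" "continuous_on X p" for X n
    using c continuous_on_subset by blast+
  have eq: "inner x (f s) - inner x (f r) = integral {r..s} p" if rs: "r < s" for r s
  proof -
    define a where "a n = integral {r..s} (\<lambda>t. inner x (\<phi>' n t) - p t)" for n
    have a: "a n = inner x (\<phi> n s) - inner x (\<phi> n r) - integral {r..s} p" for n
    proof -
      have "((\<lambda>t. inner x (\<phi>' n t)) has_integral inner x (\<phi> n s) - inner x (\<phi> n r)) {r..s}"
      proof (rule fundamental_theorem_of_calculus)
        show "((\<lambda>t. inner x (\<phi> n t)) has_vector_derivative inner x (\<phi>' n t)) (at t within {r..s})" for t
          by (rule has_vector_derivative_at_within[OF
                bounded_linear.has_vector_derivative[OF bounded_linear_inner_right d]])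
      qed (use rs in simp)
      then show ?thesis unfolding a_def
        by (subst integral_diff) (auto intro!: integrable_continuous_interval cX simp: integral_unique
            has_integral_integrable)
    qed
    have "(a n)\<^sup>2 \<le> (s - r) * integral {r..s} (\<lambda>t. (inner x (\<phi>' n t) - p t)\<^sup>2)" for n
    proof -
      define k where "k t = inner x (\<phi>' n t) - p t" for t
      have kc: "continuous_on X k" for X unfolding k_def by (intro continuous_intros cX)
      \<comment> \<open>The mean of \<open>k\<close>: expanding the nonnegative integral of
        \<open>(k t - m)\<^sup>2\<close> is the Cauchy--Schwarz inequality for the integral of
        \<open>k\<close>.\<close>
      define m where "m = a n / (s - r)"
      have m: "m * (s - r) = a n" using rs by (simp add: m_def)
      have "0 \<le> integral {r..s} (\<lambda>t. (k t - m)\<^sup>2)"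
        by (intro integral_nonneg integrable_continuous_interval continuous_intros kc) auto
      also have "(\<lambda>t. (k t - m)\<^sup>2) = (\<lambda>t. (k t)\<^sup>2 - 2 * m * k t + m\<^sup>2)"
        by (simp add: power2_diff algebra_simps)
      also have "integral {r..s} \<dots> = integral {r..s} (\<lambda>t. (k t)\<^sup>2) - 2 * m * a n + (s - r) * m\<^sup>2"
        using rs by (subst integral_add integral_diff; (intro integrable_continuous_interval continuous_intros kc)?)+
          (simp add: a_def k_def)
      also have "2 * m * a n = 2 * ((s - r) * m\<^sup>2)" unfolding m[symmetric] by (simp add: power2_eq_square)
      finally have "(s - r) * ((s - r) * m\<^sup>2) \<le> (s - r) * integral {r..s} (\<lambda>t. (k t)\<^sup>2)"
        using rs by (intro mult_left_mono) auto
      then show ?thesis unfolding k_def m[symmetric] by (simp add: power2_eq_square mult_ac)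
    qed
    moreover have "(\<lambda>n. (s - r) * integral {r..s} (\<lambda>t. (inner x (\<phi>' n t) - p t)\<^sup>2)) \<longlonglongrightarrow> (s - r) * 0"
      by (intro tendsto_intros lim rs)
    ultimately have "(\<lambda>n. (a n)\<^sup>2) \<longlonglongrightarrow> 0"
      by (intro tendsto_sandwich[of "\<lambda>_. 0" "\<lambda>n. (a n)\<^sup>2" sequentially]) auto
    then have a0: "a \<longlonglongrightarrow> 0"
      using tendsto_real_sqrt[of "\<lambda>n. (a n)\<^sup>2" 0 sequentially] by (simp add: tendsto_rabs_zero_iff)
    have "a \<longlonglongrightarrow> inner x (f s) - inner x (f r) - integral {r..s} p"
      unfolding a[abs_def] by (intro tendsto_diff tendsto_inner tendsto_const f)
    from LIMSEQ_unique[OF a0 this] show ?thesis by simp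
  qed
  define b where "b = s - 1"
  have "((\<lambda>u. integral {b..u} p) has_vector_derivative p s) (at s within {b..s + 1})"
    by (rule integral_has_vector_derivative) (auto simp: b_def cX)
  then have "((\<lambda>u. integral {b..u} p) has_vector_derivative p s) (at s)"
    using at_within_Icc_at[of b s "s + 1"] by (simp add: b_def)
  then have "((\<lambda>u. integral {b..u} p + inner x (f b)) has_real_derivative p s) (at s)"
    unfolding has_real_derivative_iff_has_vector_derivative[symmetric]
    using DERIV_add[OF _ DERIV_const] by fastforce
  then show ?thesis
  proof (rule has_field_derivative_transform_within[of _ _ _ _ 1])
    fix u assume "dist u s < 1"
    then have "b < u" by (auto simp: dist_real_def b_def)
    from eq[OF this] show "integral {b..u} p + inner x (f b) = inner x (f u)" by simp
  qed auto
qed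

text \<open>The functional is chosen to be the remainder \<open>f r - f s - (r - s) v s\<close>
  itself. The mean value inequality then bounds its squared norm by its norm times
  \<open>e * norm (r - s)\<close>, with \<open>e\<close> from the continuity of
  \<open>v\<close>.\<close>

lemma strong_derivative_of_weak:
  fixes f v :: "real \<Rightarrow> 'h::real_inner"
  assumes weak: "\<And>x s. ((\<lambda>s. inner x (f s)) has_real_derivative inner x (v s)) (at s)"
    and v: "continuous_on UNIV v"
  shows "(f has_vector_derivative v s) (at s)"
proof -
  have "\<exists>d>0. \<forall>r. norm (r - s) < d \<longrightarrow> norm (f r - f s - (r - s) *\<^sub>R v s) \<le> e * norm (r - s)"
    if e: "e > 0" for e
  proof -
    have "isCont v s" using v by (simp add: continuous_on_eq_continuous_at)
    then obtain d where d: "d > 0" "\<And>r. dist r s < d \<Longrightarrow> dist (v r) (v s) < e"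
      using e unfolding continuous_at_eps_delta by blast
    have "norm (f r - f s - (r - s) *\<^sub>R v s) \<le> e * norm (r - s)" if r: "norm (r - s) < d" for r
    proof -
      define x where "x = f r - f s - (r - s) *\<^sub>R v s"
      define k where "k u = inner x (f u) - (u - s) * inner x (v s)" for u
      have k: "(k has_real_derivative inner x (v u - v s)) (at u)" for u
        unfolding k_def by (auto intro!: derivative_eq_intros weak simp: inner_diff_right)
      have "norm (k r - k s) \<le> (norm x * e) * norm (r - s)"
      proof (rule field_differentiable_bound[of "ball s d"])
        fix u assume "u \<in> ball s d"
        then have u: "norm (v u - v s) \<le> e" using d(2)[of u] by (simp add: dist_commute dist_norm norm_minus_commute less_imp_le)
        have "norm (inner x (v u - v s)) \<le> norm x * norm (v u - v s)"
          using Cauchy_Schwarz_ineq2 by simp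
        also have "\<dots> \<le> norm x * e" using u by (intro mult_left_mono) auto
        finally show "norm (inner x (v u - v s)) \<le> norm x * e" .
        show "(k has_field_derivative inner x (v u - v s)) (at u within ball s d)"
          by (rule has_field_derivative_at_within[OF k])
      qed (use r d in \<open>auto simp: dist_norm norm_minus_commute\<close>)
      also have "k r - k s = inner x x"
        by (simp add: k_def x_def inner_diff_right algebra_simps)
      finally have "norm x * norm x \<le> norm x * (e * norm (r - s))"
        by (simp add: power2_norm_eq_inner[symmetric] power2_eq_square mult_ac)
      then show ?thesis unfolding x_def[symmetric]
        using e by (cases "x = 0") auto
    qed
    then show ?thesis using d(1) by blast
  qed
  then show ?thesis
    unfolding has_vector_derivative_def has_derivative_at_alt by (auto intro: bounded_linear_scaleR_left)
qed

lemma uniform_limit_pointwise: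
  assumes "\<And>R::real. uniform_limit {-R..R} \<phi> h sequentially"
  shows "(\<lambda>n. \<phi> n s) \<longlonglongrightarrow> h s"
  by (rule tendsto_uniform_limitI[OF assms[of "\<bar>s\<bar>"]]) auto

lemma inner_sq_le: "(inner x y)\<^sup>2 \<le> (norm x)\<^sup>2 * (norm y)\<^sup>2"
  using power_mono[OF Cauchy_Schwarz_ineq2[of x y], of 2] by (simp add: power_mult_distrib)

text \<open>The weak derivative \<open>g\<close> again lies in the domain of the time derivative, so
  its approximants \<open>\<psi> n\<close> converge locally uniformly to a continuous
  \<open>V\<close>. The derivatives \<open>\<phi>' n\<close> of the approximants of \<open>U\<close>
  have the same weighted limit \<open>g\<close>, hence tend to \<open>V\<close> locally in mean
  square. Thus \<open>V\<close> is the derivative of \<open>U\<close>, weakly and then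
  strongly.\<close>

lemma Hkw_2_C1:
  fixes U :: "real \<Rightarrow> 'h::{real_inner, complete_space}"
  assumes U: "U \<in> Hkw 2 \<rho>" "continuous_on UNIV U"
  obtains V where "continuous_on UNIV V" "\<And>s. (U has_vector_derivative V s) (at s)"
proof -
  from U(1) obtain g g2 where g: "dt_graph \<rho> U g" and g2: "dt_graph \<rho> g g2"
    by (auto simp: numeral_2_eq_2)
  obtain \<phi> \<phi>' h where \<phi>': "\<forall>n s. (\<phi> n has_vector_derivative \<phi>' n s) (at s)"
    "\<forall>n. continuous_on UNIV (\<phi> n)" "\<forall>n. continuous_on UNIV (\<phi>' n)"
    "(\<lambda>n. wnorm_sq \<rho> (\<lambda>s. \<phi> n s - U s)) \<longlonglongrightarrow> 0"
    "(\<lambda>n. wnorm_sq \<rho> (\<lambda>s. \<phi>' n s - g s)) \<longlonglongrightarrow> 0"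
    "\<forall>R. uniform_limit {-R..R} \<phi> h sequentially" "continuous_on UNIV h"
    "strongly_measurable U" and gm: "strongly_measurable g"
    by (rule dt_graph_approx[OF g]) (rule that; assumption)
  note \<phi> = \<phi>'[rule_format]
  have hU: "h = U" by (rule dt_graph_limit_eq[OF \<phi>(2,7) U(2) \<phi>(4,6)])
  obtain \<psi> \<psi>' V where "\<forall>n s. (\<psi> n has_vector_derivative \<psi>' n s) (at s)"
    and \<psi>1: "\<forall>n. continuous_on UNIV (\<psi> n)" and "\<forall>n. continuous_on UNIV (\<psi>' n)"
    and \<psi>2: "(\<lambda>n. wnorm_sq \<rho> (\<lambda>s. \<psi> n s - g s)) \<longlonglongrightarrow> 0"
    and "(\<lambda>n. wnorm_sq \<rho> (\<lambda>s. \<psi>' n s - g2 s)) \<longlonglongrightarrow> 0"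
    and \<psi>3: "\<forall>R. uniform_limit {-R..R} \<psi> V sequentially" and V: "continuous_on UNIV V"
    and "strongly_measurable g" "strongly_measurable g2"
    by (rule dt_graph_approx[OF g2]) (rule that; assumption)
  note \<psi> = \<psi>1[rule_format] \<psi>2 \<psi>3[rule_format]
  have cX: "continuous_on X (\<phi>' n)" "continuous_on X (\<psi> n)" "continuous_on X V" for X n
    using \<phi>(3) \<psi>(1) V continuous_on_subset by blast+
  have w: "(\<lambda>n. wnorm_sq \<rho> (\<lambda>s. \<psi> n s - \<phi>' n s)) \<longlonglongrightarrow> 0"
  proof (rule tendsto_sandwich[OF _ _ tendsto_const])
    have "(\<lambda>n. ennreal 2 * wnorm_sq \<rho> (\<lambda>s. \<psi> n s - g s) + ennreal 2 * wnorm_sq \<rho> (\<lambda>s. \<phi>' n s - g s))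
        \<longlonglongrightarrow> ennreal 2 * 0 + ennreal 2 * 0"
      by (intro tendsto_add ennreal_tendsto_cmult \<psi> \<phi>) auto
    then show "(\<lambda>n. 2 * wnorm_sq \<rho> (\<lambda>s. \<psi> n s - g s) + 2 * wnorm_sq \<rho> (\<lambda>s. \<phi>' n s - g s)) \<longlonglongrightarrow> 0"
      by simp
    show "\<forall>\<^sub>F n in sequentially. wnorm_sq \<rho> (\<lambda>s. \<psi> n s - \<phi>' n s) \<le>
        2 * wnorm_sq \<rho> (\<lambda>s. \<psi> n s - g s) + 2 * wnorm_sq \<rho> (\<lambda>s. \<phi>' n s - g s)"
      by (intro always_eventually allI wnorm_sq_triangle[OF strongly_measurable_continuous[OF \<psi>(1)] gm
            strongly_measurable_continuous[OF \<phi>(3)]])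
  qed simp
  have weak: "((\<lambda>s. inner x (U s)) has_real_derivative inner x (V s)) (at s)" for x s
  proof (rule weak_primitive[OF \<phi>(1,3)])
    show "continuous_on UNIV (\<lambda>s. inner x (V s))" by (intro continuous_intros V)
    show "(\<lambda>n. \<phi> n s) \<longlonglongrightarrow> U s" for s
      using uniform_limit_pointwise[OF \<phi>(6)] unfolding hU .
    fix r s :: real assume rs: "r < s"
    have "(\<lambda>n. (norm x)\<^sup>2 * (2 * integral {r..s} (\<lambda>t. (norm (\<psi> n t - \<phi>' n t))\<^sup>2)
        + 2 * integral {r..s} (\<lambda>t. (norm (V t - \<psi> n t))\<^sup>2))) \<longlonglongrightarrow> (norm x)\<^sup>2 * (2 * 0 + 2 * 0)"
      by (intro tendsto_intros integral_norm_sq_tendsto_wnorm[OF _ w]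
          integral_norm_sq_tendsto_uniform continuous_intros \<psi> \<phi> V rs)
    then have lim: "(\<lambda>n. (norm x)\<^sup>2 * (2 * integral {r..s} (\<lambda>t. (norm (\<psi> n t - \<phi>' n t))\<^sup>2)
        + 2 * integral {r..s} (\<lambda>t. (norm (V t - \<psi> n t))\<^sup>2))) \<longlonglongrightarrow> 0" by simp
    show "(\<lambda>n. integral {r..s} (\<lambda>t. (inner x (\<phi>' n t) - inner x (V t))\<^sup>2)) \<longlonglongrightarrow> 0"
    proof (rule tendsto_sandwich[OF _ _ tendsto_const lim]; intro always_eventually allI)
      fix n
      show "0 \<le> integral {r..s} (\<lambda>t. (inner x (\<phi>' n t) - inner x (V t))\<^sup>2)"
        by (intro integral_nonneg integrable_continuous_interval continuous_intros cX) auto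
      have "integral {r..s} (\<lambda>t. (inner x (\<phi>' n t) - inner x (V t))\<^sup>2) \<le>
          integral {r..s} (\<lambda>t. (norm x)\<^sup>2 * (norm (V t - \<phi>' n t))\<^sup>2)"
      proof (intro integral_le integrable_continuous_interval continuous_intros cX)
        show "(inner x (\<phi>' n t) - inner x (V t))\<^sup>2 \<le> (norm x)\<^sup>2 * (norm (V t - \<phi>' n t))\<^sup>2" for t
          using inner_sq_le[of x "\<phi>' n t - V t"] by (simp add: inner_diff_right norm_minus_commute)
      qed
      also have "\<dots> = (norm x)\<^sup>2 * integral {r..s} (\<lambda>t. (norm (V t - \<phi>' n t))\<^sup>2)" by simp
      also have "\<dots> \<le> (norm x)\<^sup>2 * (2 * integral {r..s} (\<lambda>t. (norm (\<psi> n t - \<phi>' n t))\<^sup>2)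
        + 2 * integral {r..s} (\<lambda>t. (norm (V t - \<psi> n t))\<^sup>2))"
        by (intro mult_left_mono integral_norm_diff_sq_le cX) auto
      finally show "integral {r..s} (\<lambda>t. (inner x (\<phi>' n t) - inner x (V t))\<^sup>2) \<le> \<dots>" .
    qed
  qed
  show thesis using that[OF V] strong_derivative_of_weak[OF weak V] by blast
qed

section \<open>The evolution equation at every time\<close>

lemma skew_selfadjoint_inner:
  assumes "skew_selfadjoint_op D A" "x \<in> D" "y \<in> D"
  shows "inner (A x) y = - inner x (A y)"
proof -
  have "(y, - A y) \<in> adjoint_graph D A"
    using assms unfolding skew_selfadjoint_op_def op_graph_def by auto
  then show ?thesis using assms(2) unfolding adjoint_graph_def by auto
qed

text \<open>Both \<open>U s \<in> D\<close> and the equation are given only almost everywhere.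
  Pairing with a fixed \<open>x\<close> in \<open>D\<close> moves \<open>A\<close> onto
  \<open>x\<close>, which leaves only continuous functions of time, so the paired equation holds for
  every \<open>s\<close>. It says that \<open>U s\<close> belongs to the domain of the adjoint, and
  the adjoint of \<open>A\<close> is \<open>- A\<close>.\<close>

lemma evolution_pointwise:
  fixes M0 M1 A :: "'h::{real_inner, complete_space} \<Rightarrow> 'h"
  assumes M0: "bounded_linear M0" and M1: "bounded_linear M1" and A: "skew_selfadjoint_op D A"
    and F: "continuous_on UNIV F" and U: "continuous_on UNIV U"
    and V: "\<And>s. (U has_vector_derivative V s) (at s)"
    and sol: "solves_evo \<rho> M0 M1 D A F U"
  shows "U s \<in> D" "M0 (V s) + M1 (U s) + A (U s) = F s"
proof -
  from sol obtain g where UD: "AE s in lebesgue. U s \<in> D"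
    and g: "dt_graph \<rho> (\<lambda>s. M0 (U s)) g"
    and eq: "AE s in lebesgue. g s + M1 (U s) + A (U s) = F s"
    unfolding solves_evo_def by blast
  obtain \<phi> \<phi>' h where \<phi>': "\<forall>n s. (\<phi> n has_vector_derivative \<phi>' n s) (at s)"
    "\<forall>n. continuous_on UNIV (\<phi> n)" "\<forall>n. continuous_on UNIV (\<phi>' n)"
    "(\<lambda>n. wnorm_sq \<rho> (\<lambda>s. \<phi> n s - M0 (U s))) \<longlonglongrightarrow> 0"
    "(\<lambda>n. wnorm_sq \<rho> (\<lambda>s. \<phi>' n s - g s)) \<longlonglongrightarrow> 0"
    "\<forall>R. uniform_limit {-R..R} \<phi> h sequentially" "continuous_on UNIV h"
    "strongly_measurable (\<lambda>s. M0 (U s))" and gm: "strongly_measurable g"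
    by (rule dt_graph_approx[OF g]) (rule that; assumption)
  note \<phi> = \<phi>'[rule_format]
  have M0U: "continuous_on UNIV (\<lambda>s. M0 (U s))" and M1U: "continuous_on UNIV (\<lambda>s. M1 (U s))"
    by (intro bounded_linear.continuous_on[OF M0] bounded_linear.continuous_on[OF M1] U)+
  have h: "h = (\<lambda>s. M0 (U s))" by (rule dt_graph_limit_eq[OF \<phi>(2,7) M0U \<phi>(4,6)])
  have key: "inner (A x) (U s) = inner x (M0 (V s) + M1 (U s) - F s)" if x: "x \<in> D" for x s
  proof -
    \<comment> \<open>The almost everywhere value of \<open>inner x (g s)\<close>, written without
      \<open>A (U s)\<close> and therefore continuous.\<close>
    define p where "p s = inner x (F s) - inner x (M1 (U s)) + inner (A x) (U s)" for s
    have p: "continuous_on UNIV p" unfolding p_def by (intro continuous_intros F M1U U)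
    have cX: "continuous_on X (\<phi>' n)" "continuous_on X p" for X n
      using \<phi>(3) p continuous_on_subset by blast+
    from UD eq have pg: "AE s in lebesgue. inner x (g s) = p s"
    proof eventually_elim
      case (elim s)
      have "g s = F s - M1 (U s) - A (U s)" using elim(2) by (simp add: algebra_simps)
      then show ?case using skew_selfadjoint_inner[OF A x elim(1)] by (simp add: p_def inner_diff_right)
    qed
    have "((\<lambda>s. inner x (M0 (U s))) has_real_derivative p s) (at s)"
    proof (rule weak_primitive[OF \<phi>(1,3) p])
      show "(\<lambda>n. \<phi> n s) \<longlonglongrightarrow> M0 (U s)" for s
        using uniform_limit_pointwise[OF \<phi>(6)] unfolding h .
      fix r s :: real assume rs: "r < s"
      define R where "R = \<bar>r\<bar> + \<bar>s\<bar>"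
      show "(\<lambda>n. integral {r..s} (\<lambda>t. (inner x (\<phi>' n t) - p t)\<^sup>2)) \<longlonglongrightarrow> 0"
      proof (rule tendsto_zero_ennreal_bound[OF _ _ \<phi>(5)])
        show "0 \<le> integral {r..s} (\<lambda>t. (inner x (\<phi>' n t) - p t)\<^sup>2)" for n
          by (intro integral_nonneg integrable_continuous_interval continuous_intros cX) auto
        show "ennreal (integral {r..s} (\<lambda>t. (inner x (\<phi>' n t) - p t)\<^sup>2)) \<le>
          ennreal ((norm x)\<^sup>2 * exp (2 * \<bar>\<rho>\<bar> * R)) * wnorm_sq \<rho> (\<lambda>s. \<phi>' n s - g s)" for n
        proof (intro integral_le_wnorm_sq continuous_intros cX
            strongly_measurable_diff[OF strongly_measurable_continuous[OF \<phi>(3)] gm])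
          from pg show "AE t in lebesgue. t \<in> {r..s} \<longrightarrow>
              (inner x (\<phi>' n t) - p t)\<^sup>2 \<le> (norm x)\<^sup>2 * (norm (\<phi>' n t - g t))\<^sup>2"
          proof eventually_elim
            case (elim t)
            then show ?case using inner_sq_le[of x "\<phi>' n t - g t"] by (simp add: inner_diff_right)
          qed
        qed (auto simp: R_def)
      qed
    qed
    moreover have "((\<lambda>s. inner x (M0 (U s))) has_real_derivative inner x (M0 (V s))) (at s)"
      unfolding has_real_derivative_iff_has_vector_derivative
      by (rule bounded_linear.has_vector_derivative[OF bounded_linear_inner_right
            bounded_linear.has_vector_derivative[OF M0 V]])
    ultimately have "p s = inner x (M0 (V s))" by (rule DERIV_unique)
    then show ?thesis by (simp add: p_def inner_diff_right inner_add_right)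
  qed
  then have "(U s, M0 (V s) + M1 (U s) - F s) \<in> adjoint_graph D A"
    by (auto simp: adjoint_graph_def)
  then have "(U s, M0 (V s) + M1 (U s) - F s) \<in> op_graph D (\<lambda>x. - A x)"
    using A unfolding skew_selfadjoint_op_def by simp
  then have "U s \<in> D" "M0 (V s) + M1 (U s) - F s = - A (U s)" by (auto simp: op_graph_def)
  then show "U s \<in> D" "M0 (V s) + M1 (U s) + A (U s) = F s" by (auto simp: algebra_simps)
qed

section \<open>The global estimate\<close>

lemma partition_less:
  assumes "is_partition T N t" "i < j" "j \<le> N"
  shows "t i < t j"
  using assms(2,3)
proof (induction j)
  case (Suc j)
  have "t j < t (Suc j)" using assms(1) Suc.prems unfolding is_partition_def by simp
  then show ?case using Suc by (cases "i = j") auto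
qed simp

lemma partition_le:
  assumes "is_partition T N t" "i \<le> j" "j \<le> N"
  shows "t i \<le> t j"
  using partition_less[OF assms(1), of i j] assms(2,3) by (cases "i = j") auto

lemma partition_bounds:
  assumes "is_partition T N t" "j \<le> N"
  shows "0 \<le> t j" "t j \<le> T"
  using partition_le[OF assms(1), of 0 j] partition_le[OF assms(1), of j N] assms
  unfolding is_partition_def by auto

lemma partition_step_pos:
  assumes "is_partition T N t" "m \<in> {1..N}"
  shows "t (m - 1) < t m"
  using partition_less[OF assms(1), of "m - 1" m] assms(2) by auto

lemma cell_index_eq:
  assumes P: "is_partition T N t" and m: "m \<in> {1..N}" and s: "s \<in> cell t m"
  shows "cell_index N t s = m"
  unfolding cell_index_def
proof (rule the_equality)
  fix k assume k: "k \<in> {1..N} \<and> s \<in> cell t k"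
  show "k = m"
  proof (rule ccontr)
    assume "k \<noteq> m"
    then consider "k \<le> m - 1" | "m \<le> k - 1" using k m by linarith
    then show False
    proof cases
      case 1
      moreover have "m - 1 \<le> N" using m by auto
      ultimately show False using partition_le[OF P 1] k s by (auto simp: cell_def)
    next
      case 2
      moreover have "k - 1 \<le> N" using k by auto
      ultimately show False using partition_le[OF P 2] s k by (auto simp: cell_def)
    qed
  qed
qed (use m s in simp)

lemma cell_cover:
  assumes P: "is_partition T N t" and s: "0 < s" "s \<le> T"
  obtains m where "m \<in> {1..N}" "s \<in> cell t m"
proof -
  define m where "m = (LEAST k. s \<le> t k)"
  have N: "s \<le> t N" "t 0 < s" using P s by (auto simp: is_partition_def)
  have 1: "s \<le> t m" unfolding m_def by (rule LeastI[of _ N]) (rule N)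
  have 2: "m \<le> N" unfolding m_def by (rule Least_le) (rule N)
  have 3: "m \<noteq> 0" using 1 N by (metis not_less)
  have "\<not> s \<le> t (m - 1)"
    using not_less_Least[of "m - 1" "\<lambda>k. s \<le> t k"] 3 unfolding m_def by simp
  then show thesis using that[of m] 1 2 3 by (auto simp: cell_def)
qed

lemma islimpt_Ioc: "a < s \<Longrightarrow> s \<le> b \<Longrightarrow> s islimpt {a<..b}" for s :: real
  by (rule islimpt_subset[OF islimpt_greaterThanLessThan2[of a s]]) auto

text \<open>The last Radau node is the right end point of the half-open cell, where the derivative
  is one-sided. It is still unique, because every point of the cell is a limit point of it.\<close>

lemma pw_dt_eq:
  assumes P: "is_partition T N t" and m: "m \<in> {1..N}" and s: "s \<in> cell t m"
    and fg: "\<And>r. r \<in> cell t m \<Longrightarrow> f r = g r" and g: "(g has_vector_derivative g') (at s)"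
  shows "pw_dt N t f s = g'"
  unfolding pw_dt_def cell_index_eq[OF P m s]
proof (rule vector_derivative_within)
  show "at s within cell t m \<noteq> bot"
    using s islimpt_Ioc[of "t (m - 1)" s "t m"] by (auto simp: cell_def trivial_limit_within)
  show "(f has_vector_derivative g') (at s within cell t m)"
    by (rule has_vector_derivative_transform[OF s _ has_vector_derivative_at_within[OF g]])
      (simp add: fg)
qed

lemma right_lim_eq:
  assumes "a < b" "\<And>r. r \<in> {a<..b} \<Longrightarrow> f r = g r" "isCont g a"
  shows "right_lim f a = g a"
  unfolding right_lim_def
proof (rule tendsto_Lim)
  have "(g \<longlongrightarrow> g a) (at_right a)" using assms(3) by (simp add: isCont_def filterlim_at_split)
  moreover have "\<forall>\<^sub>F r in at_right a. g r = f r"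
    using eventually_at_right_less[of a] eventually_at_right_real[OF assms(1)]
    by eventually_elim (use assms(2) in auto)
  ultimately show "(f \<longlongrightarrow> g a) (at_right a)" by (rule Lim_transform_eventually)
qed simp

lemma left_lim_eq:
  assumes "a < b" "\<And>r. r \<in> {a<..b} \<Longrightarrow> f r = g r" "isCont g b"
  shows "left_lim f b = g b"
  unfolding left_lim_def
proof (rule tendsto_Lim)
  have "(g \<longlongrightarrow> g b) (at_left b)" using assms(3) by (simp add: isCont_def filterlim_at_split)
  moreover have "\<forall>\<^sub>F r in at_left b. g r = f r"
    using eventually_at_left_real[OF assms(1)]
    by eventually_elim (use assms(2) in auto)
  ultimately show "(f \<longlongrightarrow> g b) (at_left b)" by (rule Lim_transform_eventually)
qed simp

section \<open>The quadrature rule and the error equation on a cell\<close>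

text \<open>Under the affine map from [-1, 1] onto \<open>[a, b]\<close>, \<open>s + 1\<close> on
  the reference interval becomes \<open>2 / (b - a)\<close> times the distance from
  \<open>a\<close>. The exponent of the reference weight thus turns into
  \<open>- 2 * \<rho> * (s - a)\<close>.\<close>

lemma gauss_radau_transformed:
  assumes gr: "gauss_radau \<rho> (b - a) q x w" and ab: "a < b" and f: "vpoly_on (2 * q) UNIV f"
  shows "integral {a..b} (\<lambda>s. exp (- 2 * \<rho> * (s - a)) * f s)
    = (\<Sum>i\<le>q. (b - a) / 2 * w i * f ((a + b) / 2 + (b - a) / 2 * x i))"
proof -
  define h where "h = (b - a) / 2"
  define c where "c = (a + b) / 2"
  have h: "h > 0" using ab by (simp add: h_def)
  define g where "g s = exp (- 2 * \<rho> * (s - a)) * f s" for s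
  obtain p where p: "degree p \<le> 2 * q" "f = poly p" using vpoly_on_real_poly[OF f] by blast
  define p' where "p' = pcompose p [:c, h:]"
  have p': "poly p' s = f (h * s + c)" for s
    by (simp add: p'_def p(2) poly_pcompose algebra_simps)
  have "degree p' \<le> 2 * q"
    using p(1) h by (simp add: p'_def degree_pcompose)
  then have "integral {-1..1} (\<lambda>s. exp (- \<rho> * (b - a) * (s + 1)) * poly p' s) = (\<Sum>i\<le>q. w i * poly p' (x i))"
    using gr unfolding gauss_radau_def by blast
  moreover have "exp (- \<rho> * (b - a) * (s + 1)) * poly p' s = g (h * s + c)" for s
  proof -
    have "- \<rho> * (b - a) * (s + 1) = - 2 * \<rho> * (h * s + c - a)"
      by (simp add: h_def c_def field_simps)
    then show ?thesis by (simp add: g_def p')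
  qed
  ultimately have q: "integral {-1..1} (\<lambda>s. g (h * s + c)) = (\<Sum>i\<le>q. w i * f (c + h * x i))"
    by (simp add: p' add.commute)
  have gc: "continuous_on X g" for X
    unfolding g_def by (intro continuous_intros vpoly_on_continuous[OF f])
  have "(g has_integral integral {a..b} g) (cbox a b)"
    using integrable_continuous_interval[OF gc] by (simp add: integrable_integral)
  from has_integral_affinity[OF this, of h c]
  have "((\<lambda>s. g (h * s + c)) has_integral (1 / h) * integral {a..b} g) ((\<lambda>x. (1 / h) * x + - ((1 / h) * c)) ` {a..b})"
    using h by simp
  also have "(\<lambda>x. (1 / h) * x + - ((1 / h) * c)) ` {a..b} = {-1..1}"
  proof -
    have "(1 / h) * a + - ((1 / h) * c) = -1" "(1 / h) * b + - ((1 / h) * c) = 1"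
    proof -
      have "(1 / h) * a + - ((1 / h) * c) = (a - c) / h" "(1 / h) * b + - ((1 / h) * c) = (b - c) / h"
        by (simp_all add: diff_divide_distrib)
      moreover have "a - c = - h" "b - c = h" by (simp_all add: h_def c_def field_simps)
      ultimately show "(1 / h) * a + - ((1 / h) * c) = -1" "(1 / h) * b + - ((1 / h) * c) = 1"
        using h by simp_all
    qed
    then show ?thesis using image_affinity_atLeastAtMost[of "1 / h" "- ((1 / h) * c)" a b] h ab by simp
  qed
  finally have "integral {-1..1} (\<lambda>s. g (h * s + c)) = (1 / h) * integral {a..b} g"
    by (rule integral_unique)
  then have "integral {a..b} g = h * (\<Sum>i\<le>q. w i * f (c + h * x i))"
    using q h by (simp add: field_simps)
  then show ?thesis unfolding g_def h_def c_def by (simp add: sum_distrib_left mult_ac)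
qed

lemma radau_cell_gauss_radau:
  assumes "\<rho> > 0" "is_partition T N t" "m \<in> {1..N}" "gauss_radau \<rho> (step t m) q (x m) (w m)"
  shows "radau_cell \<rho> T (t (m - 1)) (t m) q (node t x m) (\<lambda>i. step t m / 2 * w m i)"
proof
  have s: "t (m - 1) < t m" by (rule partition_step_pos[OF assms(2,3)])
  then show "t (m - 1) < t m" .
  then have st: "step t m > 0" by (simp add: step_def)
  have "m - 1 \<le> N" "m \<le> N" using assms(3) by auto
  then show "t m - t (m - 1) \<le> T"
    using partition_bounds[OF assms(2), of "m - 1"] partition_bounds[OF assms(2), of m] by linarith
  have "step t m / 2 * (- 1) < step t m / 2 * x m 0"
    using st assms(4) by (intro mult_strict_left_mono) (auto simp: gauss_radau_def)
  then show "t (m - 1) < node t x m 0" by (simp add: node_def step_def field_simps)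
  show "node t x m i < node t x m (Suc i)" if "i < q" for i
    using that assms(4) st by (simp add: node_def gauss_radau_def)
  show "node t x m q = t m" using assms(4) by (simp add: node_def step_def gauss_radau_def field_simps)
  show "integral {t (m - 1)..t m} (\<lambda>s. exp (- 2 * \<rho> * (s - t (m - 1))) * f s)
      = (\<Sum>i\<le>q. step t m / 2 * w m i * f (node t x m i))" if "vpoly_on (2 * q) UNIV f" for f
    using gauss_radau_transformed[OF assms(4)[unfolded step_def] s that]
    by (simp add: node_def step_def)
qed (rule assms(1))

text \<open>\<open>p\<close> and \<open>ph\<close> are \<open>P U\<close> and \<open>P_hat U\<close> on the cell; they differ by \<open>\<theta> (U a - p a)\<close>.\<close>

lemma (in radau_cell) error_equation:
  fixes M0 M1 A :: "'h::real_inner \<Rightarrow> 'h"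
  assumes M0: "bounded_linear M0" and M1: "bounded_linear M1"
    and A: "\<And>x1 x2. x1 \<in> D \<Longrightarrow> x2 \<in> D \<Longrightarrow> A (x1 - x2) = A x1 - A x2"
    and UD: "\<And>i. i \<le> q \<Longrightarrow> U (y i) \<in> D" and uD: "\<And>i. i \<le> q \<Longrightarrow> u (y i) \<in> D"
    and exact_eq: "\<And>i. i \<le> q \<Longrightarrow> M0 (V (y i)) + M1 (U (y i)) + A (U (y i)) = F (y i)"
    and p: "p = interpolant q y U" "\<And>s. (p has_vector_derivative p' s) (at s)"
    and ph: "ph = interpolant (Suc q) (case_nat a y) U" "\<And>s. (ph has_vector_derivative ph' s) (at s)"
    and \<Phi>: "vpoly_on q UNIV \<Phi>"
    and discrete: "Q (\<lambda>s. inner (M0 (u' s) + M1 (u s) + A (u s)) (\<Phi> s)) + inner (M0 (u a - z)) (\<Phi> a)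
      = Q (\<lambda>s. inner (F s) (\<Phi> s))"
  shows "Q (\<lambda>s. inner (M0 (u' s - p' s) + M1 (u s - p s) + A (u s - p s)) (\<Phi> s))
      + inner (M0 ((u a - p a) - (z - U a))) (\<Phi> a)
    = Q (\<lambda>s. inner (M0 (V s - ph' s)) (\<Phi> s))
      + 2 * \<rho> * integral {a..b} (\<lambda>s. E s * (\<theta> s * inner (M0 (U a - p a)) (\<Phi> s)))"
proof -
  interpret M0: bounded_linear M0 by (rule M0)
  interpret M1: bounded_linear M1 by (rule M1)
  define \<eta> where "\<eta> = U a - p a"
  have pn: "p (y i) = U (y i)" if "i \<le> q" for i
    unfolding p(1) by (rule interpolant_at_node[OF y_inj that])
  have pp: "vpoly_on q UNIV p" unfolding p(1) by (rule vpoly_on_interpolant)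
  have inj: "inj_on (case_nat a y) {..Suc q}"
  proof (rule inj_onI)
    fix i j assume "i \<in> {..Suc q}" "j \<in> {..Suc q}" "case_nat a y i = case_nat a y j"
    then show "i = j"
      using y_gt_a y_inj by (cases i; cases j) (auto simp: inj_on_def)
  qed
  have "(\<lambda>s. p s + \<theta> s *\<^sub>R \<eta>) = interpolant (Suc q) (case_nat a y) U"
  proof (rule interpolant_unique[OF inj])
    have "vpoly_on (Suc q + 0) UNIV (\<lambda>s. \<theta> s *\<^sub>R \<eta>)"
      by (intro vpoly_on_scaleR \<theta>_poly vpoly_on_const)
    then show "vpoly_on (Suc q) UNIV (\<lambda>s. p s + \<theta> s *\<^sub>R \<eta>)"
      by (intro vpoly_on_add vpoly_on_mono[OF pp]) auto
    show "p (case_nat a y k) + \<theta> (case_nat a y k) *\<^sub>R \<eta> = U (case_nat a y k)" if "k \<le> Suc q" for k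
      using that by (cases k) (auto simp: \<theta>_a \<eta>_def \<theta>_node pn)
  qed
  then have ph_eq: "ph = (\<lambda>s. p s + \<theta> s *\<^sub>R \<eta>)" using ph(1) by simp
  obtain \<theta>' where \<theta>': "vpoly_on (Suc q - 1) UNIV \<theta>'" "\<And>s. (\<theta> has_vector_derivative \<theta>' s) (at s)"
    using vpoly_on_has_derivative[OF \<theta>_poly] by blast
  have \<theta>'_real: "(\<theta> has_real_derivative \<theta>' s) (at s)" for s
    using \<theta>'(2) by (simp add: has_real_derivative_iff_has_vector_derivative)
  have ph': "ph' s = p' s + \<theta>' s *\<^sub>R \<eta>" for s
  proof (rule vector_derivative_unique_at[OF ph(2)])
    show "(ph has_vector_derivative p' s + \<theta>' s *\<^sub>R \<eta>) (at s)"
      unfolding ph_eq by (auto intro!: derivative_eq_intros p(2) \<theta>'_real)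
  qed
  have "Q (\<lambda>s. inner (M0 (u' s - p' s) + M1 (u s - p s) + A (u s - p s)) (\<Phi> s))
    = Q (\<lambda>s. (inner (M0 (u' s) + M1 (u s) + A (u s)) (\<Phi> s) - inner (F s) (\<Phi> s))
        + (inner (M0 (V s - ph' s)) (\<Phi> s) + \<theta>' s * inner (M0 \<eta>) (\<Phi> s)))"
  proof (intro Q_cong)
    fix i assume i: "i \<le> q"
    \<comment> \<open>\<open>p\<close> agrees with \<open>U\<close> at the nodes, so the exact
      equation accounts for \<open>M1\<close> and \<open>A\<close>. Only the time derivatives of
      \<open>U\<close> and \<open>p\<close> differ there, by the derivative of \<open>U - ph\<close>
      plus that of \<open>\<theta> \<eta>\<close>.\<close>
    have "M0 (u' (y i) - p' (y i)) + M1 (u (y i) - p (y i)) + A (u (y i) - p (y i))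
      = (M0 (u' (y i)) + M1 (u (y i)) + A (u (y i))) - F (y i) + (M0 (V (y i) - ph' (y i)) + \<theta>' (y i) *\<^sub>R M0 \<eta>)"
      unfolding exact_eq[OF i, symmetric] pn[OF i] ph'
      using A[OF uD[OF i] UD[OF i]] by (simp add: M0.diff M0.add M0.scale M1.diff algebra_simps)
    then show "inner (M0 (u' (y i) - p' (y i)) + M1 (u (y i) - p (y i)) + A (u (y i) - p (y i))) (\<Phi> (y i))
      = (inner (M0 (u' (y i)) + M1 (u (y i)) + A (u (y i))) (\<Phi> (y i)) - inner (F (y i)) (\<Phi> (y i)))
        + (inner (M0 (V (y i) - ph' (y i))) (\<Phi> (y i)) + \<theta>' (y i) * inner (M0 \<eta>) (\<Phi> (y i)))"
      by (simp only: inner_add_left inner_diff_left inner_scaleR_left)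
  qed
  also have "\<dots> = Q (\<lambda>s. inner (M0 (u' s) + M1 (u s) + A (u s)) (\<Phi> s)) - Q (\<lambda>s. inner (F s) (\<Phi> s))
      + (Q (\<lambda>s. inner (M0 (V s - ph' s)) (\<Phi> s)) + Q (\<lambda>s. \<theta>' s * inner (M0 \<eta>) (\<Phi> s)))"
    by (simp only: Q_add Q_diff)
  also have "Q (\<lambda>s. \<theta>' s * inner (M0 \<eta>) (\<Phi> s)) = - inner (M0 \<eta>) (\<Phi> a)
      + 2 * \<rho> * integral {a..b} (\<lambda>s. E s * (\<theta> s * inner (M0 \<eta>) (\<Phi> s)))"
    using \<theta>'(1) by (intro Q_theta_deriv vpoly_on_bounded_linear[OF bounded_linear_inner_right \<Phi>] \<theta>'_real) simp
  \<comment> \<open>The boundary term of the preceding identity is what converts the jump of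
    \<open>u\<close> into the jump of the error, with entering value \<open>z - U a\<close>.\<close>
  also have "inner (M0 ((u a - p a) - (z - U a))) (\<Phi> a) = inner (M0 (u a - z)) (\<Phi> a) + inner (M0 \<eta>) (\<Phi> a)"
    unfolding \<eta>_def by (simp add: M0.diff M0.add inner_diff_left inner_add_left)
  ultimately show ?thesis using discrete unfolding \<eta>_def by linarith
qed

section \<open>Summation over the cells\<close>

text \<open>Coercivity holds for all parameters beyond \<open>\<rho>0\<close>, so a negative value
  of the form would eventually outweigh the fixed contribution of \<open>M1\<close>.\<close>

lemma coercive_imp_nonneg:
  fixes M0 M1 :: "'h::real_inner \<Rightarrow> 'h"
  assumes "\<And>r. r \<ge> \<rho>0 \<Longrightarrow> inner (r *\<^sub>R M0 h + M1 h) h \<ge> \<gamma> * inner h h" "\<gamma> > 0"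
  shows "0 \<le> inner (M0 h) h"
proof (rule ccontr)
  define c where "c = inner (M0 h) h"
  define d where "d = inner (M1 h) h"
  assume "\<not> 0 \<le> inner (M0 h) h"
  then have c: "c < 0" by (simp add: c_def)
  \<comment> \<open>Large enough that \<open>r * c\<close> is at most
    \<open>- (\<bar>d\<bar> + 1)\<close>, which forces \<open>r * c + d\<close> to be
    negative.\<close>
  define r where "r = max \<rho>0 ((\<bar>d\<bar> + 1) / (- c))"
  have "\<gamma> * inner h h \<le> r * c + d"
    using assms(1)[of r] by (simp add: r_def inner_add_left c_def d_def)
  moreover have "r * c \<le> (\<bar>d\<bar> + 1) / (- c) * c"
    using c by (intro mult_right_mono_neg) (auto simp: r_def)
  moreover have "(\<bar>d\<bar> + 1) / (- c) * c = - (\<bar>d\<bar> + 1)" using c by (simp add: field_simps)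
  moreover have "0 \<le> \<gamma> * inner h h" using assms(2) by simp
  ultimately show False by linarith
qed

lemma sup_const_nonneg:
  assumes "0 < \<rho>" "0 < T" "0 \<le> \<mu>0" "0 \<le> \<mu>1"
  shows "0 \<le> sup_const \<rho> T q \<mu>0 \<mu>1"
proof -
  have "0 \<le> sup_const_aux \<rho> T q \<mu>0 \<mu>1"
    using assms node_const_pos[of \<rho> T q] theta_const_pos[of \<rho> T q] inverse_const_pos[of "2 * q"]
    unfolding sup_const_aux_def Let_def by (intro add_nonneg_nonneg mult_nonneg_nonneg divide_nonneg_nonneg) auto
  then show ?thesis using inverse_const_pos[of "2 * q"] by (simp add: sup_const_def)
qed

text \<open>The energy steps telescope, so each ingredient of the supremum bound on a cell is
  controlled by the total data \<open>S\<close>: entering energy and jump energy by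
  \<open>2 * C1\<close>, the quadrature norm by \<open>2 * C1 / \<gamma>\<close>, the data of the
  cell by 1. Their sum is the bracket next to \<open>C2\<close>.\<close>

lemma error_estimate:
  fixes M0 M1 A :: "'h::{real_inner, complete_space} \<Rightarrow> 'h"
  assumes pos: "T > 0" "\<gamma> > 0" "\<rho> > 0"
    and M0: "bounded_linear M0" and M1: "bounded_linear M1"
    and sa: "selfadjoint_op UNIV M0" and A: "skew_selfadjoint_op D A"
    and \<rho>0: "\<rho>0 \<le> \<rho>"
    and coercive: "\<And>r h. r \<ge> \<rho>0 \<Longrightarrow> inner (r *\<^sub>R M0 h + M1 h) h \<ge> \<gamma> * inner h h"
    and P: "is_partition T N t"
    and gr: "\<And>m. m \<in> {1..N} \<Longrightarrow> gauss_radau \<rho> (step t m) q (x m) (w m)"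
    and F: "continuous_on UNIV F" and U: "U \<in> Hkw 2 \<rho>" "continuous_on UNIV U"
    and sol: "solves_evo \<rho> M0 M1 D A F U"
    and disc: "discrete_solution q N t x w M0 M1 D A F (right_lim U 0) Ut" "Ut 0 = right_lim U 0"
    and s: "s \<in> {0..T}"
  defines "C1 \<equiv> (1 + 4 * \<rho>\<^sup>2 * (theta_const \<rho> T q)\<^sup>2) / \<gamma>"
  defines "C2 \<equiv> sup_const \<rho> T q (onorm M0) (onorm M1)"
  shows "inner (M0 (Ut s - interp_P q N t x U s)) (Ut s - interp_P q N t x U s) \<le>
    C2 * (4 * C1 + 2 * C1 / \<gamma> + 1) * exp (2 * \<rho> * T) *
      (Qnorm_sq \<rho> q N t x w (pw_dt N t (\<lambda>s. M0 (U s - interp_P_hat q N t x U s)))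
       + T * Max ((\<lambda>m. (norm (M0 (right_lim (\<lambda>s. U s - interp_P q N t x U s) (t (m - 1)))))\<^sup>2
                         * exp (- 2 * \<rho> * t (m - 1))) ` {1..N}))"
proof -
  obtain V where V: "continuous_on UNIV V" "\<And>s. (U has_vector_derivative V s) (at s)"
    using Hkw_2_C1[OF U] by blast
  note UD = evolution_pointwise(1)[OF M0 M1 A F U(2) V(2) sol]
  note U_eq = evolution_pointwise(2)[OF M0 M1 A F U(2) V(2) sol]
  have Uc: "isCont U s" for s using U(2) by (simp add: continuous_on_eq_continuous_at)
  have U0: "right_lim U 0 = U 0" by (rule right_lim_eq[of 0 1]) (auto intro: Uc)
  have t0: "t 0 = 0" "t N = T" using P by (auto simp: is_partition_def)
  have A_diff: "A (x1 - x2) = A x1 - A x2" "x1 - x2 \<in> D" if "x1 \<in> D" "x2 \<in> D" for x1 x2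
  proof -
    have sub: "subspace D" and add: "\<And>x y. x \<in> D \<Longrightarrow> y \<in> D \<Longrightarrow> A (x + y) = A x + A y"
      and sc: "\<And>c x. x \<in> D \<Longrightarrow> A (c *\<^sub>R x) = c *\<^sub>R A x"
      using A unfolding skew_selfadjoint_op_def densely_defined_op_def by auto
    have m: "(-1) *\<^sub>R x2 \<in> D" using sub that(2) by (rule subspace_scale)
    show "A (x1 - x2) = A x1 - A x2" using add[OF that(1) m] sc[OF that(2), of "-1"] by simp
    show "x1 - x2 \<in> D" using sub that by (rule subspace_diff)
  qed
  have sym: "inner (M0 x1) x2 = inner x1 (M0 x2)" for x1 x2
  proof -
    have "(x2, M0 x2) \<in> adjoint_graph UNIV M0" using sa by (auto simp: selfadjoint_op_def op_graph_def)
    then show ?thesis by (simp add: adjoint_graph_def)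
  qed
  have nonneg: "0 \<le> inner (M0 h) h" for h by (rule coercive_imp_nonneg[OF coercive pos(2)])
  have bound: "norm (M0 h) \<le> onorm M0 * norm h" "norm (M1 h) \<le> onorm M1 * norm h" for h
    by (rule onorm[OF M0] onorm[OF M1])+
  have onn: "0 \<le> onorm M0" "0 \<le> onorm M1" by (rule onorm_pos_le[OF M0] onorm_pos_le[OF M1])+
  have Ut_D: "Ut r \<in> D" if "0 < r" "r \<le> T" for r
    using disc(1) that t0 by (auto simp: discrete_solution_def)
  have disc_eq: "Qm_inner q t x w m (\<lambda>s. pw_dt N t (\<lambda>r. M0 (Ut r)) s + M1 (Ut s) + A (Ut s)) \<Phi>
          + inner (M0 (jump t (right_lim U 0) Ut m)) (right_lim \<Phi> (t (m - 1)))
        = Qm_inner q t x w m (interp_P q N t x F) \<Phi>"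
    if "vpoly_on q UNIV \<Phi>" "m \<in> {1..N}" for \<Phi> m
    using disc(1) that vpoly_on_subset[OF that(1)] by (auto simp: discrete_solution_def pw_poly_def)
  have "\<forall>m\<in>{1..N}. \<exists>u u'. vpoly_on q UNIV u \<and> vpoly_on (q - 1) UNIV u' \<and>
      (\<forall>s. (u has_vector_derivative u' s) (at s)) \<and> (\<forall>s\<in>cell t m. Ut s = u s)"
  proof
    fix m assume "m \<in> {1..N}"
    then have "vpoly_on q (cell t m) Ut" using disc(1) by (auto simp: discrete_solution_def pw_poly_def)
    then obtain u where u: "vpoly_on q UNIV u" "\<And>s. s \<in> cell t m \<Longrightarrow> Ut s = u s"
      using vpoly_on_extend by blast
    obtain u' where "vpoly_on (q - 1) UNIV u'" "\<And>s. (u has_vector_derivative u' s) (at s)"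
      using vpoly_on_has_derivative[OF u(1)] by blast
    with u show "\<exists>u u'. vpoly_on q UNIV u \<and> vpoly_on (q - 1) UNIV u' \<and>
      (\<forall>s. (u has_vector_derivative u' s) (at s)) \<and> (\<forall>s\<in>cell t m. Ut s = u s)" by blast
  qed
  then obtain u u' where "\<forall>m\<in>{1..N}. vpoly_on q UNIV (u m) \<and> vpoly_on (q - 1) UNIV (u' m) \<and>
      (\<forall>s. (u m has_vector_derivative u' m s) (at s)) \<and> (\<forall>s\<in>cell t m. Ut s = u m s)"
    by metis
  then have u: "vpoly_on q UNIV (u m)" "vpoly_on (q - 1) UNIV (u' m)"
      "(u m has_vector_derivative u' m r) (at r)" "r \<in> cell t m \<Longrightarrow> Ut r = u m r"
    if "m \<in> {1..N}" for m r
    using that by blast+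
  define p where "p m = interpolant q (node t x m) U" for m
  define ph where "ph m = interpolant (Suc q) (case_nat (t (m - 1)) (node t x m)) U" for m
  have p_poly: "vpoly_on q UNIV (p m)" and ph_poly: "vpoly_on (Suc q) UNIV (ph m)" for m
    unfolding p_def ph_def by (rule vpoly_on_interpolant)+
  have "\<exists>p'. vpoly_on (q - 1) UNIV p' \<and> (\<forall>s. (p m has_vector_derivative p' s) (at s))" for m
    by (rule vpoly_on_has_derivative[OF p_poly[of m]]) blast
  then obtain p' where p': "\<And>m. vpoly_on (q - 1) UNIV (p' m)"
      "\<And>m s. (p m has_vector_derivative p' m s) (at s)" by metis
  have "\<exists>ph'. \<forall>s. (ph m has_vector_derivative ph' s) (at s)" for m
  proof (rule vpoly_on_has_derivative[OF ph_poly[of m]])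
    fix f' assume "\<And>s. (ph m has_vector_derivative f' s) (at s)"
    then show ?thesis by (intro exI[of _ f'] allI)
  qed
  then obtain ph' where ph': "\<And>m s. (ph m has_vector_derivative ph' m s) (at s)" by metis
  define v where "v m s = u m s - p m s" for m s
  define zu where "zu m = (if m = 1 then U 0 else u (m - 1) (t (m - 1)))" for m
  \<comment> \<open>The error entering cell \<open>m\<close>. It is zero for \<open>m = 1\<close>,
    since the discrete solution starts from the exact initial value.\<close>
  define z where "z m = zu m - U (t (m - 1))" for m
  define \<eta> where "\<eta> m = U (t (m - 1)) - p m (t (m - 1))" for m
  define r where "r m s = M0 (V s - ph' m s)" for m s
  have cell_pos: "0 < s" "s \<le> T" if "m \<in> {1..N}" "s \<in> cell t m" for m s
  proof -
    have "m - 1 \<le> N" "m \<le> N" using that by auto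
    then show "0 < s" "s \<le> T"
      using that(2) partition_bounds[OF P, of "m - 1"] partition_bounds[OF P, of m] by (auto simp: cell_def)
  qed
  have interp: "interp_P q N t x f s = interpolant q (node t x m) f s"
    if "m \<in> {1..N}" "s \<in> cell t m" for m s and f :: "real \<Rightarrow> 'h"
    using cell_pos[OF that] cell_index_eq[OF P that] by (simp add: interp_P_def)
  have interp_hat: "interp_P_hat q N t x U s = ph m s" if "m \<in> {1..N}" "s \<in> cell t m" for m s
    using cell_pos[OF that] cell_index_eq[OF P that] by (simp add: interp_P_hat_def ph_def Let_def)
  have xi: "Ut s - interp_P q N t x U s = v m s" if "m \<in> {1..N}" "s \<in> cell t m" for m s
    using u(4)[OF that] interp[OF that] by (simp add: v_def p_def)
  have radau: "radau_cell \<rho> T (t (m - 1)) (t m) q (node t x m) (\<lambda>i. step t m / 2 * w m i)"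
    if "m \<in> {1..N}" for m
    by (rule radau_cell_gauss_radau[where x = x and w = w, OF pos(3) P that gr[OF that]])
  have node_cell: "node t x m i \<in> cell t m" if "m \<in> {1..N}" "i \<le> q" for m i
    using radau_cell.y_gt_a[OF radau that(2)] radau_cell.y_le_b[OF radau that(2)] that(1)
    by (auto simp: cell_def)
  have p_node: "p m (node t x m i) = U (node t x m i)" if "m \<in> {1..N}" "i \<le> q" for m i
    unfolding p_def by (rule interpolant_at_node[OF radau_cell.y_inj[OF radau[OF that(1)]] that(2)])
  have CE: "cell_error \<rho> T (t (m - 1)) (t m) q (node t x m) (\<lambda>i. step t m / 2 * w m i)
      M0 M1 A \<gamma> (onorm M0) (onorm M1) (v m) (\<lambda>s. u' m s - p' m s) (r m) (z m) (\<eta> m)"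
    if m: "m \<in> {1..N}" for m
  proof -
    interpret c: radau_cell \<rho> T "t (m - 1)" "t m" q "node t x m" "\<lambda>i. step t m / 2 * w m i"
      by (rule radau[OF m])
    have Qm: "Qm q t x w m f = c.Q f" for f
      unfolding Qm_def c.Q_def sum_distrib_left by (simp only: mult.assoc)
    have Ut_lim: "right_lim Ut (t (m - 1)) = u m (t (m - 1))"
    proof (rule right_lim_eq[OF c.ab])
      show "Ut r = u m r" if "r \<in> {t (m - 1)<..t m}" for r using u(4)[OF m] that by (simp add: cell_def)
      show "isCont (u m) (t (m - 1))"
        using vpoly_on_continuous[OF u(1)[OF m], of UNIV] by (simp add: continuous_on_eq_continuous_at)
    qed
    have Ut_left: "left_lim Ut (t (m - 1)) = u (m - 1) (t (m - 1))" if "m \<noteq> 1"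
    proof -
      have m1: "m - 1 \<in> {1..N}" using m that by auto
      show ?thesis
      proof (rule left_lim_eq[OF partition_step_pos[OF P m1]])
        show "Ut r = u (m - 1) r" if "r \<in> {t (m - 1 - 1)<..t (m - 1)}" for r
          using u(4)[OF m1] that by (simp add: cell_def)
        show "isCont (u (m - 1)) (t (m - 1))"
          using vpoly_on_continuous[OF u(1)[OF m1], of UNIV] by (simp add: continuous_on_eq_continuous_at)
      qed
    qed
    have jump: "jump t (right_lim U 0) Ut m = u m (t (m - 1)) - zu m"
      unfolding jump_def zu_def Ut_lim U0 using Ut_left by simp
    have discrete: "c.Q (\<lambda>s. inner (M0 (u' m s) + M1 (u m s) + A (u m s)) (\<Phi> s))
        + inner (M0 (u m (t (m - 1)) - zu m)) (\<Phi> (t (m - 1))) = c.Q (\<lambda>s. inner (F s) (\<Phi> s))"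
      if \<Phi>: "vpoly_on q UNIV \<Phi>" for \<Phi>
    proof -
      have "right_lim \<Phi> (t (m - 1)) = \<Phi> (t (m - 1))"
        using vpoly_on_continuous[OF \<Phi>, of UNIV]
        by (intro right_lim_eq[OF c.ab]) (auto simp: continuous_on_eq_continuous_at)
      moreover have "Qm_inner q t x w m (\<lambda>s. pw_dt N t (\<lambda>r. M0 (Ut r)) s + M1 (Ut s) + A (Ut s)) \<Phi>
          = c.Q (\<lambda>s. inner (M0 (u' m s) + M1 (u m s) + A (u m s)) (\<Phi> s))"
        unfolding Qm_inner_def Qm
      proof (rule c.Q_cong)
        fix i assume i: "i \<le> q"
        have "pw_dt N t (\<lambda>r. M0 (Ut r)) (node t x m i) = M0 (u' m (node t x m i))"
          using u(4)[OF m]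
          by (intro pw_dt_eq[OF P m node_cell[OF m i], of _ "\<lambda>r. M0 (u m r)"]
              bounded_linear.has_vector_derivative[OF M0 u(3)[OF m]]) simp
        then show "inner (pw_dt N t (\<lambda>r. M0 (Ut r)) (node t x m i) + M1 (Ut (node t x m i)) + A (Ut (node t x m i))) (\<Phi> (node t x m i))
          = inner (M0 (u' m (node t x m i)) + M1 (u m (node t x m i)) + A (u m (node t x m i))) (\<Phi> (node t x m i))"
          using u(4)[OF m node_cell[OF m i]] by simp
      qed
      moreover have "Qm_inner q t x w m (interp_P q N t x F) \<Phi> = c.Q (\<lambda>s. inner (F s) (\<Phi> s))"
        unfolding Qm_inner_def Qm
        by (rule c.Q_cong) (simp add: interp[OF m node_cell[OF m]] interpolant_at_node[OF c.y_inj])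
      ultimately show ?thesis using disc_eq[OF \<Phi> m] jump by simp
    qed
    have u_node: "u m (node t x m i) = Ut (node t x m i)" "Ut (node t x m i) \<in> D" if "i \<le> q" for i
      using u(4)[OF m node_cell[OF m that]] Ut_D[OF cell_pos[OF m node_cell[OF m that]]] by auto
    show ?thesis
    proof (intro cell_error.intro cell_error_axioms.intro)
      show "inner (A (v m (node t x m i))) (v m (node t x m i)) = 0" if "i \<le> q" for i
      proof -
        have "v m (node t x m i) \<in> D"
          unfolding v_def p_node[OF m that] u_node(1)[OF that]
          by (rule A_diff(2)[OF u_node(2)[OF that] UD])
        from skew_selfadjoint_inner[OF A this this] show ?thesis by (simp add: inner_commute)
      qed
      show "vpoly_on q UNIV (v m)" unfolding v_def by (intro vpoly_on_diff u(1)[OF m] p_poly)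
      show "vpoly_on (q - 1) UNIV (\<lambda>s. u' m s - p' m s)" by (intro vpoly_on_diff u(2)[OF m] p')
      show "(v m has_vector_derivative u' m s - p' m s) (at s)" for s
        unfolding v_def by (intro has_vector_derivative_diff u(3)[OF m] p')
      show "c.Q (\<lambda>s. inner (M0 (u' m s - p' m s) + M1 (v m s) + A (v m s)) (\<Phi> s))
          + inner (M0 (v m (t (m - 1)) - z m)) (\<Phi> (t (m - 1)))
        = c.Q (\<lambda>s. inner (r m s) (\<Phi> s)) + 2 * \<rho> * integral {t (m - 1)..t m}
            (\<lambda>s. c.E s * (c.\<theta> s * inner (M0 (\<eta> m)) (\<Phi> s)))"
        if \<Phi>: "vpoly_on q UNIV \<Phi>" for \<Phi>
        unfolding v_def z_def r_def \<eta>_def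
        by (rule c.error_equation[OF M0 M1 A_diff(1) UD _ U_eq p_def p'(2) ph_def ph' \<Phi> discrete[OF \<Phi>]])
          (use u_node in auto)
    qed (use c.radau_cell_axioms M0 sym nonneg bound onn pos coercive \<rho>0 in auto)
  qed
  define e where "e m = exp (- 2 * \<rho> * t (m - 1))" for m
  \<comment> \<open>The weighted energy at \<open>t m\<close>. There is no cell of index 0, and the
    value 0 set for it matches the vanishing initial error, so the telescoping sum starts from
    nothing.\<close>
  define en where "en m = (if m = 0 then 0 else inner (M0 (v m (t m))) (v m (t m)) * exp (- 2 * \<rho> * t m))" for m
  define B where "B m = Qm_inner q t x w m (v m) (v m)" for m
  define R where "R m = Qm_inner q t x w m (r m) (r m)" for m
  define H where "H m = (t m - t (m - 1)) * (norm (M0 (\<eta> m)))\<^sup>2" for m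
  define J where "J m = inner (M0 (v m (t (m - 1)) - z m)) (v m (t (m - 1)) - z m)" for m
  have e: "e m > 0" for m by (simp add: e_def)
  have z_en: "inner (M0 (z m)) (z m) * e m = en (m - 1)" if m: "m \<in> {1..N}" for m
  proof (cases "m = 1")
    case True
    then have "z m = 0" by (simp add: z_def zu_def t0)
    then show ?thesis using True by (simp add: en_def)
  next
    case False
    then have m1: "m - 1 \<in> {1..N}" using m by auto
    \<comment> \<open>The last Radau node is the right end point, so \<open>P U\<close> is exact
      there and the error leaving a cell is the one entering the next.\<close>
    have "node t x (m - 1) q = t (m - 1)" using radau_cell.yq[OF radau[OF m1]] .
    then have "p (m - 1) (t (m - 1)) = U (t (m - 1))" using p_node[OF m1, of q] by simp
    then have "z m = v (m - 1) (t (m - 1))" using False by (simp add: z_def zu_def v_def)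
    moreover have "m - 1 \<noteq> 0" using m1 by (metis atLeastAtMost_iff not_one_le_zero)
    ultimately show ?thesis by (simp only: en_def e_def if_False)
  qed
  have energy: "en m + \<gamma> * (B m * e m) + J m * e m \<le> en (m - 1) + 2 * C1 * ((R m + H m) * e m)"
    and supb: "\<And>s. s \<in> {t (m - 1)..t m} \<Longrightarrow> inner (M0 (v m s)) (v m s) * e m \<le>
      C2 * (en (m - 1) + B m * e m + (R m + H m) * e m + J m * e m)"
    and nn: "0 \<le> B m" "0 \<le> R m" "0 \<le> H m" "0 \<le> J m" if m: "m \<in> {1..N}" for m
  proof -
    interpret c: cell_error \<rho> T "t (m - 1)" "t m" q "node t x m" "\<lambda>i. step t m / 2 * w m i"
      M0 M1 A \<gamma> "onorm M0" "onorm M1" "v m" "\<lambda>s. u' m s - p' m s" "r m" "z m" "\<eta> m"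
      by (rule CE[OF m])
    have Qm: "Qm q t x w m f = c.Q f" for f
      unfolding Qm_def c.Q_def sum_distrib_left by (simp only: mult.assoc)
    have BQ: "B m = c.Q (\<lambda>s. inner (v m s) (v m s))" and RQ: "R m = c.Q (\<lambda>s. inner (r m s) (r m s))"
      unfolding B_def R_def Qm_inner_def Qm by (rule refl)+
    have data: "c.data = R m + H m" unfolding c.data_def RQ H_def by (rule refl)
    have Eb: "c.E (t m) * e m = exp (- 2 * \<rho> * t m)"
      unfolding c.E_def e_def exp_add[symmetric] by (simp add: algebra_simps)
    have "(inner (M0 (v m (t m))) (v m (t m)) * c.E (t m) + \<gamma> * B m + J m) * e m
        \<le> (inner (M0 (z m)) (z m) + 2 * C1 * (R m + H m)) * e m"
      using c.energy_step e[of m] unfolding data BQ[symmetric] J_def[symmetric] C1_def[symmetric]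
      by (intro mult_right_mono) auto
    also have "\<dots> = en (m - 1) + 2 * C1 * ((R m + H m) * e m)"
      by (simp only: distrib_right z_en[OF m] mult.assoc)
    also have "(inner (M0 (v m (t m))) (v m (t m)) * c.E (t m) + \<gamma> * B m + J m) * e m
        = inner (M0 (v m (t m))) (v m (t m)) * (c.E (t m) * e m) + \<gamma> * (B m * e m) + J m * e m"
      by (simp only: distrib_right mult.assoc)
    finally show "en m + \<gamma> * (B m * e m) + J m * e m \<le> en (m - 1) + 2 * C1 * ((R m + H m) * e m)"
      unfolding Eb using m by (simp add: en_def)
    show "inner (M0 (v m s)) (v m s) * e m \<le>
      C2 * (en (m - 1) + B m * e m + (R m + H m) * e m + J m * e m)" if "s \<in> {t (m - 1)..t m}" for s
    proof -
      have "inner (M0 (v m s)) (v m s) * e m \<le>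
          (C2 * (inner (M0 (z m)) (z m) + B m + (R m + H m) + J m)) * e m"
        using c.sup_step[OF that] e[of m] unfolding data BQ[symmetric] J_def[symmetric] C2_def[symmetric]
        by (intro mult_right_mono) auto
      also have "\<dots> = C2 * (inner (M0 (z m)) (z m) * e m + B m * e m + (R m + H m) * e m + J m * e m)"
        by (simp only: distrib_right mult.assoc)
      finally show ?thesis unfolding z_en[OF m] .
    qed
    show "0 \<le> B m" "0 \<le> R m" unfolding BQ RQ by (rule c.Q_nonneg, rule inner_ge_zero)+
    show "0 \<le> H m" "0 \<le> J m" using c.ab nonneg by (auto simp: H_def J_def)
  qed
  have C1: "0 \<le> C1" using pos by (simp add: C1_def)
  have C2: "0 \<le> C2" unfolding C2_def using pos onn by (intro sup_const_nonneg) auto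
  define S where "S = (\<Sum>m=1..N. (R m + H m) * e m)"
  have partial: "0 \<le> (\<Sum>m=1..k. (R m + H m) * e m)" "(\<Sum>m=1..k. (R m + H m) * e m) \<le> S"
      if "k \<le> N" for k
  proof -
    have "0 \<le> (R m + H m) * e m" if "m \<in> {1..N}" for m
      using nn[OF that] e[of m] by simp
    then show "0 \<le> (\<Sum>m=1..k. (R m + H m) * e m)" "(\<Sum>m=1..k. (R m + H m) * e m) \<le> S"
      using that unfolding S_def by (auto intro!: sum_nonneg sum_mono2)
  qed
  have en_nn: "0 \<le> en m" for m using nonneg by (simp add: en_def)
  have en_le: "en k \<le> 2 * C1 * (\<Sum>m=1..k. (R m + H m) * e m)" if "k \<le> N" for k
    using that
  proof (induction k)
    case 0
    then show ?case by (simp add: en_def)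
  next
    case (Suc k)
    then have m: "Suc k \<in> {1..N}" by simp
    have "0 \<le> \<gamma> * (B (Suc k) * e (Suc k)) + J (Suc k) * e (Suc k)"
      using nn[OF m] e[of "Suc k"] pos by (intro add_nonneg_nonneg mult_nonneg_nonneg) auto
    then have "en (Suc k) \<le> en k + 2 * C1 * ((R (Suc k) + H (Suc k)) * e (Suc k))"
      using energy[OF m] by simp
    then show ?case using Suc by (simp add: distrib_left)
  qed
  have cell_le: "en (m - 1) \<le> 2 * C1 * S" "B m * e m \<le> 2 * C1 / \<gamma> * S" "J m * e m \<le> 2 * C1 * S"
      "(R m + H m) * e m \<le> S" if m: "m \<in> {1..N}" for m
  proof -
    define k where "k = m - 1"
    have mk: "m = Suc k" "Suc k \<le> N" "k \<le> N" using m by (auto simp: k_def)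
    have split: "(\<Sum>i=1..m. (R i + H i) * e i) = (\<Sum>i=1..k. (R i + H i) * e i) + (R m + H m) * e m"
      by (simp add: mk(1))
    have pm: "0 \<le> (\<Sum>i=1..k. (R i + H i) * e i)" "(\<Sum>i=1..k. (R i + H i) * e i) \<le> S"
        "(\<Sum>i=1..m. (R i + H i) * e i) \<le> S"
      using partial(1)[OF mk(3)] partial(2)[OF mk(3)] partial(2)[of m] mk(1,2) by blast+
    show "en (m - 1) \<le> 2 * C1 * S"
      using en_le[OF mk(3)] mult_left_mono[OF pm(2), of "2 * C1"] C1 by (simp add: k_def)
    show "(R m + H m) * e m \<le> S" using split pm by linarith
    have "en (m - 1) + 2 * C1 * ((R m + H m) * e m) \<le> 2 * C1 * (\<Sum>i=1..m. (R i + H i) * e i)"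
      unfolding split distrib_left using en_le[OF mk(3)] by (simp add: k_def)
    also have "\<dots> \<le> 2 * C1 * S" using pm(3) C1 by (intro mult_left_mono) auto
    finally have le: "en m + \<gamma> * (B m * e m) + J m * e m \<le> 2 * C1 * S" using energy[OF m] by linarith
    have BJ: "0 \<le> \<gamma> * (B m * e m)" "0 \<le> J m * e m" using nn[OF m] e[of m] pos by simp_all
    show "J m * e m \<le> 2 * C1 * S" using le BJ en_nn[of m] by linarith
    have "\<gamma> * (B m * e m) \<le> 2 * C1 * S" using le BJ en_nn[of m] by linarith
    then show "B m * e m \<le> 2 * C1 / \<gamma> * S" using pos by (simp add: field_simps)
  qed
  define Mx where "Mx = Max ((\<lambda>m. (norm (M0 (right_lim (\<lambda>s. U s - interp_P q N t x U s) (t (m - 1)))))\<^sup>2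
                         * exp (- 2 * \<rho> * t (m - 1))) ` {1..N})"
  have \<eta>_lim: "right_lim (\<lambda>s. U s - interp_P q N t x U s) (t (m - 1)) = \<eta> m" if m: "m \<in> {1..N}" for m
    unfolding \<eta>_def
  proof (rule right_lim_eq[OF partition_step_pos[OF P m]])
    show "U r - interp_P q N t x U r = U r - p m r" if "r \<in> {t (m - 1)<..t m}" for r
      using interp[OF m, of r U] that by (simp add: cell_def p_def)
    show "isCont (\<lambda>s. U s - p m s) (t (m - 1))"
      using vpoly_on_continuous[OF p_poly, of UNIV m]
      by (intro isCont_diff Uc) (simp add: continuous_on_eq_continuous_at)
  qed
  have Mx: "(norm (M0 (\<eta> m)))\<^sup>2 * e m \<le> Mx" if m: "m \<in> {1..N}" for m
    unfolding Mx_def e_def \<eta>_lim[OF m, symmetric] using m by (intro Max_ge) auto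
  \<comment> \<open>The cell lengths contained in \<open>H\<close> add up to \<open>T\<close>, the
    factor in front of the maximum.\<close>
  have "(\<Sum>m=1..N. H m * e m) \<le> (\<Sum>m=1..N. (t m - t (m - 1)) * Mx)"
    using Mx partition_step_pos[OF P] unfolding H_def mult.assoc
    by (intro sum_mono mult_left_mono) (auto simp: less_imp_le)
  also have "\<dots> = (\<Sum>m=1..N. t m - t (m - 1)) * Mx" by (simp only: sum_distrib_right)
  also have "(\<Sum>m=1..k. t m - t (m - 1)) = t k - t 0" for k by (induction k) auto
  finally have Hsum: "(\<Sum>m=1..N. H m * e m) \<le> T * Mx" by (simp add: t0)
  define Qn where "Qn = Qnorm_sq \<rho> q N t x w (pw_dt N t (\<lambda>s. M0 (U s - interp_P_hat q N t x U s)))"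
  have "(\<Sum>m=1..N. R m * e m) = Qn"
    unfolding Qn_def Qnorm_sq_def R_def e_def
  proof (intro sum.cong refl arg_cong2[where f = "(*)"])
    fix m assume m: "m \<in> {1..N}"
    have "pw_dt N t (\<lambda>s. M0 (U s - interp_P_hat q N t x U s)) (node t x m i) = r m (node t x m i)"
      if i: "i \<le> q" for i
      unfolding r_def using interp_hat[OF m]
      by (intro pw_dt_eq[OF P m node_cell[OF m i], of _ "\<lambda>s. M0 (U s - ph m s)"]
          bounded_linear.has_vector_derivative[OF M0] has_vector_derivative_diff V ph') simp
    then show "Qm_inner q t x w m (r m) (r m) =
        Qm_inner q t x w m (pw_dt N t (\<lambda>s. M0 (U s - interp_P_hat q N t x U s)))
          (pw_dt N t (\<lambda>s. M0 (U s - interp_P_hat q N t x U s)))"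
      unfolding Qm_inner_def Qm_def by simp
  qed
  then have S_le: "S \<le> Qn + T * Mx"
    using Hsum unfolding S_def distrib_right sum.distrib by simp
  have S_nn: "0 \<le> S" using partial[of N] by simp
  define C where "C = C2 * (4 * C1 + 2 * C1 / \<gamma> + 1)"
  have C: "0 \<le> C" using C1 C2 pos by (simp add: C_def)
  have "inner (M0 (Ut s - interp_P q N t x U s)) (Ut s - interp_P q N t x U s) \<le> C * exp (2 * \<rho> * T) * S"
  proof (cases "s = 0")
    \<comment> \<open>The time 0 belongs to no cell; both the discrete solution and the interpolant
      take the value \<open>U 0\<close> there.\<close>
    case True
    then have "Ut s - interp_P q N t x U s = 0" using disc(2) U0 by (simp add: interp_P_def)
    then show ?thesis using C S_nn by (simp only: inner_zero_right) simp
  next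
    case False
    then obtain m where m: "m \<in> {1..N}" "s \<in> cell t m" using cell_cover[OF P, of s] s by auto
    have "inner (M0 (v m s)) (v m s) * e m \<le>
        C2 * (en (m - 1) + B m * e m + (R m + H m) * e m + J m * e m)"
      using m(2) by (intro supb[OF m(1)]) (auto simp: cell_def)
    also have "\<dots> \<le> C2 * (2 * C1 * S + 2 * C1 / \<gamma> * S + S + 2 * C1 * S)"
      using C2 cell_le[OF m(1)] by (intro mult_left_mono add_mono) auto
    also have "\<dots> = C * S" by (simp add: C_def algebra_simps)
    finally have le: "inner (M0 (v m s)) (v m s) * e m \<le> C * S" .
    have "m - 1 \<le> N" using m(1) by auto
    \<comment> \<open>Undoing the weight of the cell costs at most
      \<open>exp (2 * \<rho> * T)\<close>.\<close>
    then have "\<rho> * t (m - 1) \<le> \<rho> * T" using partition_bounds[OF P] pos by (intro mult_left_mono) auto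
    then have ee: "1 \<le> e m * exp (2 * \<rho> * T)" by (simp add: e_def flip: exp_add)
    have "inner (M0 (v m s)) (v m s) * 1 \<le> inner (M0 (v m s)) (v m s) * (e m * exp (2 * \<rho> * T))"
      by (rule mult_left_mono[OF ee nonneg])
    also have "\<dots> = (inner (M0 (v m s)) (v m s) * e m) * exp (2 * \<rho> * T)" by simp
    also have "\<dots> \<le> (C * S) * exp (2 * \<rho> * T)" by (rule mult_right_mono[OF le]) simp
    finally show ?thesis unfolding xi[OF m] by (simp add: mult_ac)
  qed
  also have "\<dots> \<le> C * exp (2 * \<rho> * T) * (Qn + T * Mx)"
    using C S_le by (intro mult_left_mono) auto
  finally show ?thesis unfolding C_def Qn_def Mx_def .
qed

theorem theorem3p9:
  fixes T \<gamma> \<rho> \<mu>0 \<mu>1 :: real and q :: nat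
  assumes "T > 0" and "\<gamma> > 0" and "\<rho> > 0"
  shows "\<exists>C\<ge>0. \<forall>(M0 :: 'h::{real_inner, complete_space} \<Rightarrow> 'h) M1 D A \<rho>0 N t x w F U Ut.
    bounded_linear M0 \<and> bounded_linear M1 \<and> onorm M0 = \<mu>0 \<and> onorm M1 = \<mu>1 \<and>
    selfadjoint_op UNIV M0 \<and> skew_selfadjoint_op D A \<and>
    0 < \<rho>0 \<and> \<rho>0 \<le> \<rho> \<and>
    (\<forall>r\<ge>\<rho>0. \<forall>h. inner (r *\<^sub>R M0 h + M1 h) h \<ge> \<gamma> * inner h h) \<and>
    is_partition T N t \<and>
    (\<forall>m\<in>{1..N}. gauss_radau \<rho> (step t m) q (x m) (w m)) \<and>
    F \<in> Hkw 2 \<rho> \<and> continuous_on UNIV F \<and>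
    U \<in> Hkw 2 \<rho> \<and> continuous_on UNIV U \<and> solves_evo \<rho> M0 M1 D A F U \<and>
    discrete_solution q N t x w M0 M1 D A F (right_lim U 0) Ut \<and> Ut 0 = right_lim U 0
    \<longrightarrow>
    (let \<xi> = (\<lambda>s. Ut s - interp_P q N t x U s);
         \<eta> = (\<lambda>s. U s - interp_P q N t x U s)
     in (SUP s\<in>{0..T}. inner (M0 (\<xi> s)) (\<xi> s))
        \<le> C * exp (2 * \<rho> * T) *
           (Qnorm_sq \<rho> q N t x w (pw_dt N t (\<lambda>s. M0 (U s - interp_P_hat q N t x U s)))
            + T * Max ((\<lambda>m. (norm (M0 (right_lim \<eta> (t (m - 1)))))\<^sup>2
                              * exp (- 2 * \<rho> * t (m - 1))) ` {1..N})))"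
proof (intro exI conjI allI impI)
  define C1 where "C1 = (1 + 4 * \<rho>\<^sup>2 * (theta_const \<rho> T q)\<^sup>2) / \<gamma>"
  \<comment> \<open>\<open>C\<close> is fixed before the operators, when \<mu>0 and \<mu>1 are
    arbitrary reals. The absolute values make it nonnegative and disappear once the parameters are
    known to be operator norms.\<close>
  define C where "C = sup_const \<rho> T q \<bar>\<mu>0\<bar> \<bar>\<mu>1\<bar> * (4 * C1 + 2 * C1 / \<gamma> + 1)"
  have "0 \<le> C1" using assms by (simp add: C1_def)
  then show "0 \<le> C"
    unfolding C_def using assms by (intro mult_nonneg_nonneg sup_const_nonneg) auto
  fix M0 M1 A :: "'h \<Rightarrow> 'h" and D \<rho>0 N t x w and F U Ut :: "real \<Rightarrow> 'h"
  assume *: "bounded_linear M0 \<and> bounded_linear M1 \<and> onorm M0 = \<mu>0 \<and> onorm M1 = \<mu>1 \<and>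
    selfadjoint_op UNIV M0 \<and> skew_selfadjoint_op D A \<and>
    0 < \<rho>0 \<and> \<rho>0 \<le> \<rho> \<and>
    (\<forall>r\<ge>\<rho>0. \<forall>h. inner (r *\<^sub>R M0 h + M1 h) h \<ge> \<gamma> * inner h h) \<and>
    is_partition T N t \<and>
    (\<forall>m\<in>{1..N}. gauss_radau \<rho> (step t m) q (x m) (w m)) \<and>
    F \<in> Hkw 2 \<rho> \<and> continuous_on UNIV F \<and>
    U \<in> Hkw 2 \<rho> \<and> continuous_on UNIV U \<and> solves_evo \<rho> M0 M1 D A F U \<and>
    discrete_solution q N t x w M0 M1 D A F (right_lim U 0) Ut \<and> Ut 0 = right_lim U 0"
  then have hyps: "bounded_linear M0" "bounded_linear M1" "selfadjoint_op UNIV M0"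
    "skew_selfadjoint_op D A" "\<rho>0 \<le> \<rho>" "is_partition T N t" "continuous_on UNIV F"
    "U \<in> Hkw 2 \<rho>" "continuous_on UNIV U" "solves_evo \<rho> M0 M1 D A F U"
    "discrete_solution q N t x w M0 M1 D A F (right_lim U 0) Ut" "Ut 0 = right_lim U 0"
    by auto
  have \<mu>: "\<bar>\<mu>0\<bar> = onorm M0" "\<bar>\<mu>1\<bar> = onorm M1"
    using * onorm_pos_le by (metis abs_of_nonneg)+
  show "let \<xi> = (\<lambda>s. Ut s - interp_P q N t x U s);
         \<eta> = (\<lambda>s. U s - interp_P q N t x U s)
     in (SUP s\<in>{0..T}. inner (M0 (\<xi> s)) (\<xi> s))
        \<le> C * exp (2 * \<rho> * T) *
           (Qnorm_sq \<rho> q N t x w (pw_dt N t (\<lambda>s. M0 (U s - interp_P_hat q N t x U s)))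
            + T * Max ((\<lambda>m. (norm (M0 (right_lim \<eta> (t (m - 1)))))\<^sup>2
                              * exp (- 2 * \<rho> * t (m - 1))) ` {1..N}))"
    unfolding Let_def C_def C1_def \<mu>
    by (intro cSUP_least error_estimate[OF assms hyps(1-5) _ hyps(6) _ hyps(7-12)])
      (use assms * in auto)
qed

end
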